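(* Let $1<p<\infty$ and $\alpha\ge0$. The Banach space $\mathcal{T}_p^{(\alpha)}(|t|^\alpha)$ is a module for the algebra $\mathcal{T}_1^{(\alpha)}(|t|^\alpha)$ under the convolution $f*g(t)=\int_{-\infty}^\infty f(t-s)g(s)\,ds$, and there is a constant $C_{\alpha,p}$ such that $$|||f*g|||_{\alpha,p}\le C_{\alpha,p}\,|||f|||_{\alpha,p}\,|||g|||_{\alpha,1},\qquad f\in\mathcal{T}_p^{(\alpha)}(|t|^\alpha),\ g\in\mathcal{T}_1^{(\alpha)}(|t|^\alpha).$$
   Context: Let $\mathcal{S}$ be the Schwartz class on $\mathbb{R}$. For $\alpha>0$, $f\in\mathcal{S}$, $x\in\mathbb{R}$ and an integer $n>\alpha$ (with $n=[\alpha]+1$): $W_+^{-\alpha}f(x)=\frac{1}{\Gamma(\alpha)}\int_x^\infty(s-x)^{\alpha-1}f(s)\,ds$, $W_+^\alpha f(x)=(-1)^n\frac{d^n}{dx^n}W_+^{-(n-\alpha)}f(x)$, $W_-^{-\alpha}f(x)=\frac{1}{\Gamma(\alpha)}\int_{-\infty}^x(x-t)^{\alpha-1}f(t)\,dt$, $W_-^{\alpha}f(x)=\frac{1}{\Gamma(n-\alpha)}\frac{d^n}{dx^n}\int_{-\infty}^x(x-t)^{n-\alpha-1}f(t)\,dt$, and $W_\pm^0f=f$. Set $W_0^\alpha f(t)=W_-^\alpha f(t)$ for $t<0$ and $W_0^\alpha f(t)=e^{i\pi\alpha}W_+^\alpha f(t)$ for $t>0$. For $1\le p<\infty$, $\mathcal{T}_p^{(\alpha)}(|t|^\alpha)$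 is the completion of $\mathcal{S}$ in the norm $|||f|||_{\alpha,p}=\frac{1}{\Gamma(\alpha+1)}\left(\int_{-\infty}^\infty(|W_0^\alpha f(t)|\,|t|^\alpha)^p\,dt\right)^{1/p}$; it embeds continuously into $L^p(\mathbb{R})$ (for $\alpha=0$ it is $L^p(\mathbb{R})$). $\mathcal{T}_1^{(\alpha)}(|t|^\alpha)$ is a Banach algebra under this convolution. *)

theory Defs
  imports "HOL-Analysis.Analysis"
begin

definition vderiv_iter :: "nat \<Rightarrow> (real \<Rightarrow> complex) \<Rightarrow> real \<Rightarrow> complex" where
  "vderiv_iter m f = ((\<lambda>g x. vector_derivative g (at x)) ^^ m) f"

definition schwartz :: "(real \<Rightarrow> complex) set" where
  "schwartz = {f. \<forall>m. (\<forall>x. vderiv_iter m f differentiable (at x)) \<and>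
                 (\<forall>k::nat. bounded (range (\<lambda>x. (x ^ k) *\<^sub>R vderiv_iter m f x)))}"

definition weyl_plus_int :: "real \<Rightarrow> (real \<Rightarrow> complex) \<Rightarrow> real \<Rightarrow> complex" where
  "weyl_plus_int a f x = complex_of_real (1 / Gamma a) *
     (LINT s:{x<..}|lborel. complex_of_real ((s - x) powr (a - 1)) * f s)"

definition weyl_minus_int :: "real \<Rightarrow> (real \<Rightarrow> complex) \<Rightarrow> real \<Rightarrow> complex" where
  "weyl_minus_int a f x = complex_of_real (1 / Gamma a) *
     (LINT t:{..<x}|lborel. complex_of_real ((x - t) powr (a - 1)) * f t)"

definition weyl_plus :: "real \<Rightarrow> (real \<Rightarrow> complex) \<Rightarrow> real \<Rightarrow> complex" where
  "weyl_plus a f = (if a = 0 then f else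
     (let n = nat \<lfloor>a\<rfloor> + 1 in
       (\<lambda>x. (-1) ^ n * vderiv_iter n (weyl_plus_int (real n - a) f) x)))"

definition weyl_minus :: "real \<Rightarrow> (real \<Rightarrow> complex) \<Rightarrow> real \<Rightarrow> complex" where
  "weyl_minus a f = (if a = 0 then f else
     (let n = nat \<lfloor>a\<rfloor> + 1 in vderiv_iter n (weyl_minus_int (real n - a) f)))"

(* W_0^a f; the value at t = 0 is irrelevant (null set) and set to 0 *)
definition weyl0 :: "real \<Rightarrow> (real \<Rightarrow> complex) \<Rightarrow> real \<Rightarrow> complex" where
  "weyl0 a f t = (if t < 0 then weyl_minus a f t
                  else if t > 0 then exp (\<i> * complex_of_real (pi * a)) * weyl_plus a f t
                  else 0)"

definition tnorm :: "real \<Rightarrow> real \<Rightarrow> (real \<Rightarrow> complex) \<Rightarrow> real" where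
  "tnorm a p f = (1 / Gamma (a + 1)) *
     (\<integral>t. (norm (weyl0 a f t) * \<bar>t\<bar> powr a) powr p \<partial>lborel) powr (1 / p)"

definition in_Lp :: "real \<Rightarrow> (real \<Rightarrow> complex) \<Rightarrow> bool" where
  "in_Lp p f \<longleftrightarrow> f \<in> borel_measurable lborel \<and> integrable lborel (\<lambda>x. norm (f x) powr p)"

definition lp_dist :: "real \<Rightarrow> (real \<Rightarrow> complex) \<Rightarrow> (real \<Rightarrow> complex) \<Rightarrow> real" where
  "lp_dist p f g = (\<integral>x. norm (f x - g x) powr p \<partial>lborel) powr (1 / p)"

definition approx_seq :: "real \<Rightarrow> real \<Rightarrow> (real \<Rightarrow> complex) \<Rightarrow> (nat \<Rightarrow> real \<Rightarrow> complex) \<Rightarrow> bool" where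
  "approx_seq a p f F \<longleftrightarrow>
     (\<forall>n. F n \<in> schwartz) \<and>
     (\<forall>e>0. \<exists>N. \<forall>m\<ge>N. \<forall>n\<ge>N. tnorm a p (\<lambda>x. F m x - F n x) < e) \<and>
     in_Lp p f \<and> (\<lambda>n. lp_dist p (F n) f) \<longlonglongrightarrow> 0"

(* T_p^{(a)}(|t|^a): the completion of S, realised inside L^p *)
definition T_space :: "real \<Rightarrow> real \<Rightarrow> (real \<Rightarrow> complex) set" where
  "T_space a p = {f. \<exists>F. approx_seq a p f F}"

definition T_norm :: "real \<Rightarrow> real \<Rightarrow> (real \<Rightarrow> complex) \<Rightarrow> real" where
  "T_norm a p f = lim (\<lambda>n. tnorm a p ((SOME F. approx_seq a p f F) n))"

definition conv :: "(real \<Rightarrow> complex) \<Rightarrow> (real \<Rightarrow> complex) \<Rightarrow> real \<Rightarrow> complex" where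
  "conv f g t = (\<integral>s. f (t - s) * g s \<partial>lborel)"

end

theory Submission
  imports Defs
begin

text \<open>
  For Schwartz functions the Weyl derivative \<open>W\<^sub>+\<^sup>\<alpha>\<close> commutes with convolution and is inverted by the
  Weyl integral, so with \<open>F = W\<^sub>+\<^sup>\<alpha> f\<close> and \<open>G = W\<^sub>+\<^sup>\<alpha> g\<close> the value \<open>W\<^sub>+\<^sup>\<alpha>(f * g)(x) = (f * G)(x)\<close> is the
  integral of \<open>F(t) G(y) (t + y - x)\<^sub>+\<^bsup>\<alpha>-1\<^esup> / \<Gamma>(\<alpha>)\<close> over the plane. For \<open>x > 0\<close>, inclusion-exclusion over
  \<open>y \<ge> x\<close> and \<open>t \<ge> x\<close> rewrites it as
  \<open>\<integral>\<^bsub>y>x\<^esub> f(x-y) G(y) + \<integral>\<^bsub>t>x\<^esub> g(x-t) F(t) + \<integral>\<integral>\<^bsub>t,y<x\<^esub> - \<integral>\<integral>\<^bsub>t,y>x\<^esub>\<close>,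
  where only values of \<open>F\<close> and \<open>G\<close> on the positive half-line occur apart from \<open>f\<close> and \<open>g\<close> themselves. After
  multiplication by \<open>x\<^sup>\<alpha>\<close> every term is bounded by Young's inequality and by Hardy's inequality for the
  operators \<open>\<phi> \<mapsto> \<integral>\<^bsub>t>v\<^esub> (t-v)\<^bsup>\<alpha>-1\<^esup> \<phi>(t) dt\<close> and \<open>\<phi> \<mapsto> \<integral>\<^bsub>t>v\<^esub> t\<^bsup>\<alpha>-1\<^esup> \<phi>(t) dt\<close>, which also gives the embedding into
  \<open>L\<^sup>p\<close>. The negative half-line follows by reflection.

  Passing to the completion requires that the norm of an element of \<open>L\<^sup>p\<close> does not depend on the approximating
  sequence, that is, that \<open>f \<mapsto> |t|\<^sup>\<alpha> W\<^sub>0\<^sup>\<alpha> f\<close> is closable in \<open>L\<^sup>p\<close>. With \<open>N = \<alpha> + \<beta>\<close> an integer, the identity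
  \<open>\<integral>\<^bsub>v>x\<^esub> (v-x)\<^bsup>\<beta>-1\<^esup> v\<^bsup>-N\<^esup> f(v) dv = c x\<^bsup>-\<alpha>\<^esup> \<integral>\<^bsub>t>x\<^esub> (t-x)\<^bsup>N-1\<^esup> t\<^bsup>-\<beta>\<^esup> W\<^sub>+\<^sup>\<alpha> f(t) dt\<close>
  shows that the integrals of a limit against all \<open>(t-x)\<^sub>+\<^bsup>N-1\<^esup> t\<^bsup>-\<beta>\<^esup>\<close>, \<open>x > 0\<close>, vanish, and these determine it.
\<close>

section \<open>Integral inequalities in \<open>L\<^sup>p\<close>\<close>

text \<open>The norm sees W_+ on the positive half-line only, whereas W_+ of a convolution at x > 0
  involves F and G on the whole line, where the norm does not control them. Inclusion-exclusion
  removes the uncontrolled values: wherever one variable runs over the full line, its integral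
  collapses by the inversion formula to a value of f or g, and these are controlled by the embedding
  into L^p. In the two remaining regions both variables are positive, since for t, y < x the kernel
  vanishes unless t + y > x. The half-line bounds share one mechanism: once the weight is absorbed,
  the operators are superpositions of dilates u(x r), and such a dilate has p-norm r^(-1/p) times
  that of u. In the closability argument the factor v^(-N) is chosen so that the inversion v to -1/v
  preserves the shape of the kernel. Away from 0 the kernel on the left decays fast enough to be
  paired with L^p, so those pairings tend to 0. N is an integer so that the test functions are
  truncated polynomials, which finitely many differentiations in x reduce to indicators of
  rays.\<close>

definition epow :: "ennreal \<Rightarrow> real \<Rightarrow> ennreal" where
  "epow x p = (if x = top then top else ennreal (enn2real x powr p))"

lemma epow_top [simp]: "epow top p = top"
  by (simp add: epow_def)

lemma epow_ennreal [simp]: "0 \<le> r \<Longrightarrow> epow (ennreal r) p = ennreal (r powr p)"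
  by (simp add: epow_def)

lemma epow_zero [simp]: "epow 0 p = 0"
  by (simp add: epow_def)

lemma epow_one [simp]: "epow x 1 = x"
  by (cases x) auto

lemma epow_mono: "x \<le> y \<Longrightarrow> 0 \<le> p \<Longrightarrow> epow x p \<le> epow y p"
  by (cases x; cases y) (auto simp: top_unique intro!: ennreal_leI powr_mono2)

text \<open>The conventions \<open>epow top p = top\<close> and \<open>epow 0 p = 0\<close> for
  every exponent make both sides agree even for the product of \<open>top\<close> and 0, so scalars
  leave a p-th power without case distinctions.\<close>

lemma epow_mult: "epow (x * y) p = epow x p * epow y p"
  by (cases x; cases y)
     (auto simp: powr_mult ennreal_mult[symmetric] ennreal_top_mult ennreal_mult_top)

lemma epow_powr: "epow (epow x p) q = epow x (p * q)"
  by (cases x) (auto simp: powr_powr)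

lemma borel_measurable_epow [measurable (raw)]:
  assumes [measurable]: "f \<in> borel_measurable M"
  shows "(\<lambda>x. epow (f x) p) \<in> borel_measurable M"
  unfolding epow_def by measurable

lemma epow_less_top_iff [simp]: "epow x p < top \<longleftrightarrow> x < top"
  by (cases x) auto

lemma epow_add_le:
  assumes "0 \<le> p"
  shows "epow (x + y) p \<le> ennreal (2 powr p) * (epow x p + epow y p)"
proof -
  have "epow (x + y) p \<le> epow (ennreal 2 * max x y) p"
  proof (rule epow_mono)
    have "x + y \<le> max x y + max x y" by (intro add_mono) auto
    then show "x + y \<le> ennreal 2 * max x y" by (simp add: mult_2)
  qed fact
  also have "\<dots> = ennreal (2 powr p) * epow (max x y) p"
    using epow_ennreal[of 2 p] by (simp add: epow_mult)
  also have "\<dots> \<le> ennreal (2 powr p) * (epow x p + epow y p)"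
    by (intro mult_left_mono) (auto simp: max_def)
  finally show ?thesis .
qed

section \<open>Jensen's and Minkowski's inequalities for nonnegative integrals\<close>

lemma powr_tangent:
  fixes u c p :: real
  assumes "1 \<le> p" "0 \<le> u" "0 < c"
  shows "p * c powr (p - 1) * u \<le> u powr p + (p - 1) * c powr p"
proof (cases "u = 0")
  case True
  then show ?thesis using assms by simp
next
  case False
  then have u: "0 < u" using assms by simp
  have "(u powr p) powr (1/p) * (c powr p) powr (1 - 1/p) \<le> 1/p * u powr p + (1 - 1/p) * c powr p"
    by (rule Youngs_inequality_0) (use assms u in auto)
  moreover have "(u powr p) powr (1/p) = u"
    using assms u by (simp add: powr_powr)
  moreover have "(c powr p) powr (1 - 1/p) = c powr (p - 1)"
    using assms by (simp add: powr_powr algebra_simps)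
  ultimately have "p * (u * c powr (p - 1)) \<le> p * (1/p * u powr p + (1 - 1/p) * c powr p)"
    using assms by (intro mult_left_mono) auto
  also have "\<dots> = u powr p + (p - 1) * c powr p"
    using assms by (simp add: field_simps)
  finally show ?thesis by (simp add: mult_ac)
qed

lemma epow_tangent:
  assumes "1 \<le> p" "0 < c"
  shows "ennreal (p * c powr (p - 1)) * u \<le> epow u p + ennreal ((p - 1) * c powr p)"
  using powr_tangent[OF assms(1) _ assms(2)] assms
  by (cases u) (auto simp: ennreal_mult[symmetric] ennreal_plus[symmetric]
      simp del: ennreal_plus intro!: ennreal_leI)

text \<open>Jensen's inequality for a weight of total mass at most \<open>m\<close>, infinite
  integrals allowed. The tangent inequality for the p-th power at a point \<open>c\<close> is
  integrated and \<open>c\<close> is optimised afterwards, so \<open>w\<close> need not be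
  normalised to a probability density.\<close>

lemma epow_nn_integral_le:
  assumes p: "1 \<le> p" and [measurable]: "w \<in> borel_measurable N" "u \<in> borel_measurable N"
    and w: "(\<integral>\<^sup>+r. w r \<partial>N) \<le> ennreal m" and m: "0 \<le> m"
  shows "epow (\<integral>\<^sup>+r. w r * u r \<partial>N) p \<le> ennreal (m powr (p - 1)) * (\<integral>\<^sup>+r. w r * epow (u r) p \<partial>N)"
proof -
  let ?S = "\<integral>\<^sup>+r. w r * u r \<partial>N" and ?E = "\<integral>\<^sup>+r. w r * epow (u r) p \<partial>N"
  consider "?S = 0" | "m = 0" "?S \<noteq> 0" | "0 < m" "?S \<noteq> 0" using m by fastforce
  then show ?thesis
  proof cases
    case 2
    then have "(\<integral>\<^sup>+r. w r \<partial>N) = 0" using w by simp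
    then have "AE r in N. w r = 0" by (simp add: nn_integral_0_iff_AE)
    then have "?S = (\<integral>\<^sup>+r. 0 \<partial>N)" by (intro nn_integral_cong_AE) auto
    with 2 show ?thesis by simp
  next
    case 3
    have main: "ennreal (p * c powr (p - 1)) * ?S \<le> ?E + ennreal ((p - 1) * c powr p * m)" if c: "0 < c" for c
    proof -
      have "ennreal (p * c powr (p - 1)) * ?S = (\<integral>\<^sup>+r. w r * (ennreal (p * c powr (p - 1)) * u r) \<partial>N)"
        by (subst nn_integral_cmult[symmetric]) (auto simp: mult_ac)
      also have "\<dots> \<le> (\<integral>\<^sup>+r. w r * (epow (u r) p + ennreal ((p - 1) * c powr p)) \<partial>N)"
        by (intro nn_integral_mono mult_left_mono epow_tangent p c) auto
      also have "\<dots> = ?E + ennreal ((p - 1) * c powr p) * (\<integral>\<^sup>+r. w r \<partial>N)"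
        by (simp add: distrib_left nn_integral_add nn_integral_multc mult.commute)
      also have "\<dots> \<le> ?E + ennreal ((p - 1) * c powr p) * ennreal m"
        by (intro add_left_mono mult_left_mono w) auto
      also have "\<dots> = ?E + ennreal ((p - 1) * c powr p * m)"
        using p m by (simp add: ennreal_mult)
      finally show ?thesis .
    qed
    show ?thesis
    proof (cases ?S)
      case top
      \<comment> \<open>Any positive tangent point shows that an infinite left integral forces an
        infinite right one.\<close>
      with main[of 1] p have "?E = top"
        by (auto simp: ennreal_mult_top top_unique)
      with 3 show ?thesis by (simp add: ennreal_mult_top)
    next
      case (real s)
      then have s: "0 < s" using 3 by (cases "s = 0") auto
      show ?thesis
      proof (cases ?E)
        case top
        with 3 show ?thesis by (simp add: ennreal_mult_top)
      next
        case (real e)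
        \<comment> \<open>The optimal tangent point is the mean value \<open>s/m\<close>.\<close>
        have "ennreal (p * (s/m) powr (p - 1)) * ennreal s \<le> ennreal e + ennreal ((p - 1) * (s/m) powr p * m)"
          using main[of "s/m"] s 3 \<open>?S = ennreal s\<close> real by simp
        then have "p * (s/m) powr (p - 1) * s \<le> e + (p - 1) * (s/m) powr p * m"
          using p s 3 real by (simp add: ennreal_mult[symmetric] ennreal_plus[symmetric] del: ennreal_plus)
        moreover have "(s/m) powr (p - 1) * s = (s/m) powr p * m"
          using s 3 by (simp add: powr_diff field_simps)
        ultimately have "(s/m) powr p * m \<le> e" by (simp add: algebra_simps)
        moreover have "(s/m) powr p * m = s powr p / m powr (p - 1)"
          using s 3 by (simp add: powr_divide powr_diff)
        ultimately have "s powr p / m powr (p - 1) \<le> e" by (simp only:)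
        then have "s powr p \<le> m powr (p - 1) * e"
          using 3 by (simp add: pos_divide_le_eq mult.commute)
        then show ?thesis
          using \<open>?S = ennreal s\<close> s real by (simp add: ennreal_mult[symmetric])
      qed
    qed
  qed simp
qed

text \<open>Jensen at each \<open>x\<close>, then Tonelli. The parameter space is arbitrary, so the
  same lemma serves translates, dilates and, over a two-point space, the triangle inequality. The
  bound \<open>A\<close> is demanded only where the weight is nonzero, because dilates are
  controlled only for the parameters in the support of the weight.\<close>

lemma (in sigma_finite_measure) minkowski_nn_integral_le:
  fixes u :: "'a \<Rightarrow> real \<Rightarrow> ennreal"
  assumes p: "1 \<le> p" and [measurable]: "w \<in> borel_measurable M" "case_prod u \<in> borel_measurable (M \<Otimes>\<^sub>M lborel)"
    and w: "(\<integral>\<^sup>+r. w r \<partial>M) \<le> ennreal m" and m: "0 \<le> m"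
    and A: "\<And>r. r \<in> space M \<Longrightarrow> w r \<noteq> 0 \<Longrightarrow> (\<integral>\<^sup>+x. epow (u r x) p \<partial>lborel) \<le> A"
  shows "(\<integral>\<^sup>+x. epow (\<integral>\<^sup>+r. w r * u r x \<partial>M) p \<partial>lborel) \<le> ennreal (m powr p) * A"
proof -
  interpret P: pair_sigma_finite M lborel by standard
  have "(\<integral>\<^sup>+x. epow (\<integral>\<^sup>+r. w r * u r x \<partial>M) p \<partial>lborel) \<le>
        (\<integral>\<^sup>+x. ennreal (m powr (p - 1)) * (\<integral>\<^sup>+r. w r * epow (u r x) p \<partial>M) \<partial>lborel)"
    by (intro nn_integral_mono epow_nn_integral_le p w m) auto
  also have "\<dots> = ennreal (m powr (p - 1)) * (\<integral>\<^sup>+x. (\<integral>\<^sup>+r. w r * epow (u r x) p \<partial>M) \<partial>lborel)"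
    by (rule nn_integral_cmult) simp
  also have "(\<integral>\<^sup>+x. (\<integral>\<^sup>+r. w r * epow (u r x) p \<partial>M) \<partial>lborel)
      = (\<integral>\<^sup>+r. (\<integral>\<^sup>+x. w r * epow (u r x) p \<partial>lborel) \<partial>M)"
    by (rule P.Fubini') measurable
  also have "\<dots> = (\<integral>\<^sup>+r. w r * (\<integral>\<^sup>+x. epow (u r x) p \<partial>lborel) \<partial>M)"
    by (intro nn_integral_cong nn_integral_cmult) measurable
  also have "\<dots> \<le> (\<integral>\<^sup>+r. w r * A \<partial>M)"
  proof (intro nn_integral_mono)
    fix r assume "r \<in> space M"
    then show "w r * (\<integral>\<^sup>+x. epow (u r x) p \<partial>lborel) \<le> w r * A"
      using A[of r] by (cases "w r = 0") (auto intro: mult_left_mono)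
  qed
  also have "\<dots> = (\<integral>\<^sup>+r. w r \<partial>M) * A"
    by (rule nn_integral_multc) measurable
  also have "\<dots> \<le> ennreal m * A"
    by (intro mult_right_mono w) auto
  finally have "(\<integral>\<^sup>+x. epow (\<integral>\<^sup>+r. w r * u r x \<partial>M) p \<partial>lborel) \<le> ennreal (m powr (p - 1)) * (ennreal m * A)"
    by (simp add: mult_left_mono)
  also have "\<dots> = ennreal (m powr (p - 1) * m) * A"
    using m by (simp add: ennreal_mult mult.assoc)
  also have "m powr (p - 1) * m = m powr p"
    using m by (cases "m = 0") (auto simp: powr_diff)
  finally show ?thesis .
qed

section \<open>Translation invariance and Young's inequality\<close>

lemma nn_integral_lborel_shift:
  fixes f :: "real \<Rightarrow> ennreal"
  assumes [measurable]: "f \<in> borel_measurable borel"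
  shows "(\<integral>\<^sup>+x. f (x - y) \<partial>lborel) = (\<integral>\<^sup>+x. f x \<partial>lborel)"
    and "(\<integral>\<^sup>+x. f (y - x) \<partial>lborel) = (\<integral>\<^sup>+x. f x \<partial>lborel)"
    and "(\<integral>\<^sup>+x. f (- x) \<partial>lborel) = (\<integral>\<^sup>+x. f x \<partial>lborel)"
  using nn_integral_real_affine[of f 1 "-y"] nn_integral_real_affine[of f "-1" y]
    nn_integral_real_affine[of f "-1" 0] by simp_all

lemma young_nn_integral:
  fixes u w :: "real \<Rightarrow> ennreal"
  assumes p: "1 \<le> p" and [measurable]: "w \<in> borel_measurable borel" "u \<in> borel_measurable borel"
    and w: "(\<integral>\<^sup>+y. w y \<partial>lborel) \<le> ennreal m" and m: "0 \<le> m"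
  shows "(\<integral>\<^sup>+x. epow (\<integral>\<^sup>+y. w y * u (x - y) \<partial>lborel) p \<partial>lborel)
    \<le> ennreal (m powr p) * (\<integral>\<^sup>+x. epow (u x) p \<partial>lborel)"
proof (rule lborel.minkowski_nn_integral_le[OF p _ _ w m])
  show "(\<integral>\<^sup>+x. epow (u (x - r)) p \<partial>lborel) \<le> (\<integral>\<^sup>+x. epow (u x) p \<partial>lborel)" for r
    by (subst nn_integral_lborel_shift(1)[of "\<lambda>x. epow (u x) p"]) auto
qed measurable

lemma nn_convolution_commute:
  fixes u w :: "real \<Rightarrow> ennreal"
  assumes [measurable]: "w \<in> borel_measurable borel" "u \<in> borel_measurable borel"
  shows "(\<integral>\<^sup>+y. w y * u (x - y) \<partial>lborel) = (\<integral>\<^sup>+y. u y * w (x - y) \<partial>lborel)"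
  using nn_integral_lborel_shift(2)[of "\<lambda>y. w y * u (x - y)" x] by (simp add: mult.commute)

text \<open>The sum is the superposition a (u/a) + b (v/b) over a two-point space with weights
  \<open>a\<close> and \<open>b\<close>, whose members have norm at most 1. Strict positivity of
  \<open>a\<close> and \<open>b\<close> permits the division.\<close>

lemma minkowski_triangle_nn:
  fixes u v :: "real \<Rightarrow> ennreal"
  assumes p: "1 \<le> p" and [measurable]: "u \<in> borel_measurable borel" "v \<in> borel_measurable borel"
    and u: "(\<integral>\<^sup>+x. epow (u x) p \<partial>lborel) \<le> ennreal (a powr p)" and a: "0 < a"
    and v: "(\<integral>\<^sup>+x. epow (v x) p \<partial>lborel) \<le> ennreal (b powr p)" and b: "0 < b"
  shows "(\<integral>\<^sup>+x. epow (u x + v x) p \<partial>lborel) \<le> ennreal ((a + b) powr p)"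
proof -
  let ?M = "count_space (UNIV :: bool set)"
  interpret M: sigma_finite_measure ?M
    by (rule sigma_finite_measure_count_space_countable) simp
  define w where "w = (\<lambda>r. if r then ennreal a else ennreal b)"
  define f where "f = (\<lambda>r x. if r then ennreal (1/a) * u x else ennreal (1/b) * v x)"
  have [measurable]: "case_prod f \<in> borel_measurable (?M \<Otimes>\<^sub>M lborel)"
    unfolding f_def by measurable
  have norm: "(\<integral>\<^sup>+x. epow (ennreal (1/c) * g x) p \<partial>lborel) \<le> 1"
    if [measurable]: "g \<in> borel_measurable borel" and c: "0 < c"
      and g: "(\<integral>\<^sup>+x. epow (g x) p \<partial>lborel) \<le> ennreal (c powr p)" for c g
  proof -
    have "(\<integral>\<^sup>+x. epow (ennreal (1/c) * g x) p \<partial>lborel) = ennreal ((1/c) powr p) * (\<integral>\<^sup>+x. epow (g x) p \<partial>lborel)"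
      using c by (simp add: epow_mult nn_integral_cmult)
    also have "\<dots> \<le> ennreal ((1/c) powr p) * ennreal (c powr p)"
      by (intro mult_left_mono g) auto
    also have "\<dots> = 1" using c by (simp add: ennreal_mult[symmetric] powr_divide)
    finally show ?thesis .
  qed
  have "(\<integral>\<^sup>+x. epow (\<integral>\<^sup>+r. w r * f r x \<partial>?M) p \<partial>lborel) \<le> ennreal ((a + b) powr p) * 1"
  proof (rule M.minkowski_nn_integral_le[OF p])
    show "(\<integral>\<^sup>+r. w r \<partial>?M) \<le> ennreal (a + b)"
      using a b by (simp add: nn_integral_count_space_finite w_def UNIV_bool add.commute)
    show "(\<integral>\<^sup>+x. epow (f r x) p \<partial>lborel) \<le> 1" for r
      using norm[OF _ a u] norm[OF _ b v] by (cases r) (auto simp: f_def)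
  qed (use a b in auto)
  also have "(\<lambda>x. \<integral>\<^sup>+r. w r * f r x \<partial>?M) = (\<lambda>x. u x + v x)"
    using a b by (auto simp: nn_integral_count_space_finite w_def f_def UNIV_bool add.commute
        mult.assoc[symmetric] ennreal_mult[symmetric])
  finally show ?thesis by simp
qed

section \<open>The p-norm of complex-valued functions\<close>

definition lpn :: "real \<Rightarrow> (real \<Rightarrow> complex) \<Rightarrow> real" where
  "lpn p u = (\<integral>x. norm (u x) powr p \<partial>lborel) powr (1 / p)"

lemma lpn_nonneg [simp]: "0 \<le> lpn p u"
  by (simp add: lpn_def)

lemma in_Lp_measurable: "in_Lp p u \<Longrightarrow> u \<in> borel_measurable borel"
  by (simp add: in_Lp_def)

lemma nn_integral_eq_lpn:
  assumes "in_Lp p u" "0 < p"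
  shows "(\<integral>\<^sup>+x. epow (ennreal (norm (u x))) p \<partial>lborel) = ennreal (lpn p u powr p)"
  using assms by (simp add: in_Lp_def lpn_def powr_powr nn_integral_eq_integral)

text \<open>The Bochner integral in \<open>lpn\<close> is 0 for a function that is not integrable,
  so a bound on \<open>lpn\<close> alone means little. Membership and bound are therefore derived
  together from the nonnegative integral.\<close>

lemma lpn_leI:
  assumes [measurable]: "u \<in> borel_measurable borel" and p: "0 < p" and c: "0 \<le> c"
    and le: "(\<integral>\<^sup>+x. epow (ennreal (norm (u x))) p \<partial>lborel) \<le> ennreal (c powr p)"
  shows in_LpI: "in_Lp p u" and "lpn p u \<le> c"
proof -
  have le': "(\<integral>\<^sup>+x. ennreal (norm (u x) powr p) \<partial>lborel) \<le> ennreal (c powr p)"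
    using le by simp
  then show "in_Lp p u"
    unfolding in_Lp_def by (auto intro!: integrableI_bounded simp: less_top[symmetric] top_unique)
  from nn_integral_eq_lpn[OF this p] le have "lpn p u powr p \<le> c powr p" by simp
  then show "lpn p u \<le> c"
    using p c powr_less_mono2[of p c "lpn p u"] by fastforce
qed

lemma lpn_triangle:
  assumes u: "in_Lp p u" and v: "in_Lp p v" and p: "1 \<le> p"
  shows in_Lp_add: "in_Lp p (\<lambda>x. u x + v x)" and "lpn p (\<lambda>x. u x + v x) \<le> lpn p u + lpn p v"
proof -
  have [measurable]: "u \<in> borel_measurable borel" "v \<in> borel_measurable borel"
    using u v by (auto simp: in_Lp_def)
  \<comment> \<open>The slack \<open>e\<close> keeps both radii positive when a norm vanishes; it is
    sent to 0 at the end.\<close>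
  have main: "(\<integral>\<^sup>+x. epow (ennreal (norm (u x + v x))) p \<partial>lborel) \<le> ennreal ((lpn p u + lpn p v + e) powr p)"
    if "0 < e" for e
  proof -
    have "(\<integral>\<^sup>+x. epow (ennreal (norm (u x + v x))) p \<partial>lborel)
        \<le> (\<integral>\<^sup>+x. epow (ennreal (norm (u x)) + ennreal (norm (v x))) p \<partial>lborel)"
      using p by (intro nn_integral_mono epow_mono)
         (auto simp: ennreal_plus[symmetric] norm_triangle_ineq simp del: ennreal_plus intro!: ennreal_leI)
    also have "\<dots> \<le> ennreal (((lpn p u + e/2) + (lpn p v + e/2)) powr p)"
    proof (rule minkowski_triangle_nn[OF p])
      show "(\<integral>\<^sup>+x. epow (ennreal (norm (u x))) p \<partial>lborel) \<le> ennreal ((lpn p u + e/2) powr p)"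
        using that p by (subst nn_integral_eq_lpn[OF u]) (auto intro!: ennreal_leI powr_mono2)
      show "(\<integral>\<^sup>+x. epow (ennreal (norm (v x))) p \<partial>lborel) \<le> ennreal ((lpn p v + e/2) powr p)"
        using that p by (subst nn_integral_eq_lpn[OF v]) (auto intro!: ennreal_leI powr_mono2)
    qed (use that in \<open>auto intro: add_nonneg_pos\<close>)
    finally show ?thesis by (simp add: algebra_simps)
  qed
  show "in_Lp p (\<lambda>x. u x + v x)"
    by (rule in_LpI[OF _ _ _ main[of 1]]) (use p in auto)
  show "lpn p (\<lambda>x. u x + v x) \<le> lpn p u + lpn p v"
  proof (rule field_le_epsilon)
    fix e :: real assume "0 < e"
    then show "lpn p (\<lambda>x. u x + v x) \<le> lpn p u + lpn p v + e"
      by (intro lpn_leI(2)[OF _ _ _ main]) (use p in auto)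
  qed
qed

lemma in_Lp_scale:
  assumes "in_Lp p u" "0 < p"
  shows "in_Lp p (\<lambda>x. c * u x)" "lpn p (\<lambda>x. c * u x) = norm c * lpn p u"
  using assms by (auto simp: in_Lp_def lpn_def norm_mult powr_mult powr_powr)

lemma in_Lp_diff:
  assumes "in_Lp p u" "in_Lp p v" "1 \<le> p"
  shows "in_Lp p (\<lambda>x. u x - v x)"
  using in_Lp_add[OF assms(1) in_Lp_scale(1)[OF assms(2), of "-1"]] assms by simp

lemma lpn_minus_commute: "lpn p (\<lambda>x. u x - v x) = lpn p (\<lambda>x. v x - u x)"
  by (simp add: lpn_def norm_minus_commute)

lemma lpn_diff_triangle:
  assumes "in_Lp p u" "in_Lp p v" "in_Lp p w" "1 \<le> p"
  shows "lpn p (\<lambda>x. u x - w x) \<le> lpn p (\<lambda>x. u x - v x) + lpn p (\<lambda>x. v x - w x)"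
  using lpn_triangle(2)[OF in_Lp_diff[OF assms(1,2,4)] in_Lp_diff[OF assms(2,3,4)] assms(4)] by simp

lemma lpn_diff_ineq:
  assumes "in_Lp p u" "in_Lp p v" "1 \<le> p"
  shows "\<bar>lpn p u - lpn p v\<bar> \<le> lpn p (\<lambda>x. u x - v x)"
  using lpn_triangle(2)[OF in_Lp_diff[OF assms] assms(2,3)]
    lpn_triangle(2)[OF in_Lp_diff[OF assms(2,1,3)] assms(1,3)]
  by (simp add: lpn_minus_commute[of p u v])

section \<open>Convolution and Schwartz functions\<close>

lemma conv_measurable [measurable (raw)]:
  assumes [measurable]: "f \<in> borel_measurable borel" "g \<in> borel_measurable borel"
  shows "conv f g \<in> borel_measurable borel"
  unfolding conv_def[abs_def] by measurable

lemma norm_integral_le_nn_integral: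
  fixes f :: "'a \<Rightarrow> 'b :: {banach, second_countable_topology}"
  shows "ennreal (norm (integral\<^sup>L M f)) \<le> (\<integral>\<^sup>+x. ennreal (norm (f x)) \<partial>M)"
  by (cases "integrable M f") (auto intro: integral_norm_bound_ennreal simp: not_integrable_integral_eq)

text \<open>This holds at every \<open>t\<close>: where the defining integral diverges,
  \<open>conv\<close> has the value 0.\<close>

lemma norm_conv_le:
  "ennreal (norm (conv f g t)) \<le> (\<integral>\<^sup>+s. ennreal (norm (g s)) * ennreal (norm (f (t - s))) \<partial>lborel)"
  unfolding conv_def
  by (rule order_trans[OF norm_integral_le_nn_integral])
     (auto simp: norm_mult ennreal_mult[symmetric] mult.commute)

lemma lborel_integral_shift:
  fixes f :: "real \<Rightarrow> complex"
  shows "(\<integral>x. f (x - y) \<partial>lborel) = (\<integral>x. f x \<partial>lborel)"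
    and "(\<integral>x. f (y - x) \<partial>lborel) = (\<integral>x. f x \<partial>lborel)"
    and "(\<integral>x. f (- x) \<partial>lborel) = (\<integral>x. f x \<partial>lborel)"
  using lborel_integral_real_affine[of 1 f "-y"] lborel_integral_real_affine[of "-1" f y]
    lborel_integral_real_affine[of "-1" f 0] by simp_all

lemma conv_commute: "conv f g = conv g f"
  using lborel_integral_shift(2)[of "\<lambda>s. f (t - s) * g s" t for t]
  by (auto simp: conv_def[abs_def] mult.commute fun_eq_iff)

lemma conv_reflect: "conv (\<lambda>x. f (- x)) (\<lambda>x. g (- x)) t = conv f g (- t)"
  unfolding conv_def using lborel_integral_shift(3)[of "\<lambda>s. f (- t - s) * g s"]
  by (simp add: algebra_simps)

lemma nn_conv_assoc:
  fixes f g h :: "real \<Rightarrow> ennreal"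
  assumes [measurable]: "f \<in> borel_measurable borel" "g \<in> borel_measurable borel" "h \<in> borel_measurable borel"
  shows "(\<integral>\<^sup>+r. h r * (\<integral>\<^sup>+s. g s * f (t - r - s) \<partial>lborel) \<partial>lborel)
    = (\<integral>\<^sup>+s. (\<integral>\<^sup>+r. h r * g (s - r) \<partial>lborel) * f (t - s) \<partial>lborel)"
proof -
  have "(\<integral>\<^sup>+r. h r * (\<integral>\<^sup>+s. g s * f (t - r - s) \<partial>lborel) \<partial>lborel)
      = (\<integral>\<^sup>+r. h r * (\<integral>\<^sup>+s. g (s - r) * f (t - s) \<partial>lborel) \<partial>lborel)"
  proof -
    have "(\<integral>\<^sup>+s. g s * f (t - r - s) \<partial>lborel) = (\<integral>\<^sup>+s. g (s - r) * f (t - s) \<partial>lborel)" for r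
      using nn_integral_lborel_shift(1)[of "\<lambda>s. g s * f (t - r - s)" r] by (simp add: algebra_simps)
    then show ?thesis by simp
  qed
  also have "\<dots> = (\<integral>\<^sup>+r. (\<integral>\<^sup>+s. h r * (g (s - r) * f (t - s)) \<partial>lborel) \<partial>lborel)"
    by (intro nn_integral_cong nn_integral_cmult[symmetric]) measurable
  also have "\<dots> = (\<integral>\<^sup>+s. (\<integral>\<^sup>+r. h r * (g (s - r) * f (t - s)) \<partial>lborel) \<partial>lborel)"
    by (rule lborel_pair.Fubini') measurable
  also have "\<dots> = (\<integral>\<^sup>+s. (\<integral>\<^sup>+r. h r * g (s - r) \<partial>lborel) * f (t - s) \<partial>lborel)"
    by (intro nn_integral_cong) (simp add: nn_integral_multc mult.assoc[symmetric])
  finally show ?thesis .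
qed

text \<open>Tonelli for the absolute values, then Fubini. The identity is localised at a single
  \<open>t\<close> because \<open>conv\<close> is 0 wherever its integrand is not integrable, so
  absolute convergence has to be checked point by point.\<close>

lemma conv_assoc_at:
  assumes [measurable]: "f \<in> borel_measurable borel" "g \<in> borel_measurable borel" "h \<in> borel_measurable borel"
    and fin: "(\<integral>\<^sup>+r. ennreal (norm (h r)) * (\<integral>\<^sup>+s. ennreal (norm (g s)) * ennreal (norm (f (t - r - s))) \<partial>lborel) \<partial>lborel) < top"
  shows "conv (conv f g) h t = conv f (conv g h) t"
proof -
  define Q where "Q = (\<lambda>r s. f (t - s) * g (s - r) * h r)"
  have Q: "integrable (lborel \<Otimes>\<^sub>M lborel) (case_prod Q)"
  proof (rule integrableI_bounded)
    show "case_prod Q \<in> borel_measurable (lborel \<Otimes>\<^sub>M lborel)" unfolding Q_def by measurable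
    have "(\<integral>\<^sup>+z. ennreal (norm (case_prod Q z)) \<partial>(lborel \<Otimes>\<^sub>M lborel))
        = (\<integral>\<^sup>+r. (\<integral>\<^sup>+s. ennreal (norm (Q r s)) \<partial>lborel) \<partial>lborel)"
      unfolding Q_def by (subst lborel.nn_integral_fst[symmetric]) auto
    also have "\<dots> = (\<integral>\<^sup>+r. ennreal (norm (h r)) * (\<integral>\<^sup>+s. ennreal (norm (g s)) * ennreal (norm (f (t - r - s))) \<partial>lborel) \<partial>lborel)"
    proof (intro nn_integral_cong)
      fix r
      have "(\<integral>\<^sup>+s. ennreal (norm (Q r s)) \<partial>lborel) = (\<integral>\<^sup>+s. ennreal (norm (h r)) * (ennreal (norm (g (s - r))) * ennreal (norm (f (t - s)))) \<partial>lborel)"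
        unfolding Q_def by (simp add: norm_mult ennreal_mult mult_ac)
      also have "\<dots> = ennreal (norm (h r)) * (\<integral>\<^sup>+s. ennreal (norm (g (s - r))) * ennreal (norm (f (t - s))) \<partial>lborel)"
        by (rule nn_integral_cmult) measurable
      also have "(\<integral>\<^sup>+s. ennreal (norm (g (s - r))) * ennreal (norm (f (t - s))) \<partial>lborel)
          = (\<integral>\<^sup>+s. ennreal (norm (g s)) * ennreal (norm (f (t - r - s))) \<partial>lborel)"
        using nn_integral_lborel_shift(1)[of "\<lambda>s. ennreal (norm (g s)) * ennreal (norm (f (t - r - s)))" r]
        by (simp add: algebra_simps)
      finally show "(\<integral>\<^sup>+s. ennreal (norm (Q r s)) \<partial>lborel) = ennreal (norm (h r)) * \<dots>" .
    qed
    finally show "(\<integral>\<^sup>+z. ennreal (norm (case_prod Q z)) \<partial>(lborel \<Otimes>\<^sub>M lborel)) < \<infinity>"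
      using fin by simp
  qed
  have "conv (conv f g) h t = (\<integral>r. (\<integral>s. Q r s \<partial>lborel) \<partial>lborel)"
    unfolding conv_def Q_def
  proof (intro Bochner_Integration.integral_cong refl)
    fix r
    have "(\<integral>s. f (t - r - s) * g s \<partial>lborel) = (\<integral>s. f (t - s) * g (s - r) \<partial>lborel)"
      using lborel_integral_shift(1)[of "\<lambda>s. f (t - r - s) * g s" r] by (simp add: algebra_simps)
    then show "(\<integral>s. f (t - r - s) * g s \<partial>lborel) * h r = (\<integral>s. f (t - s) * g (s - r) * h r \<partial>lborel)"
      by simp
  qed
  also have "\<dots> = (\<integral>s. (\<integral>r. Q r s \<partial>lborel) \<partial>lborel)"
    by (rule lborel_pair.Fubini_integral[OF Q, symmetric])
  also have "\<dots> = conv f (conv g h) t"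
    unfolding conv_def Q_def by (intro Bochner_Integration.integral_cong refl) (simp add: mult.assoc)
  finally show ?thesis .
qed

section \<open>The Schwartz class and its closure properties\<close>

abbreviation dv :: "(real \<Rightarrow> complex) \<Rightarrow> real \<Rightarrow> complex" where
  "dv f \<equiv> \<lambda>x. vector_derivative f (at x)"

lemma vderiv_iter_0 [simp]: "vderiv_iter 0 f = f"
  by (simp add: vderiv_iter_def)

lemma vderiv_iter_Suc: "vderiv_iter (Suc m) f = dv (vderiv_iter m f)"
  by (simp add: vderiv_iter_def)

lemma vderiv_iter_Suc': "vderiv_iter (Suc m) f = vderiv_iter m (dv f)"
  by (simp add: vderiv_iter_def funpow_Suc_right del: funpow.simps)

text \<open>The Schwartz class is the largest class closed under differentiation whose members are
  differentiable and bounded against every power of \<open>x\<close>. Closure properties thus need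
  one derivative only, and no formula for the iterated ones.\<close>

lemma schwartz_coinduct:
  assumes "f \<in> S"
    and S: "\<And>f. f \<in> S \<Longrightarrow> (\<forall>x. f differentiable (at x)) \<and> dv f \<in> S \<and>
              (\<forall>k::nat. bounded (range (\<lambda>x. (x ^ k) *\<^sub>R f x)))"
  shows "f \<in> schwartz"
proof -
  have "vderiv_iter m f \<in> S" for m
    by (induction m) (use assms in \<open>auto simp: vderiv_iter_Suc\<close>)
  then show ?thesis using S by (auto simp: schwartz_def)
qed

lemma schwartzD:
  assumes "f \<in> schwartz"
  shows schwartz_differentiable: "f differentiable (at x)"
    and schwartz_bounded: "bounded (range (\<lambda>x. (x ^ k) *\<^sub>R f x))"
    and schwartz_dv: "dv f \<in> schwartz"
proof -
  have *: "\<forall>m. (\<forall>x. vderiv_iter m f differentiable (at x)) \<and>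
                 (\<forall>k::nat. bounded (range (\<lambda>x. (x ^ k) *\<^sub>R vderiv_iter m f x)))"
    using assms by (simp add: schwartz_def)
  show "f differentiable (at x)" "bounded (range (\<lambda>x. (x ^ k) *\<^sub>R f x))"
    using *[rule_format, of 0] by auto
  show "dv f \<in> schwartz"
    using * unfolding schwartz_def mem_Collect_eq vderiv_iter_Suc'[symmetric] by blast
qed

lemma schwartz_has_vector_derivative:
  "f \<in> schwartz \<Longrightarrow> (f has_vector_derivative dv f x) (at x)"
  using schwartz_differentiable vector_derivative_works by blast

lemma schwartz_vderiv_iter: "f \<in> schwartz \<Longrightarrow> vderiv_iter m f \<in> schwartz"
  by (induction m) (auto simp: vderiv_iter_Suc schwartz_dv)

lemma schwartz_continuous: "f \<in> schwartz \<Longrightarrow> continuous_on A f"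
  by (meson continuous_at_imp_continuous_on differentiable_imp_continuous_within schwartz_differentiable)

lemma schwartz_measurable: "f \<in> schwartz \<Longrightarrow> f \<in> borel_measurable borel"
  by (intro borel_measurable_continuous_onI schwartz_continuous)

lemma vector_derivative_lincomb:
  assumes "f \<in> schwartz" "g \<in> schwartz"
  shows "((\<lambda>x. c * f x + d * g x) has_vector_derivative c * dv f x + d * dv g x) (at x)"
  by (intro derivative_intros schwartz_has_vector_derivative assms)

lemma schwartz_lincomb:
  assumes "f \<in> schwartz" "g \<in> schwartz"
  shows "(\<lambda>x. c * f x + d * g x) \<in> schwartz"
proof -
  define S where "S = {\<lambda>x. c * f x + d * g x | f g. f \<in> schwartz \<and> g \<in> schwartz}"
  have SI: "(\<lambda>x. c * f x + d * g x) \<in> S" if "f \<in> schwartz" "g \<in> schwartz" for f g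
    unfolding S_def using that by (intro CollectI exI[of _ f] exI[of _ g]) auto
  show ?thesis
  proof (rule schwartz_coinduct[OF SI[OF assms]])
  fix u assume "u \<in> S"
  then obtain f g where u: "u = (\<lambda>x. c * f x + d * g x)" and fg: "f \<in> schwartz" "g \<in> schwartz"
    unfolding S_def by blast
  note der = vector_derivative_lincomb[OF fg, of c d]
  have "dv u = (\<lambda>x. c * dv f x + d * dv g x)"
    unfolding u using der by (auto simp: vector_derivative_at)
  then have "dv u \<in> S"
    using SI[OF schwartz_dv[OF fg(1)] schwartz_dv[OF fg(2)]] by simp
  moreover have "u differentiable (at x)" for x
    unfolding u using der by (rule differentiableI_vector)
  moreover have "bounded (range (\<lambda>x. (x ^ k) *\<^sub>R u x))" for k :: nat
  proof -
    obtain A B where A: "\<And>x. norm ((x ^ k) *\<^sub>R f x) \<le> A" and B: "\<And>x. norm ((x ^ k) *\<^sub>R g x) \<le> B"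
      using schwartz_bounded[OF fg(1), of k] schwartz_bounded[OF fg(2), of k]
      unfolding bounded_iff by auto
    have "norm ((x ^ k) *\<^sub>R u x) \<le> norm c * A + norm d * B" for x
    proof -
      have "(x ^ k) *\<^sub>R u x = c * ((x ^ k) *\<^sub>R f x) + d * ((x ^ k) *\<^sub>R g x)"
        by (simp add: u scaleR_add_right)
      also have "norm \<dots> \<le> norm c * norm ((x ^ k) *\<^sub>R f x) + norm d * norm ((x ^ k) *\<^sub>R g x)"
        by (rule norm_triangle_le) (simp add: norm_mult)
      also have "\<dots> \<le> norm c * A + norm d * B"
        by (intro add_mono mult_left_mono A B) auto
      finally show ?thesis .
    qed
    then show ?thesis unfolding bounded_iff by auto
  qed
  ultimately show "(\<forall>x. u differentiable (at x)) \<and> dv u \<in> S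
      \<and> (\<forall>k::nat. bounded (range (\<lambda>x. (x ^ k) *\<^sub>R u x)))"
    by blast
qed
qed

lemma schwartz_diff: "f \<in> schwartz \<Longrightarrow> g \<in> schwartz \<Longrightarrow> (\<lambda>x. f x - g x) \<in> schwartz"
  using schwartz_lincomb[of f g 1 "-1"] by simp

lemma schwartz_cmult: "f \<in> schwartz \<Longrightarrow> (\<lambda>x. c * f x) \<in> schwartz"
  using schwartz_lincomb[of f f c 0] by simp

lemma has_vector_derivative_reflect:
  fixes f :: "real \<Rightarrow> 'a :: real_normed_vector"
  assumes "(f has_vector_derivative D) (at (- x))"
  shows "((\<lambda>x. f (- x)) has_vector_derivative - D) (at x)"
proof -
  have "((\<lambda>x::real. - x) has_vector_derivative - 1) (at x)"
    by (intro derivative_eq_intros) auto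
  from vector_diff_chain_at[OF this, of f D] assms show ?thesis by (simp add: o_def)
qed

lemma schwartz_reflect:
  assumes "f \<in> schwartz"
  shows "(\<lambda>x. f (- x)) \<in> schwartz"
proof (rule schwartz_coinduct[where S = "{\<lambda>x. f (- x) | f. f \<in> schwartz}"])
  show "(\<lambda>x. f (- x)) \<in> {\<lambda>x. f (- x) | f. f \<in> schwartz}"
    using assms by blast
next
  fix u assume "u \<in> {\<lambda>x. f (- x) | f. f \<in> schwartz}"
  then obtain f where u: "u = (\<lambda>x. f (- x))" and f: "f \<in> schwartz" by blast
  have der: "(u has_vector_derivative - dv f (- x)) (at x)" for x
    unfolding u by (intro has_vector_derivative_reflect schwartz_has_vector_derivative f)
  have "dv u = (\<lambda>x. (\<lambda>y. (- 1) * dv f y) (- x))"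
    using der by (auto simp: vector_derivative_at)
  then have "dv u \<in> {\<lambda>x. f (- x) | f. f \<in> schwartz}"
    using schwartz_cmult[OF schwartz_dv[OF f], of "-1"]
    by (intro CollectI exI[of _ "\<lambda>y. (- 1) * dv f y"] conjI) auto
  moreover have "u differentiable (at x)" for x
    using der by (rule differentiableI_vector)
  moreover have "bounded (range (\<lambda>x. (x ^ k) *\<^sub>R u x))" for k :: nat
  proof -
    obtain A where A: "\<And>x. norm ((x ^ k) *\<^sub>R f x) \<le> A"
      using schwartz_bounded[OF f, of k] unfolding bounded_iff by auto
    have "norm ((x ^ k) *\<^sub>R u x) \<le> A" for x
      using A[of "-x"] by (simp add: u power_abs)
    then show ?thesis unfolding bounded_iff by auto
  qed
  ultimately show "(\<forall>x. u differentiable (at x)) \<and> dv u \<in> {\<lambda>x. f (- x) | f. f \<in> schwartz}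
      \<and> (\<forall>k::nat. bounded (range (\<lambda>x. (x ^ k) *\<^sub>R u x)))"
    by blast
qed

text \<open>Since (1 + |x|)^k is at most 2^k (1 + |x|^k), the bounds for the powers 0 and
  \<open>k\<close> suffice.\<close>

lemma schwartz_decay:
  assumes "f \<in> schwartz"
  obtains C where "0 \<le> C" "\<And>x. norm (f x) \<le> C / (1 + \<bar>x\<bar>) ^ k"
proof -
  obtain A where A: "\<And>x. norm (f x) \<le> A"
    using schwartz_bounded[OF assms, of 0] unfolding bounded_iff by auto
  obtain B where B: "\<And>x. \<bar>x\<bar> ^ k * norm (f x) \<le> B"
    using schwartz_bounded[OF assms, of k] unfolding bounded_iff by (auto simp: power_abs)
  have "norm (f x) \<le> (2 ^ k * (A + B)) / (1 + \<bar>x\<bar>) ^ k" for x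
  proof -
    have "1 + \<bar>x\<bar> \<le> 2 * max 1 \<bar>x\<bar>" by simp
    then have "(1 + \<bar>x\<bar>) ^ k \<le> 2 ^ k * (max 1 \<bar>x\<bar>) ^ k"
      by (metis abs_ge_zero add_nonneg_nonneg power_mono power_mult_distrib zero_le_one)
    also have "(max 1 \<bar>x\<bar>) ^ k \<le> 1 + \<bar>x\<bar> ^ k" by (auto simp: max_def)
    finally have "(1 + \<bar>x\<bar>) ^ k * norm (f x) \<le> 2 ^ k * (1 + \<bar>x\<bar> ^ k) * norm (f x)"
      by (simp add: mult_right_mono)
    also have "\<dots> = 2 ^ k * (norm (f x) + \<bar>x\<bar> ^ k * norm (f x))" by (simp add: algebra_simps)
    also have "\<dots> \<le> 2 ^ k * (A + B)" by (intro mult_left_mono add_mono A B) auto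
    finally show ?thesis by (simp add: field_simps)
  qed
  moreover have "0 \<le> A" "0 \<le> B"
    by (rule order_trans[OF norm_ge_zero A[of 0]], rule order_trans[OF _ B[of 0]]) simp
  ultimately show ?thesis by (intro that[of "2 ^ k * (A + B)"]) auto
qed

text \<open>Peetre's inequality. It exchanges a polynomial weight in \<open>t - s\<close> for one in
  \<open>s\<close> at the price of a factor depending on \<open>t\<close> alone, which is how
  integrals over \<open>s\<close> are dominated for fixed \<open>t\<close>.\<close>

lemma one_plus_abs_mult: "1 + \<bar>s\<bar> \<le> (1 + \<bar>t - s\<bar>) * (1 + \<bar>t\<bar>)" for s t :: real
proof -
  have "1 + \<bar>s\<bar> \<le> 1 + \<bar>t - s\<bar> + \<bar>t\<bar>" by linarith
  also have "\<dots> \<le> (1 + \<bar>t - s\<bar>) * (1 + \<bar>t\<bar>)" by (simp add: algebra_simps)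
  finally show ?thesis .
qed

lemma inverse_one_plus_abs_shift:
  fixes s t :: real
  shows "1 / (1 + \<bar>t - s\<bar>) ^ k \<le> (1 + \<bar>t\<bar>) ^ k / (1 + \<bar>s\<bar>) ^ k"
proof -
  have "(1 + \<bar>s\<bar>) ^ k \<le> ((1 + \<bar>t - s\<bar>) * (1 + \<bar>t\<bar>)) ^ k"
    by (intro power_mono one_plus_abs_mult) auto
  then have "(1 + \<bar>s\<bar>) ^ k \<le> (1 + \<bar>t - s\<bar>) ^ k * (1 + \<bar>t\<bar>) ^ k"
    by (simp only: power_mult_distrib)
  then show ?thesis by (simp add: field_simps)
qed

section \<open>Integrability against polynomial weights\<close>

lemma nn_integral_one_plus_square:
  "(\<integral>\<^sup>+x. ennreal (1 / (1 + \<bar>x\<bar>) ^ 2) \<partial>lborel) \<le> 2"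
proof -
  have *: "(\<integral>\<^sup>+x. ennreal (1 / (1 + x) ^ 2) * indicator {0..} x \<partial>lborel) = ennreal (0 - (- 1 / (1 + 0)))"
  proof (rule nn_integral_FTC_atLeast)
    show "((\<lambda>x. - 1 / (1 + x)) has_field_derivative 1 / (1 + x) ^ 2) (at x)" if "0 \<le> x" for x :: real
      using that by (auto intro!: derivative_eq_intros simp: power2_eq_square field_simps)
    show "((\<lambda>x::real. - 1 / (1 + x)) \<longlongrightarrow> 0) at_top"
      by (intro tendsto_divide_0[OF tendsto_const] filterlim_at_top_imp_at_infinity
          filterlim_tendsto_add_at_top[OF tendsto_const] filterlim_ident)
  qed auto
  have "(\<integral>\<^sup>+x. ennreal (1 / (1 + \<bar>x\<bar>) ^ 2) \<partial>lborel) \<le>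
      (\<integral>\<^sup>+x. ennreal (1 / (1 + x) ^ 2) * indicator {0..} x +
         ennreal (1 / (1 + (- x)) ^ 2) * indicator {0..} (- x) \<partial>lborel)"
    by (intro nn_integral_mono) (auto split: split_indicator)
  also have "\<dots> = (\<integral>\<^sup>+x. ennreal (1 / (1 + x) ^ 2) * indicator {0..} x \<partial>lborel)
      + (\<integral>\<^sup>+x. ennreal (1 / (1 + (- x)) ^ 2) * indicator {0..} (- x) \<partial>lborel)"
    by (intro nn_integral_add) auto
  also have "\<dots> = 2"
    by (subst nn_integral_lborel_shift(3)[of "\<lambda>x. ennreal (1 / (1 + x) ^ 2) * indicator {0..} x"])
       (auto simp: *)
  finally show ?thesis .
qed

text \<open>The growth class against which Schwartz functions are convolved. It contains the
  integrable functions and also the kernels of fractional integration, which may be unbounded at 0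
  and are not integrable at infinity.\<close>

definition tempered :: "nat \<Rightarrow> (real \<Rightarrow> complex) \<Rightarrow> bool" where
  "tempered k g \<longleftrightarrow> g \<in> borel_measurable borel \<and> integrable lborel (\<lambda>s. norm (g s) / (1 + \<bar>s\<bar>) ^ k)"

lemma temperedI:
  assumes [measurable]: "g \<in> borel_measurable borel"
    and "(\<integral>\<^sup>+s. ennreal (norm (g s) / (1 + \<bar>s\<bar>) ^ k) \<partial>lborel) < top"
  shows "tempered k g"
  unfolding tempered_def using assms(2) by (auto intro!: integrableI_bounded)

lemma integrable_one_plus_square: "integrable lborel (\<lambda>x::real. 1 / (1 + \<bar>x\<bar>) ^ 2)"
  using nn_integral_one_plus_square
  by (intro integrableI_bounded) (auto simp: order_le_less_trans)

lemma schwartz_weighted_integrable: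
  assumes f: "f \<in> schwartz"
  shows "integrable lborel (\<lambda>x. (1 + \<bar>x\<bar>) ^ k * norm (f x))"
proof -
  have [measurable]: "f \<in> borel_measurable borel" using f by (rule schwartz_measurable)
  obtain C where C: "0 \<le> C" "\<And>x. norm (f x) \<le> C / (1 + \<bar>x\<bar>) ^ (k + 2)" using schwartz_decay[OF f] by blast
  show ?thesis
  proof (rule Bochner_Integration.integrable_bound)
    show "integrable lborel (\<lambda>x::real. C * (1 / (1 + \<bar>x\<bar>) ^ 2))"
      using integrable_one_plus_square by (rule integrable_mult_right)
    show "AE x in lborel. norm ((1 + \<bar>x\<bar>) ^ k * norm (f x)) \<le> norm (C * (1 / (1 + \<bar>x\<bar>) ^ 2))"
    proof (rule AE_I2)
      fix x :: real
      have "(1 + \<bar>x\<bar>) ^ k * norm (f x) \<le> (1 + \<bar>x\<bar>) ^ k * (C / (1 + \<bar>x\<bar>) ^ (k + 2))"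
        by (intro mult_left_mono C) auto
      also have "\<dots> = C * (1 / (1 + \<bar>x\<bar>) ^ 2)"
        by (simp only: power_add) (simp add: power_eq_0_iff)
      finally show "norm ((1 + \<bar>x\<bar>) ^ k * norm (f x)) \<le> norm (C * (1 / (1 + \<bar>x\<bar>) ^ 2))"
        using C by (simp add: abs_mult)
    qed
  qed measurable
qed

lemma schwartz_tempered: "f \<in> schwartz \<Longrightarrow> tempered 0 f"
  using schwartz_weighted_integrable[of f 0] by (simp add: tempered_def schwartz_measurable)

lemma schwartz_integrable: "f \<in> schwartz \<Longrightarrow> integrable lborel f"
  using schwartz_weighted_integrable[of f 0]
  by (auto intro!: integrable_norm_cancel[of lborel f] schwartz_measurable)

lemma schwartz_conv_integrable:
  assumes f: "f \<in> schwartz" and g: "tempered k g"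
  shows "integrable lborel (\<lambda>s. f (t - s) * g s)"
proof -
  have [measurable]: "f \<in> borel_measurable borel" "g \<in> borel_measurable borel"
    using f g by (auto simp: schwartz_measurable tempered_def)
  obtain C where C: "0 \<le> C" "\<And>x. norm (f x) \<le> C / (1 + \<bar>x\<bar>) ^ k" using schwartz_decay[OF f] by blast
  show ?thesis
  proof (rule Bochner_Integration.integrable_bound)
    show "integrable lborel (\<lambda>s. C * (1 + \<bar>t\<bar>) ^ k * (norm (g s) / (1 + \<bar>s\<bar>) ^ k))"
      using g by (intro integrable_mult_right) (simp add: tempered_def)
    show "AE s in lborel. norm (f (t - s) * g s) \<le> norm (C * (1 + \<bar>t\<bar>) ^ k * (norm (g s) / (1 + \<bar>s\<bar>) ^ k))"
    proof (rule AE_I2)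
      fix s :: real
      have "norm (f (t - s)) \<le> C * (1 / (1 + \<bar>t - s\<bar>) ^ k)" using C(2)[of "t - s"] by simp
      also have "\<dots> \<le> C * ((1 + \<bar>t\<bar>) ^ k / (1 + \<bar>s\<bar>) ^ k)"
        by (intro mult_left_mono inverse_one_plus_abs_shift C)
      finally have "norm (f (t - s)) * norm (g s) \<le> C * ((1 + \<bar>t\<bar>) ^ k / (1 + \<bar>s\<bar>) ^ k) * norm (g s)"
        by (intro mult_right_mono) auto
      then show "norm (f (t - s) * g s) \<le> norm (C * (1 + \<bar>t\<bar>) ^ k * (norm (g s) / (1 + \<bar>s\<bar>) ^ k))"
        using C by (simp add: norm_mult abs_mult)
    qed
  qed measurable
qed

section \<open>Differentiation of convolutions\<close>

lemma vector_derivative_lipschitz: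
  fixes f :: "real \<Rightarrow> 'a :: real_normed_vector"
  assumes "\<And>x. x \<in> S \<Longrightarrow> (f has_vector_derivative f' x) (at x)" "\<And>x. x \<in> S \<Longrightarrow> norm (f' x) \<le> B"
    and "convex S" "x \<in> S" "y \<in> S"
  shows "norm (f y - f x) \<le> B * \<bar>y - x\<bar>"
proof -
  have "norm (f y - f x) \<le> B * norm (y - x)"
  proof (rule differentiable_bound[OF assms(3) _ _ assms(5,4), where f' = "\<lambda>x h. h *\<^sub>R f' x"])
    show "(f has_derivative (\<lambda>h. h *\<^sub>R f' x)) (at x within S)" if "x \<in> S" for x
      using assms(1)[OF that] by (auto simp: has_vector_derivative_def intro: has_derivative_at_withinI)
    show "onorm (\<lambda>h. h *\<^sub>R f' x) \<le> B" if "x \<in> S" for x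
      using assms(2)[OF that] onorm_scaleR_left[OF bounded_linear_ident, of "f' x"] by (simp add: onorm_id)
  qed
  then show ?thesis by simp
qed

lemma has_vector_derivative_iff_quotient:
  fixes f :: "real \<Rightarrow> 'a :: real_normed_vector"
  shows "(f has_vector_derivative D) (at x) \<longleftrightarrow> ((\<lambda>y. (1 / (y - x)) *\<^sub>R (f y - f x)) \<longlongrightarrow> D) (at x)"
proof -
  have "(f has_vector_derivative D) (at x) \<longleftrightarrow>
      ((\<lambda>y. norm ((f y - f x) - (y - x) *\<^sub>R D) / norm (y - x)) \<longlongrightarrow> 0) (at x)"
    by (simp add: has_vector_derivative_def has_derivative_iff_norm bounded_linear_scaleR_left)
  also have "\<dots> \<longleftrightarrow> ((\<lambda>y. norm ((1 / (y - x)) *\<^sub>R (f y - f x) - D)) \<longlongrightarrow> 0) (at x)"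
  proof (rule filterlim_cong[OF refl refl])
    show "\<forall>\<^sub>F y in at x. norm ((f y - f x) - (y - x) *\<^sub>R D) / norm (y - x)
        = norm ((1 / (y - x)) *\<^sub>R (f y - f x) - D)"
    proof (rule eventually_mono[OF eventually_neq_at_within[of x]])
      fix y assume "y \<noteq> x"
      then have "(1 / (y - x)) *\<^sub>R (f y - f x) - D = (1 / (y - x)) *\<^sub>R ((f y - f x) - (y - x) *\<^sub>R D)"
        by (simp add: scaleR_right_diff_distrib)
      then show "norm ((f y - f x) - (y - x) *\<^sub>R D) / norm (y - x) = norm ((1 / (y - x)) *\<^sub>R (f y - f x) - D)"
        by (simp only: norm_scaleR) (simp add: divide_inverse mult.commute abs_inverse)
    qed
  qed
  also have "\<dots> \<longleftrightarrow> ((\<lambda>y. (1 / (y - x)) *\<^sub>R (f y - f x)) \<longlongrightarrow> D) (at x)"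
    by (simp only: tendsto_norm_zero_iff LIM_zero_iff)
  finally show ?thesis .
qed

text \<open>Differentiation under the integral sign. The derivative falls on the Schwartz factor,
  since \<open>g\<close> may be singular.\<close>

lemma conv_has_vector_derivative:
  assumes f: "f \<in> schwartz" and g: "tempered k g"
  shows "(conv f g has_vector_derivative conv (dv f) g x) (at x)"
proof -
  have [measurable]: "f \<in> borel_measurable borel" "g \<in> borel_measurable borel" "dv f \<in> borel_measurable borel"
    using f g by (auto simp: schwartz_measurable tempered_def schwartz_dv)
  obtain C where C: "0 \<le> C" "\<And>x. norm (dv f x) \<le> C / (1 + \<bar>x\<bar>) ^ k"
    using schwartz_decay[OF schwartz_dv[OF f]] by blast
  \<comment> \<open>Dominates all difference quotients with increment below 1: on the unit ball
    around \<open>x - s\<close> the weight \<open>1 + \<bar>v + s\<bar>\<close> is at most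
    \<open>2 + \<bar>x\<bar>\<close>.\<close>
  define w where "w = (\<lambda>s. C * (2 + \<bar>x\<bar>) ^ k * (norm (g s) / (1 + \<bar>s\<bar>) ^ k))"
  have w: "integrable lborel w"
    unfolding w_def using g by (intro integrable_mult_right) (simp add: tempered_def)
  have lip: "norm ((1 / (y - x)) *\<^sub>R (f (y - s) - f (x - s)) * g s) \<le> w s" if y: "y \<in> ball x 1 - {x}" for y s
  proof -
    have "norm (f (y - s) - f (x - s)) \<le> C * ((2 + \<bar>x\<bar>) ^ k / (1 + \<bar>s\<bar>) ^ k) * \<bar>(y - s) - (x - s)\<bar>"
    proof (rule vector_derivative_lipschitz[where S = "ball (x - s) 1"])
      fix v assume "v \<in> ball (x - s) 1"
      then have v: "\<bar>v + s\<bar> \<le> 1 + \<bar>x\<bar>" by (auto simp: dist_real_def)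
      show "(f has_vector_derivative dv f v) (at v)" using f by (rule schwartz_has_vector_derivative)
      have "norm (dv f v) \<le> C * (1 / (1 + \<bar>(v + s) - s\<bar>) ^ k)" using C(2)[of v] by simp
      also have "\<dots> \<le> C * ((1 + \<bar>v + s\<bar>) ^ k / (1 + \<bar>s\<bar>) ^ k)"
        by (intro mult_left_mono inverse_one_plus_abs_shift C)
      also have "\<dots> \<le> C * ((2 + \<bar>x\<bar>) ^ k / (1 + \<bar>s\<bar>) ^ k)"
        using v by (intro mult_left_mono divide_right_mono power_mono C) auto
      finally show "norm (dv f v) \<le> C * ((2 + \<bar>x\<bar>) ^ k / (1 + \<bar>s\<bar>) ^ k)" .
    qed (use y in \<open>auto simp: dist_real_def\<close>)
    then have "norm (f (y - s) - f (x - s)) / \<bar>y - x\<bar> \<le> C * ((2 + \<bar>x\<bar>) ^ k / (1 + \<bar>s\<bar>) ^ k)"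
      using y by (simp add: pos_divide_le_eq)
    then have "norm (f (y - s) - f (x - s)) / \<bar>y - x\<bar> * norm (g s) \<le> C * ((2 + \<bar>x\<bar>) ^ k / (1 + \<bar>s\<bar>) ^ k) * norm (g s)"
      by (intro mult_right_mono) auto
    then show ?thesis by (simp add: w_def norm_mult)
  qed
  \<comment> \<open>The domination covers only increments below 1, so the limit is first taken
    within a ball.\<close>
  have "((\<lambda>y. (1 / (y - x)) *\<^sub>R (conv f g y - conv f g x)) \<longlongrightarrow> conv (dv f) g x) (at x within ball x 1)"
  proof (unfold tendsto_at_iff_sequentially, intro allI impI)
    fix X :: "nat \<Rightarrow> real" assume X: "\<forall>i. X i \<in> ball x 1 - {x}" and lim: "X \<longlonglongrightarrow> x"
    let ?q = "\<lambda>y s. (1 / (y - x)) *\<^sub>R (f (y - s) - f (x - s)) * g s"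
    have "(\<lambda>i. \<integral>s. ?q (X i) s \<partial>lborel) \<longlonglongrightarrow> (\<integral>s. dv f (x - s) * g s \<partial>lborel)"
    proof (rule integral_dominated_convergence[OF _ _ w])
      show "AE s in lborel. (\<lambda>i. ?q (X i) s) \<longlonglongrightarrow> dv f (x - s) * g s"
      proof (rule AE_I2)
        fix s
        have "((\<lambda>y. f (y - s)) has_vector_derivative dv f (x - s)) (at x)"
        proof -
          have "((\<lambda>y. y - s) has_vector_derivative 1) (at x)"
            by (auto intro!: derivative_eq_intros)
          from vector_diff_chain_at[OF this, of f "dv f (x - s)"]
          show ?thesis using schwartz_has_vector_derivative[OF f, of "x - s"] by (simp add: o_def)
        qed
        then have "((\<lambda>y. (1 / (y - x)) *\<^sub>R (f (y - s) - f (x - s))) \<longlongrightarrow> dv f (x - s)) (at x)"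
          by (simp only: has_vector_derivative_iff_quotient)
        then have "(\<lambda>i. (1 / (X i - x)) *\<^sub>R (f (X i - s) - f (x - s))) \<longlonglongrightarrow> dv f (x - s)"
          unfolding tendsto_at_iff_sequentially using X lim by (auto simp: o_def)
        then show "(\<lambda>i. ?q (X i) s) \<longlonglongrightarrow> dv f (x - s) * g s" by (intro tendsto_intros)
      qed
      show "AE s in lborel. norm (?q (X i) s) \<le> w s" for i
        using lip X by (intro AE_I2) blast
    qed measurable
    also have "(\<lambda>i. \<integral>s. ?q (X i) s \<partial>lborel) = (\<lambda>i. (1 / (X i - x)) *\<^sub>R (conv f g (X i) - conv f g x))"
      unfolding conv_def
      by (auto simp: fun_eq_iff scaleR_conv_of_real mult.assoc left_diff_distrib schwartz_conv_integrable[OF f g])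
    finally show "((\<lambda>y. (1 / (y - x)) *\<^sub>R (conv f g y - conv f g x)) \<circ> X) \<longlonglongrightarrow> conv (dv f) g x"
      by (simp add: o_def conv_def)
  qed
  then have "((\<lambda>y. (1 / (y - x)) *\<^sub>R (conv f g y - conv f g x)) \<longlongrightarrow> conv (dv f) g x) (at x)"
    using at_within_open[of x "ball x 1"] by (simp only: centre_in_ball open_ball zero_less_one)
  then show ?thesis by (simp only: has_vector_derivative_iff_quotient)
qed

lemma vderiv_iter_conv:
  assumes f: "f \<in> schwartz" and g: "tempered k g"
  shows "vderiv_iter m (conv f g) = conv (vderiv_iter m f) g"
proof (induction m)
  case (Suc m)
  have "dv (conv (vderiv_iter m f) g) = conv (dv (vderiv_iter m f)) g"
    using conv_has_vector_derivative[OF schwartz_vderiv_iter[OF f] g]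
    by (auto simp: vector_derivative_at)
  then show ?case using Suc by (simp add: vderiv_iter_Suc)
qed simp

text \<open>The class for the coinduction fixes \<open>g\<close> and lets the first factor vary,
  because differentiation acts on the first factor.\<close>

lemma schwartz_conv:
  assumes f: "f \<in> schwartz" and g: "g \<in> schwartz"
  shows "conv f g \<in> schwartz"
proof (rule schwartz_coinduct[where S = "(\<lambda>f. conv f g) ` schwartz"])
  show "conv f g \<in> (\<lambda>f. conv f g) ` schwartz" using f by blast
next
  fix u assume "u \<in> (\<lambda>f. conv f g) ` schwartz"
  then obtain f where u: "u = conv f g" and f: "f \<in> schwartz" by blast
  have [measurable]: "f \<in> borel_measurable borel" "g \<in> borel_measurable borel"
    using f g by (auto simp: schwartz_measurable)
  have der: "(u has_vector_derivative conv (dv f) g x) (at x)" for x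
    unfolding u by (rule conv_has_vector_derivative[OF f schwartz_tempered[OF g]])
  have "dv u = conv (dv f) g" using der by (auto simp: vector_derivative_at)
  then have "dv u \<in> (\<lambda>f. conv f g) ` schwartz" using schwartz_dv[OF f] by blast
  moreover have "u differentiable (at x)" for x
    using der by (rule differentiableI_vector)
  moreover have "bounded (range (\<lambda>x. (x ^ k) *\<^sub>R u x))" for k :: nat
  proof -
    obtain C where C: "0 \<le> C" "\<And>x. norm (f x) \<le> C / (1 + \<bar>x\<bar>) ^ k" using schwartz_decay[OF f] by blast
    define B where "B = (\<integral>s. C * ((1 + \<bar>s\<bar>) ^ k * norm (g s)) \<partial>lborel)"
    have "norm ((x ^ k) *\<^sub>R u x) \<le> B" for x
    proof -
      have "(x ^ k) *\<^sub>R u x = (\<integral>s. (x ^ k) *\<^sub>R (f (x - s) * g s) \<partial>lborel)"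
        by (simp add: u conv_def)
      also have "norm \<dots> \<le> B"
        unfolding B_def
      proof (rule Bochner_Integration.integral_norm_bound_integral)
        show "integrable lborel (\<lambda>s. (x ^ k) *\<^sub>R (f (x - s) * g s))"
          by (intro integrable_scaleR_right impI schwartz_conv_integrable[OF f schwartz_tempered[OF g]])
        show "integrable lborel (\<lambda>s. C * ((1 + \<bar>s\<bar>) ^ k * norm (g s)))"
          by (intro integrable_mult_right schwartz_weighted_integrable g)
        fix s
        have "\<bar>x\<bar> ^ k \<le> ((1 + \<bar>s - x\<bar>) * (1 + \<bar>s\<bar>)) ^ k"
          using one_plus_abs_mult[of x s] by (intro power_mono) auto
        then have "\<bar>x\<bar> ^ k * norm (f (x - s)) \<le> ((1 + \<bar>x - s\<bar>) * (1 + \<bar>s\<bar>)) ^ k * (C / (1 + \<bar>x - s\<bar>) ^ k)"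
          by (intro mult_mono C) (auto simp: abs_minus_commute)
        also have "\<dots> = C * (1 + \<bar>s\<bar>) ^ k"
          using abs_ge_zero[of "x - s"] by (simp only: power_mult_distrib) (auto simp: power_eq_0_iff)
        finally have "\<bar>x\<bar> ^ k * norm (f (x - s)) * norm (g s) \<le> C * (1 + \<bar>s\<bar>) ^ k * norm (g s)"
          by (intro mult_right_mono) auto
        then show "norm ((x ^ k) *\<^sub>R (f (x - s) * g s)) \<le> C * ((1 + \<bar>s\<bar>) ^ k * norm (g s))"
          by (simp add: norm_mult power_abs mult.assoc)
      qed
      finally show ?thesis .
    qed
    then show ?thesis unfolding bounded_iff by auto
  qed
  ultimately show "(\<forall>x. u differentiable (at x)) \<and> dv u \<in> (\<lambda>f. conv f g) ` schwartz
      \<and> (\<forall>k::nat. bounded (range (\<lambda>x. (x ^ k) *\<^sub>R u x)))"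
    by blast
qed

section \<open>Weyl fractional calculus\<close>

text \<open>The kernel of fractional integration of order \<open>b\<close>, placed on the negative
  half-line so that \<open>conv f (kap b)\<close> integrates \<open>f\<close> over the points to the
  right of the argument.\<close>

definition rk :: "real \<Rightarrow> real \<Rightarrow> real" where
  "rk b s = (if s < 0 then (- s) powr (b - 1) / Gamma b else 0)"

abbreviation kap :: "real \<Rightarrow> real \<Rightarrow> complex" where
  "kap b \<equiv> \<lambda>s. complex_of_real (rk b s)"

lemma rk_measurable [measurable]: "rk b \<in> borel_measurable borel"
  unfolding rk_def[abs_def] by measurable

lemma rk_nonneg: "0 < b \<Longrightarrow> 0 \<le> rk b s"
  by (auto simp: rk_def Gamma_real_pos intro!: divide_nonneg_pos)

text \<open>Semigroup law of the kernels: the substitution s = t u produces a Beta integral. In the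
  form for nonnegative integrals it also supplies the absolute convergence that associativity
  requires.\<close>

lemma nn_integral_rk_rk:
  assumes a: "0 < a" and b: "0 < b"
  shows "(\<integral>\<^sup>+s. ennreal (rk b s) * ennreal (rk a (t - s)) \<partial>lborel) = ennreal (rk (a + b) t)"
proof (cases "t < 0")
  case False
  have "(\<integral>\<^sup>+s. ennreal (rk b s) * ennreal (rk a (t - s)) \<partial>lborel) = (\<integral>\<^sup>+(s::real). 0 \<partial>lborel)"
    using False by (intro nn_integral_cong) (auto simp: rk_def)
  then show ?thesis using False by (simp add: rk_def)
next
  case True
  note G = Gamma_real_pos[OF a] Gamma_real_pos[OF b]
  define c where "c = (- t) powr (a + b - 2) / (Gamma a * Gamma b)"
  have c: "0 \<le> c" using G by (simp add: c_def)
  have eq: "ennreal (rk b (0 + t * u)) * ennreal (rk a (t - (0 + t * u)))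
      = ennreal c * (ennreal (u powr (b - 1) * (1 - u) powr (a - 1)) * indicator {0..1} u)" for u
  proof (cases "0 < u \<and> u < 1")
    case True
    have 1: "t * u < 0" and 2: "t - t * u < 0"
      using \<open>t < 0\<close> True by (auto simp: mult_neg_pos mult_less_cancel_left1)
    have "rk b (t * u) * rk a (t - t * u) = c * (u powr (b - 1) * (1 - u) powr (a - 1))"
    proof -
      have "(- (t * u)) powr (b - 1) = (- t) powr (b - 1) * u powr (b - 1)"
        using powr_mult[of "- t" u "b - 1"] \<open>t < 0\<close> True by simp
      moreover have "(- (t - t * u)) powr (a - 1) = (- t) powr (a - 1) * (1 - u) powr (a - 1)"
        using powr_mult[of "- t" "1 - u" "a - 1"] \<open>t < 0\<close> True by (simp add: algebra_simps)
      moreover have "(- t) powr (b - 1) * (- t) powr (a - 1) = (- t) powr (a + b - 2)"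
        by (simp add: powr_add[symmetric] algebra_simps)
      ultimately show ?thesis
        using 1 2 by (simp add: rk_def c_def mult_ac)
    qed
    then show ?thesis
      using True a b c by (simp add: ennreal_mult[symmetric] rk_nonneg)
  next
    case False
    then have "rk b (t * u) = 0 \<or> rk a (t - t * u) = 0"
      using \<open>t < 0\<close> by (auto simp: rk_def mult_less_0_iff mult_less_cancel_left1)
    moreover have "u powr (b - 1) * (1 - u) powr (a - 1) * indicator {0..1} u = 0"
      using False by (auto split: split_indicator)
    ultimately show ?thesis by (auto split: split_indicator)
  qed
  have "(\<integral>\<^sup>+s. ennreal (rk b s) * ennreal (rk a (t - s)) \<partial>lborel)
      = ennreal \<bar>t\<bar> * (\<integral>\<^sup>+u. ennreal (rk b (0 + t * u)) * ennreal (rk a (t - (0 + t * u))) \<partial>lborel)"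
    using True by (intro nn_integral_real_affine) auto
  also have "\<dots> = ennreal \<bar>t\<bar> * (ennreal c * (\<integral>\<^sup>+u. ennreal (u powr (b - 1) * (1 - u) powr (a - 1)) * indicator {0..1} u \<partial>lborel))"
    unfolding eq by (subst nn_integral_cmult) auto
  also have "(\<integral>\<^sup>+u. ennreal (u powr (b - 1) * (1 - u) powr (a - 1)) * indicator {0..1} u \<partial>lborel) = ennreal (Beta b a)"
    by (rule nn_integral_has_integral_lebesgue'[OF _ has_integral_Beta_real[OF b a]]) auto
  also have "Beta b a = Gamma a * Gamma b / Gamma (a + b)"
    by (simp add: Beta_def add.commute)
  also have "ennreal \<bar>t\<bar> * (ennreal c * ennreal (Gamma a * Gamma b / Gamma (a + b))) = ennreal (\<bar>t\<bar> * (c * (Gamma a * Gamma b / Gamma (a + b))))"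
    using c by (simp only: ennreal_mult'[symmetric] abs_ge_zero)
  also have "\<bar>t\<bar> * (c * (Gamma a * Gamma b / Gamma (a + b))) = (- t) * (- t) powr (a + b - 2) / Gamma (a + b)"
    using True G by (simp add: c_def)
  also have "(- t) * (- t) powr (a + b - 2) = (- t) powr (a + b - 1)"
    using True powr_add[of "- t" 1 "a + b - 2"] by simp
  finally show ?thesis using True by (simp add: rk_def)
qed

lemma conv_kap_kap:
  assumes "0 < a" "0 < b"
  shows "conv (kap a) (kap b) = kap (a + b)"
proof
  fix t
  have "has_bochner_integral lborel (\<lambda>s. rk b s * rk a (t - s)) (rk (a + b) t)"
    using assms nn_integral_rk_rk[OF assms, of t]
    by (intro has_bochner_integral_nn_integral) (auto simp: rk_nonneg ennreal_mult)
  then have "(\<integral>s. complex_of_real (rk b s * rk a (t - s)) \<partial>lborel) = kap (a + b) t"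
    by (simp add: has_bochner_integral_iff del: of_real_mult)
  then show "conv (kap a) (kap b) t = kap (a + b) t"
    by (simp add: conv_def mult.commute)
qed

text \<open>At 0 the kernel is integrable because \<open>b\<close> is positive. At infinity the
  power \<lceil>b\<rceil> of the weight absorbs the growth and the additional 2 gives
  convergence.\<close>

lemma kap_tempered:
  assumes b: "0 < b"
  shows "tempered (nat \<lceil>b\<rceil> + 2) (kap b)"
proof (rule temperedI)
  let ?k = "nat \<lceil>b\<rceil> + 2"
  note G = Gamma_real_pos[OF b]
  have le: "ennreal (norm (kap b s) / (1 + \<bar>s\<bar>) ^ ?k) \<le>
      ennreal (1 / Gamma b) * (ennreal ((- s) powr (b - 1)) * indicator {0..1} (- s) + ennreal (1 / (1 + \<bar>s\<bar>) ^ 2))" for s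
  proof (cases "s < 0")
    case False
    then show ?thesis by (simp add: rk_def)
  next
    case True
    define v where "v = - s"
    have v: "0 < v" using True by (simp add: v_def)
    have *: "v powr (b - 1) / (1 + v) ^ ?k \<le> v powr (b - 1) * indicator {0..1} v + 1 / (1 + v) ^ 2"
    proof (cases "v \<le> 1")
      case True
      have "v powr (b - 1) / (1 + v) ^ ?k \<le> v powr (b - 1) / 1"
        using v by (intro divide_left_mono one_le_power) auto
      also have "\<dots> \<le> v powr (b - 1) * indicator {0..1} v + 1 / (1 + v) ^ 2"
        using True v by simp
      finally show ?thesis .
    next
      case False
      have "v powr (b - 1) \<le> v powr (real (nat \<lceil>b\<rceil>))"
        using False b by (intro powr_mono) linarith+
      also have "\<dots> \<le> (1 + v) ^ nat \<lceil>b\<rceil>"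
        using v by (simp add: powr_realpow power_mono)
      finally have "v powr (b - 1) / (1 + v) ^ ?k \<le> (1 + v) ^ nat \<lceil>b\<rceil> / (1 + v) ^ ?k"
        using v by (intro divide_right_mono) auto
      also have "\<dots> = 1 / (1 + v) ^ 2" using v by (simp only: power_add) simp
      finally show ?thesis by (simp add: add_increasing)
    qed
    have "norm (kap b s) / (1 + \<bar>s\<bar>) ^ ?k = (1 / Gamma b) * (v powr (b - 1) / (1 + v) ^ ?k)"
      using True G by (simp add: rk_def v_def norm_divide)
    also have "\<dots> \<le> (1 / Gamma b) * (v powr (b - 1) * indicator {0..1} v + 1 / (1 + v) ^ 2)"
      using G by (intro mult_left_mono *) auto
    finally have "ennreal (norm (kap b s) / (1 + \<bar>s\<bar>) ^ ?k) \<le> ennreal \<dots>"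
      by (rule ennreal_leI)
    also have "\<dots> = ennreal (1 / Gamma b) * (ennreal (v powr (b - 1)) * indicator {0..1} v + ennreal (1 / (1 + v) ^ 2))"
      using G v by (simp add: ennreal_mult[symmetric] ennreal_plus[symmetric] del: ennreal_plus split: split_indicator)
    finally show ?thesis using True by (simp add: v_def)
  qed
  have 1: "(\<integral>\<^sup>+s. ennreal ((- s) powr (b - 1)) * indicator {0..1} (- s) \<partial>lborel) = ennreal (1 powr (b - 1 + 1) / (b - 1 + 1))"
  proof (subst nn_integral_lborel_shift(3)[of "\<lambda>s. ennreal (s powr (b - 1)) * indicator {0..1} s"])
    show "(\<integral>\<^sup>+s. ennreal (s powr (b - 1)) * indicator {0..1} s \<partial>lborel) = ennreal (1 powr (b - 1 + 1) / (b - 1 + 1))"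
      by (rule nn_integral_has_integral_lebesgue') (use b has_integral_powr_from_0[of "b - 1" 1] in auto)
  qed measurable
  have "(\<integral>\<^sup>+s. ennreal (norm (kap b s) / (1 + \<bar>s\<bar>) ^ ?k) \<partial>lborel) \<le>
     (\<integral>\<^sup>+s. ennreal (1 / Gamma b) * (ennreal ((- s) powr (b - 1)) * indicator {0..1} (- s) + ennreal (1 / (1 + \<bar>s\<bar>) ^ 2)) \<partial>lborel)"
    by (intro nn_integral_mono le)
  also have "\<dots> = ennreal (1 / Gamma b) * ((\<integral>\<^sup>+s. ennreal ((- s) powr (b - 1)) * indicator {0..1} (- s) \<partial>lborel)
      + (\<integral>\<^sup>+s. ennreal (1 / (1 + \<bar>s\<bar>) ^ 2) \<partial>lborel))"
    by (subst nn_integral_cmult) (auto simp: nn_integral_add)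
  also have "\<dots> < top"
    using order_le_less_trans[OF nn_integral_one_plus_square, of top] unfolding 1
    by (intro ennreal_mult_less_top[THEN iffD2] disjI2 conjI) (auto simp: ennreal_add_less_top)
  finally show "(\<integral>\<^sup>+s. ennreal (norm (kap b s) / (1 + \<bar>s\<bar>) ^ ?k) \<partial>lborel) < top" .
qed measurable

text \<open>Decay is required at plus infinity only. Fractional integration looks to the right, so
  it preserves this property, while decay at minus infinity is lost in general.\<close>

definition rapid :: "(real \<Rightarrow> complex) \<Rightarrow> bool" where
  "rapid F \<longleftrightarrow> F \<in> borel_measurable borel \<and> (\<forall>j. \<exists>C\<ge>0. \<forall>x\<ge>0. norm (F x) \<le> C / (1 + x) ^ j)"

lemma rapid_measurable: "rapid F \<Longrightarrow> F \<in> borel_measurable borel"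
  by (simp add: rapid_def)

lemma schwartz_rapid: "f \<in> schwartz \<Longrightarrow> rapid f"
  unfolding rapid_def using schwartz_decay[of f] schwartz_measurable[of f]
  by (metis abs_of_nonneg)

text \<open>On the support of the kernel \<open>x - s\<close> equals x + |s|, so the decay of
  \<open>F\<close> can be split: one part survives as decay in \<open>x\<close>, the other makes the
  kernel integrable.\<close>

lemma rapid_nn_conv_kap:
  assumes F: "rapid F" and b: "0 < b"
  shows "\<exists>C\<ge>0. \<forall>x\<ge>0. (\<integral>\<^sup>+s. ennreal (rk b s) * ennreal (norm (F (x - s))) \<partial>lborel) \<le> ennreal (C / (1 + x) ^ j)"
proof -
  let ?k = "nat \<lceil>b\<rceil> + 2"
  obtain C where C: "0 \<le> C" "\<And>x. 0 \<le> x \<Longrightarrow> norm (F x) \<le> C / (1 + x) ^ (j + ?k)"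
    using F unfolding rapid_def by meson
  have int: "integrable lborel (\<lambda>s. norm (kap b s) / (1 + \<bar>s\<bar>) ^ ?k)"
    using kap_tempered[OF b] by (simp only: tempered_def)
  define D where "D = (\<integral>s. norm (kap b s) / (1 + \<bar>s\<bar>) ^ ?k \<partial>lborel)"
  have D: "0 \<le> D" unfolding D_def by (intro integral_nonneg_AE AE_I2) auto
  have "(\<integral>\<^sup>+s. ennreal (rk b s) * ennreal (norm (F (x - s))) \<partial>lborel) \<le> ennreal (C * D / (1 + x) ^ j)" if x: "0 \<le> x" for x
  proof -
    have "(\<integral>\<^sup>+s. ennreal (rk b s) * ennreal (norm (F (x - s))) \<partial>lborel) \<le>
        (\<integral>\<^sup>+s. ennreal (C / (1 + x) ^ j) * ennreal (norm (kap b s) / (1 + \<bar>s\<bar>) ^ ?k) \<partial>lborel)"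
    proof (intro nn_integral_mono)
      fix s
      show "ennreal (rk b s) * ennreal (norm (F (x - s))) \<le> ennreal (C / (1 + x) ^ j) * ennreal (norm (kap b s) / (1 + \<bar>s\<bar>) ^ ?k)"
      proof (cases "s < 0")
        case True
        have "norm (F (x - s)) \<le> C / (1 + (x - s)) ^ (j + ?k)"
          using True x by (intro C) auto
        also have "\<dots> = C / ((1 + (x - s)) ^ j * (1 + (x - s)) ^ ?k)" by (simp only: power_add)
        also have "\<dots> \<le> C / ((1 + x) ^ j * (1 + \<bar>s\<bar>) ^ ?k)"
          using True x C by (intro divide_left_mono mult_mono power_mono mult_pos_pos zero_less_power) auto
        finally have "rk b s * norm (F (x - s)) \<le> rk b s * (C / ((1 + x) ^ j * (1 + \<bar>s\<bar>) ^ ?k))"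
          using rk_nonneg[OF b] by (intro mult_left_mono) auto
        also have "\<dots> = C / (1 + x) ^ j * (norm (kap b s) / (1 + \<bar>s\<bar>) ^ ?k)"
          using rk_nonneg[OF b, of s] by simp
        finally show ?thesis
          using rk_nonneg[OF b, of s] C x by (simp add: ennreal_mult[symmetric] ennreal_leI del: norm_of_real)
      qed (simp add: rk_def)
    qed
    also have "\<dots> = ennreal (C / (1 + x) ^ j) * (\<integral>\<^sup>+s. ennreal (norm (kap b s) / (1 + \<bar>s\<bar>) ^ ?k) \<partial>lborel)"
      by (rule nn_integral_cmult) measurable
    also have "(\<integral>\<^sup>+s. ennreal (norm (kap b s) / (1 + \<bar>s\<bar>) ^ ?k) \<partial>lborel) = ennreal D"
      unfolding D_def by (intro nn_integral_eq_integral int AE_I2) auto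
    finally show ?thesis using C x D by (simp add: ennreal_mult[symmetric])
  qed
  then show ?thesis using C D by (intro exI[of _ "C * D"]) auto
qed

lemma rapid_conv_kap:
  assumes F: "rapid F" and b: "0 < b"
  shows "rapid (conv F (kap b))"
proof -
  have [measurable]: "F \<in> borel_measurable borel" using F by (rule rapid_measurable)
  have "\<exists>C\<ge>0. \<forall>x\<ge>0. norm (conv F (kap b) x) \<le> C / (1 + x) ^ j" for j
  proof -
    obtain C where C: "C \<ge> 0" "\<And>x. x\<ge>0 \<Longrightarrow> (\<integral>\<^sup>+s. ennreal (rk b s) * ennreal (norm (F (x - s))) \<partial>lborel) \<le> ennreal (C / (1 + x) ^ j)"
      using rapid_nn_conv_kap[OF F b] by blast
    have "norm (conv F (kap b) x) \<le> C / (1 + x) ^ j" if x: "0 \<le> x" for x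
    proof -
      have "ennreal (norm (conv F (kap b) x)) \<le> ennreal (C / (1 + x) ^ j)"
        using order_trans[OF norm_conv_le[of F "kap b" x] C(2)[OF x, THEN order_trans[rotated]]] rk_nonneg[OF b]
        by simp
      then show ?thesis using x C by (simp add: ennreal_le_iff)
    qed
    with C show ?thesis by blast
  qed
  then show ?thesis unfolding rapid_def by simp
qed

lemma rapid_conv_kap_assoc:
  assumes F: "rapid F" and a: "0 < a" and b: "0 < b" and x: "0 \<le> x"
  shows "conv (conv F (kap b)) (kap a) x = conv F (kap (a + b)) x"
proof -
  have [measurable]: "F \<in> borel_measurable borel" using F by (rule rapid_measurable)
  obtain C where C: "\<And>x. x\<ge>0 \<Longrightarrow> (\<integral>\<^sup>+s. ennreal (rk (a + b) s) * ennreal (norm (F (x - s))) \<partial>lborel) \<le> ennreal (C / (1 + x) ^ 0)"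
    using rapid_nn_conv_kap[OF F add_pos_pos[OF a b]] by blast
  have "(\<integral>\<^sup>+r. ennreal (norm (kap a r)) * (\<integral>\<^sup>+s. ennreal (norm (kap b s)) * ennreal (norm (F (x - r - s))) \<partial>lborel) \<partial>lborel)
     = (\<integral>\<^sup>+s. (\<integral>\<^sup>+r. ennreal (norm (kap a r)) * ennreal (norm (kap b (s - r))) \<partial>lborel) * ennreal (norm (F (x - s))) \<partial>lborel)"
    by (rule nn_conv_assoc) measurable
  also have "\<dots> = (\<integral>\<^sup>+s. ennreal (rk (a + b) s) * ennreal (norm (F (x - s))) \<partial>lborel)"
    using nn_integral_rk_rk[OF b a] rk_nonneg[OF a] rk_nonneg[OF b] by (simp add: add.commute)
  also have "\<dots> < top"
    using C[OF x] by (rule order_le_less_trans) simp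
  finally have "conv (conv F (kap b)) (kap a) x = conv F (conv (kap b) (kap a)) x"
    by (intro conv_assoc_at) auto
  then show ?thesis by (simp add: conv_kap_kap[OF b a] add.commute)
qed

lemma conv_translate: "conv (\<lambda>x. f (x + c)) g t = conv f g (t + c)"
  by (simp add: conv_def algebra_simps)

lemma schwartz_translate:
  assumes "f \<in> schwartz"
  shows "rapid (\<lambda>x. f (x + c))"
  unfolding rapid_def
proof (intro conjI allI)
  show "(\<lambda>x. f (x + c)) \<in> borel_measurable borel"
    using schwartz_measurable[OF assms] by measurable
  fix j
  obtain C where C: "0 \<le> C" "\<And>x. norm (f x) \<le> C / (1 + \<bar>x\<bar>) ^ j" using schwartz_decay[OF assms] by blast
  have "norm (f (x + c)) \<le> C * (1 + \<bar>c\<bar>) ^ j / (1 + x) ^ j" if "0 \<le> x" for x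
  proof -
    have "norm (f (x + c)) \<le> C * (1 / (1 + \<bar>c - (- x)\<bar>) ^ j)" using C(2)[of "x + c"] by (simp add: add.commute)
    also have "\<dots> \<le> C * ((1 + \<bar>c\<bar>) ^ j / (1 + \<bar>- x\<bar>) ^ j)"
      by (intro mult_left_mono inverse_one_plus_abs_shift C)
    finally show ?thesis using that by simp
  qed
  then show "\<exists>C\<ge>0. \<forall>x\<ge>0. norm (f (x + c)) \<le> C / (1 + x) ^ j"
    using C by (intro exI[of _ "C * (1 + \<bar>c\<bar>) ^ j"]) auto
qed

text \<open>\<open>rapid_conv_kap_assoc\<close> speaks about nonnegative points. Applied at the
  point 0 to every translate of \<open>f\<close> it covers the whole line.\<close>

lemma schwartz_conv_kap_assoc:
  assumes f: "f \<in> schwartz" and a: "0 < a" and b: "0 < b"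
  shows "conv (conv f (kap b)) (kap a) = conv f (kap (a + b))"
proof
  fix t
  have "conv (conv (\<lambda>x. f (x + t)) (kap b)) (kap a) 0 = conv (\<lambda>x. f (x + t)) (kap (a + b)) 0"
    by (intro rapid_conv_kap_assoc schwartz_translate f a b order_refl)
  then show "conv (conv f (kap b)) (kap a) t = conv f (kap (a + b)) t"
    by (simp add: conv_translate[abs_def] conv_translate)
qed

text \<open>\<open>kap 1\<close> is the indicator of the negative half-line, so this is the
  fundamental theorem of calculus on a right half-line, with limit 0 at infinity.\<close>

lemma conv_kap_1_dv:
  assumes f: "f \<in> schwartz"
  shows "conv (\<lambda>x. - dv f x) (kap 1) = f"
proof
  fix t
  have lim: "(f \<longlongrightarrow> 0) at_top"
  proof -
    obtain C where C: "0 \<le> C" "\<And>x. norm (f x) \<le> C / (1 + \<bar>x\<bar>) ^ 1" using schwartz_decay[OF f] by blast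
    have "((\<lambda>x. C / (1 + \<bar>x\<bar>)) \<longlongrightarrow> 0) at_top"
      by (intro tendsto_divide_0[OF tendsto_const] filterlim_at_top_imp_at_infinity
          filterlim_tendsto_add_at_top[OF tendsto_const] filterlim_abs_real)
    then show ?thesis
      by (rule Lim_null_comparison[rotated]) (use C in auto)
  qed
  have int: "integrable lborel (dv f)" using schwartz_integrable[OF schwartz_dv[OF f]] .
  have "(LBINT x=ereal t..\<infinity>. dv f x) = 0 - f t"
  proof (rule interval_integral_FTC_integrable)
    show "(f has_vector_derivative dv f x) (at x)" for x by (rule schwartz_has_vector_derivative[OF f])
    show "isCont (dv f) x" for x
      using schwartz_differentiable[OF schwartz_dv[OF f]] by (rule differentiable_imp_continuous_within)
    show "set_integrable lborel (einterval (ereal t) \<infinity>) (dv f)"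
      unfolding set_integrable_def by (intro integrable_mult_indicator int) auto
    have "isCont f t"
      using schwartz_differentiable[OF f] by (rule differentiable_imp_continuous_within)
    then show "((f \<circ> real_of_ereal) \<longlongrightarrow> f t) (at_right (ereal t))"
      by (simp add: ereal_tendsto_simps isCont_def filterlim_at_split)
    show "((f \<circ> real_of_ereal) \<longlongrightarrow> 0) (at_left \<infinity>)"
      using lim by (simp add: ereal_tendsto_simps)
  qed auto
  moreover have "einterval (ereal t) \<infinity> = {t<..}" by (auto simp: einterval_iff)
  ultimately have "f t = (\<integral>x. - (indicator {t<..} x *\<^sub>R dv f x) \<partial>lborel)"
    by (simp add: interval_lebesgue_integral_def set_lebesgue_integral_def)
  also have "\<dots> = (\<integral>s. - (indicator {t<..} (t - s) *\<^sub>R dv f (t - s)) \<partial>lborel)"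
    by (rule lborel_integral_shift(2)[symmetric])
  also have "\<dots> = conv (\<lambda>x. - dv f x) (kap 1) t"
    unfolding conv_def by (intro Bochner_Integration.integral_cong) (auto simp: rk_def split: split_indicator)
  finally show "conv (\<lambda>x. - dv f x) (kap 1) t = f t" by simp
qed

section \<open>The Weyl derivative of a Schwartz function\<close>

definition sderiv :: "nat \<Rightarrow> (real \<Rightarrow> complex) \<Rightarrow> real \<Rightarrow> complex" where
  "sderiv n f = (\<lambda>x. (- 1) ^ n * vderiv_iter n f x)"

lemma schwartz_sderiv: "f \<in> schwartz \<Longrightarrow> sderiv n f \<in> schwartz"
  unfolding sderiv_def by (intro schwartz_cmult schwartz_vderiv_iter)

lemma dv_sderiv:
  assumes "f \<in> schwartz"
  shows "(\<lambda>x. - dv (sderiv n f) x) = sderiv (Suc n) f"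
proof
  fix x
  have "((\<lambda>x. (- 1) ^ n * vderiv_iter n f x) has_vector_derivative (- 1) ^ n * dv (vderiv_iter n f) x) (at x)"
    by (intro derivative_intros schwartz_has_vector_derivative schwartz_vderiv_iter assms)
  then show "- dv (sderiv n f) x = sderiv (Suc n) f x"
    unfolding sderiv_def by (simp add: vector_derivative_at vderiv_iter_Suc)
qed

lemma conv_sderiv_kap:
  assumes f: "f \<in> schwartz"
  shows "conv (sderiv (Suc n) f) (kap (real (Suc n))) = f"
proof (induction n)
  case 0
  have "sderiv 0 f = f" by (simp add: sderiv_def)
  then show ?case using dv_sderiv[OF f, of 0] conv_kap_1_dv[OF f] by simp
next
  case (Suc n)
  have "conv (sderiv (Suc (Suc n)) f) (kap (real (Suc n) + 1)) = conv (conv (sderiv (Suc (Suc n)) f) (kap 1)) (kap (real (Suc n)))"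
    by (rule schwartz_conv_kap_assoc[symmetric]) (auto intro: schwartz_sderiv f)
  also have "conv (sderiv (Suc (Suc n)) f) (kap 1) = sderiv (Suc n) f"
    using conv_kap_1_dv[OF schwartz_sderiv[OF f, of "Suc n"]] by (simp only: dv_sderiv[OF f])
  finally show ?case using Suc by (simp add: add.commute)
qed

lemma weyl_plus_int_eq: "weyl_plus_int b f = conv f (kap b)"
proof
  fix x
  have "conv f (kap b) x = (\<integral>s. (\<lambda>s. indicator {x<..} s *\<^sub>R (complex_of_real ((s - x) powr (b - 1) / Gamma b) * f s)) (x - s) \<partial>lborel)"
    unfolding conv_def by (intro Bochner_Integration.integral_cong) (auto simp: rk_def split: split_indicator)
  also have "\<dots> = (\<integral>s. indicator {x<..} s *\<^sub>R (complex_of_real ((s - x) powr (b - 1) / Gamma b) * f s) \<partial>lborel)"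
    by (rule lborel_integral_shift(2))
  also have "\<dots> = (\<integral>s. complex_of_real (1 / Gamma b) * (indicator {x<..} s *\<^sub>R (complex_of_real ((s - x) powr (b - 1)) * f s)) \<partial>lborel)"
    by (intro Bochner_Integration.integral_cong) (auto simp: scaleR_conv_of_real)
  also have "\<dots> = weyl_plus_int b f x"
    unfolding weyl_plus_int_def set_lebesgue_integral_def by (rule integral_mult_right_zero)
  finally show "weyl_plus_int b f x = conv f (kap b) x" by simp
qed

text \<open>All derivatives are moved onto \<open>f\<close>, which turns the Weyl derivative into a
  fractional integral of a Schwartz function. Inversion, decay, growth and linearity are read off
  from this form.\<close>

lemma weyl_plus_eq:
  assumes f: "f \<in> schwartz" and a: "0 < a"
  shows "weyl_plus a f = conv (sderiv (nat \<lfloor>a\<rfloor> + 1) f) (kap (real (nat \<lfloor>a\<rfloor> + 1) - a))"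
proof -
  have "0 < real (nat \<lfloor>a\<rfloor> + 1) - a" using a by linarith
  note temp = kap_tempered[OF this]
  show ?thesis
    using a vderiv_iter_conv[OF f temp] 
    by (simp add: weyl_plus_def Let_def weyl_plus_int_eq fun_eq_iff)
       (simp add: conv_def sderiv_def mult.assoc)
qed

text \<open>With n = \<lfloor>a\<rfloor> + 1 the orders n - a and a of the two kernels add up to the
  integer n, and n-fold integration undoes the n derivatives.\<close>

lemma weyl_plus_inverse:
  assumes f: "f \<in> schwartz" and a: "0 < a"
  shows "conv (weyl_plus a f) (kap a) = f"
proof -
  have "0 < real (nat \<lfloor>a\<rfloor> + 1) - a" using a by linarith
  then show ?thesis
    using conv_sderiv_kap[OF f, of "nat \<lfloor>a\<rfloor>"] schwartz_conv_kap_assoc[OF schwartz_sderiv[OF f] a]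
    by (simp add: weyl_plus_eq[OF f a])
qed

lemma weyl_plus_rapid:
  assumes f: "f \<in> schwartz" and a: "0 < a"
  shows "rapid (weyl_plus a f)"
proof -
  have "0 < real (nat \<lfloor>a\<rfloor> + 1) - a" using a by linarith
  then show ?thesis
    unfolding weyl_plus_eq[OF f a] by (intro rapid_conv_kap schwartz_rapid schwartz_sderiv f)
qed

lemma weyl_plus_diff:
  assumes f: "f \<in> schwartz" and g: "g \<in> schwartz"  and a: "0 < a"
  shows "weyl_plus a (\<lambda>x. f x - g x) t = weyl_plus a f t - weyl_plus a g t"
proof -
  have pos: "0 < real (nat \<lfloor>a\<rfloor> + 1) - a" using a by linarith
  have vd: "vderiv_iter n (\<lambda>x. f x - g x) = (\<lambda>x. vderiv_iter n f x - vderiv_iter n g x)" for n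
  proof (induction n)
    case (Suc n)
    have "((\<lambda>x. vderiv_iter n f x - vderiv_iter n g x) has_vector_derivative dv (vderiv_iter n f) x - dv (vderiv_iter n g) x) (at x)" for x
      by (intro derivative_intros schwartz_has_vector_derivative schwartz_vderiv_iter f g)
    then show ?case using Suc by (auto simp: vderiv_iter_Suc vector_derivative_at)
  qed simp
  have "sderiv n (\<lambda>x. f x - g x) = (\<lambda>x. sderiv n f x - sderiv n g x)" for n
    by (simp add: sderiv_def vd right_diff_distrib)
  then show ?thesis
    unfolding weyl_plus_eq[OF f a] weyl_plus_eq[OF g a] weyl_plus_eq[OF schwartz_diff[OF f g] a] conv_def
    by (simp only: left_diff_distrib Bochner_Integration.integral_diff
        schwartz_conv_integrable[OF schwartz_sderiv[OF f] kap_tempered[OF pos]]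
        schwartz_conv_integrable[OF schwartz_sderiv[OF g] kap_tempered[OF pos]])
qed

text \<open>\<open>h\<close> may be a kernel that is not integrable, so norm inequalities do not
  apply. Peetre's inequality, used twice, bounds the absolute double integral by a weighted integral
  of \<open>g\<close> times one of \<open>h\<close>.\<close>

lemma schwartz_conv_assoc:
  assumes f: "f \<in> schwartz" and g: "g \<in> schwartz" and h: "tempered k h"
  shows "conv (conv f g) h = conv f (conv g h)"
proof
  fix t
  have [measurable]: "f \<in> borel_measurable borel" "g \<in> borel_measurable borel" "h \<in> borel_measurable borel"
    using f g h by (auto simp: schwartz_measurable tempered_def)
  obtain C where C: "0 \<le> C" "\<And>x. norm (f x) \<le> C / (1 + \<bar>x\<bar>) ^ k" using schwartz_decay[OF f] by blast
  define B where "B = (\<integral>s. (1 + \<bar>s\<bar>) ^ k * norm (g s) \<partial>lborel)"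
  define D where "D = (\<integral>s. norm (h s) / (1 + \<bar>s\<bar>) ^ k \<partial>lborel)"
  have "(\<integral>\<^sup>+r. ennreal (norm (h r)) * (\<integral>\<^sup>+s. ennreal (norm (g s)) * ennreal (norm (f (t - r - s))) \<partial>lborel) \<partial>lborel)
    \<le> (\<integral>\<^sup>+r. ennreal (norm (h r) / (1 + \<bar>r\<bar>) ^ k) * (ennreal (C * (1 + \<bar>t\<bar>) ^ k) * ennreal B) \<partial>lborel)"
  proof (intro nn_integral_mono)
    fix r
    have le: "norm (g s) * norm (f (t - r - s)) \<le> C * (1 + \<bar>t\<bar>) ^ k / (1 + \<bar>r\<bar>) ^ k * ((1 + \<bar>s\<bar>) ^ k * norm (g s))" for s
    proof -
      have "norm (f (t - r - s)) \<le> C * (1 / (1 + \<bar>(t - s) - r\<bar>) ^ k)" using C(2)[of "t - r - s"] by (simp add: algebra_simps)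
      also have "\<dots> \<le> C * ((1 + \<bar>t - s\<bar>) ^ k / (1 + \<bar>r\<bar>) ^ k)"
        by (intro mult_left_mono inverse_one_plus_abs_shift C)
      also have "\<dots> \<le> C * (((1 + \<bar>s\<bar>) * (1 + \<bar>t\<bar>)) ^ k / (1 + \<bar>r\<bar>) ^ k)"
        using one_plus_abs_mult[of "t - s" t] by (intro mult_left_mono divide_right_mono power_mono C) auto
      finally have "norm (g s) * norm (f (t - r - s)) \<le> norm (g s) * (C * (((1 + \<bar>s\<bar>) * (1 + \<bar>t\<bar>)) ^ k / (1 + \<bar>r\<bar>) ^ k))"
        by (intro mult_left_mono) auto
      also have "\<dots> = C * (1 + \<bar>t\<bar>) ^ k / (1 + \<bar>r\<bar>) ^ k * ((1 + \<bar>s\<bar>) ^ k * norm (g s))"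
        by (simp only: power_mult_distrib) simp
      finally show ?thesis .
    qed
    have "(\<integral>\<^sup>+s. ennreal (norm (g s)) * ennreal (norm (f (t - r - s))) \<partial>lborel)
        \<le> (\<integral>\<^sup>+s. ennreal (C * (1 + \<bar>t\<bar>) ^ k / (1 + \<bar>r\<bar>) ^ k) * ennreal ((1 + \<bar>s\<bar>) ^ k * norm (g s)) \<partial>lborel)"
      using le C by (intro nn_integral_mono) (simp add: ennreal_mult[symmetric] ennreal_leI)
    also have "\<dots> = ennreal (C * (1 + \<bar>t\<bar>) ^ k / (1 + \<bar>r\<bar>) ^ k) * (\<integral>\<^sup>+s. ennreal ((1 + \<bar>s\<bar>) ^ k * norm (g s)) \<partial>lborel)"
      by (rule nn_integral_cmult) measurable
    also have "(\<integral>\<^sup>+s. ennreal ((1 + \<bar>s\<bar>) ^ k * norm (g s)) \<partial>lborel) = ennreal B"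
      unfolding B_def by (intro nn_integral_eq_integral schwartz_weighted_integrable g AE_I2) auto
    finally have "ennreal (norm (h r)) * (\<integral>\<^sup>+s. ennreal (norm (g s)) * ennreal (norm (f (t - r - s))) \<partial>lborel)
      \<le> ennreal (norm (h r)) * (ennreal (C * (1 + \<bar>t\<bar>) ^ k / (1 + \<bar>r\<bar>) ^ k) * ennreal B)"
      by (intro mult_left_mono) auto
    also have "\<dots> = ennreal (norm (h r)) * ennreal (C * (1 + \<bar>t\<bar>) ^ k / (1 + \<bar>r\<bar>) ^ k) * ennreal B"
      by (simp only: mult.assoc)
    also have "ennreal (norm (h r)) * ennreal (C * (1 + \<bar>t\<bar>) ^ k / (1 + \<bar>r\<bar>) ^ k) = ennreal (norm (h r) / (1 + \<bar>r\<bar>) ^ k) * ennreal (C * (1 + \<bar>t\<bar>) ^ k)"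
      using C by (simp add: ennreal_mult[symmetric] mult_ac)
    finally show "ennreal (norm (h r)) * (\<integral>\<^sup>+s. ennreal (norm (g s)) * ennreal (norm (f (t - r - s))) \<partial>lborel)
      \<le> ennreal (norm (h r) / (1 + \<bar>r\<bar>) ^ k) * (ennreal (C * (1 + \<bar>t\<bar>) ^ k) * ennreal B)"
      by (simp only: mult.assoc)
  qed
  also have "\<dots> = (\<integral>\<^sup>+r. ennreal (norm (h r) / (1 + \<bar>r\<bar>) ^ k) \<partial>lborel) * (ennreal (C * (1 + \<bar>t\<bar>) ^ k) * ennreal B)"
    by (rule nn_integral_multc) measurable
  also have "(\<integral>\<^sup>+r. ennreal (norm (h r) / (1 + \<bar>r\<bar>) ^ k) \<partial>lborel) = ennreal D"
    unfolding D_def using h by (intro nn_integral_eq_integral AE_I2) (auto simp: tempered_def)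
  also have "ennreal D * (ennreal (C * (1 + \<bar>t\<bar>) ^ k) * ennreal B) < top"
    by (simp add: ennreal_mult_less_top)
  finally show "conv (conv f g) h t = conv f (conv g h) t"
    by (intro conv_assoc_at) auto
qed

text \<open>The integer derivatives may all be placed on \<open>g\<close>, and associativity then
  moves the fractional kernel to the second factor as well.\<close>

lemma weyl_plus_conv:
  assumes f: "f \<in> schwartz" and g: "g \<in> schwartz" and a: "0 < a"
  shows "weyl_plus a (conv f g) = conv f (weyl_plus a g)"
proof -
  let ?n = "nat \<lfloor>a\<rfloor> + 1"
  have pos: "0 < real ?n - a" using a by linarith
  have "sderiv ?n (conv f g) = conv f (sderiv ?n g)"
    using vderiv_iter_conv[OF g schwartz_tempered[OF f], of ?n]
    by (simp add: sderiv_def conv_commute[of f]) (simp add: conv_def mult.assoc fun_eq_iff)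
  then show ?thesis
    using schwartz_conv_assoc[OF f schwartz_sderiv[OF g] kap_tempered[OF pos]]
    by (simp only: weyl_plus_eq[OF g a] weyl_plus_eq[OF schwartz_conv[OF f g] a])
qed

text \<open>Reflection multiplies the n-th derivative by (-1)^n, which is exactly the sign by which
  the two definitions differ. Work on the negative half-line thus reduces to
  \<open>weyl_plus\<close>.\<close>

lemma weyl_minus_eq:
  assumes f: "f \<in> schwartz"
    and a: "0 \<le> a"
  shows "weyl_minus a f t = weyl_plus a (\<lambda>x. f (- x)) (- t)"
proof (cases "a = 0")
  case False
  let ?n = "nat \<lfloor>a\<rfloor> + 1"
  have int: "weyl_minus_int b f = (\<lambda>x. weyl_plus_int b (\<lambda>x. f (- x)) (- x))" for b
  proof
    fix x
    have "(LINT s:{- x<..}|lborel. complex_of_real ((s - - x) powr (b - 1)) * f (- s))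
        = (\<integral>s. (\<lambda>s. indicator {..<x} s *\<^sub>R (complex_of_real ((x - s) powr (b - 1)) * f s)) (- s) \<partial>lborel)"
      unfolding set_lebesgue_integral_def
      by (intro Bochner_Integration.integral_cong) (auto split: split_indicator simp: add.commute)
    also have "\<dots> = (LINT s:{..<x}|lborel. complex_of_real ((x - s) powr (b - 1)) * f s)"
      unfolding set_lebesgue_integral_def by (rule lborel_integral_shift(3))
    finally show "weyl_minus_int b f x = weyl_plus_int b (\<lambda>x. f (- x)) (- x)"
      by (simp add: weyl_minus_int_def weyl_plus_int_def)
  qed
  define u where "u = weyl_plus_int (real ?n - a) (\<lambda>x. f (- x))"
  have pos: "0 < real ?n - a" using a by linarith
  have d: "vderiv_iter m u differentiable (at x)" for m x
    unfolding u_def weyl_plus_int_eq vderiv_iter_conv[OF schwartz_reflect[OF f] kap_tempered[OF pos]]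
    using conv_has_vector_derivative[OF schwartz_vderiv_iter[OF schwartz_reflect[OF f]] kap_tempered[OF pos]]
    by (rule differentiableI_vector)
  have vd: "vderiv_iter m (\<lambda>x. u (- x)) = (\<lambda>x. (- 1) ^ m * vderiv_iter m u (- x))" for m
  proof (induction m)
    case (Suc m)
    have "((\<lambda>x. (- 1) ^ m * vderiv_iter m u (- x)) has_vector_derivative (- 1) ^ m * (- dv (vderiv_iter m u) (- x))) (at x)" for x
      using d vector_derivative_works by (intro derivative_intros has_vector_derivative_reflect) blast
    then have "dv (\<lambda>x. (- 1) ^ m * vderiv_iter m u (- x)) = (\<lambda>x. (- 1) ^ m * (- dv (vderiv_iter m u) (- x)))"
      by (intro ext vector_derivative_at)
    then show ?case using Suc by (simp add: vderiv_iter_Suc)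
  qed simp
  show ?thesis
    using False vd[of ?n] by (simp add: weyl_minus_def weyl_plus_def Let_def int u_def)
qed (simp add: weyl_minus_def weyl_plus_def)

section \<open>Hardy inequalities\<close>

text \<open>The dilate u(x r) has p-norm r^(-1/p) times that of \<open>u\<close>, which explains the
  integral required of \<open>w\<close>. The inner integral is a superposition of dilates, so
  Minkowski's inequality applies.\<close>

lemma dilation_nn_integral_le:
  fixes w :: "real \<Rightarrow> real" and u :: "real \<Rightarrow> ennreal"
  assumes p: "1 \<le> p" and [measurable]: "w \<in> borel_measurable borel" "u \<in> borel_measurable borel"
    and w0: "\<And>r. r \<le> 1 \<Longrightarrow> w r = 0" and m: "0 \<le> m"
    and w: "(\<integral>\<^sup>+r. ennreal (w r * r powr (- 1 / p)) \<partial>lborel) \<le> ennreal m"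
  shows "(\<integral>\<^sup>+x. epow (\<integral>\<^sup>+r. ennreal (w r) * u (x * r) \<partial>lborel) p \<partial>lborel)
    \<le> ennreal (m powr p) * (\<integral>\<^sup>+x. epow (u x) p \<partial>lborel)"
proof -
  \<comment> \<open>The dilates are rescaled so that all of them have the same p-norm.\<close>
  have eq: "ennreal (w r) * u (x * r) = ennreal (w r * r powr (- 1 / p)) * (ennreal (r powr (1 / p)) * u (x * r))" for r x
  proof (cases "r \<le> 1")
    case False
    have "ennreal (w r) = ennreal (w r * r powr (- 1 / p) * r powr (1 / p))"
      using False by (simp add: mult.assoc powr_add[symmetric])
    also have "\<dots> = ennreal (w r * r powr (- 1 / p)) * ennreal (r powr (1 / p))"
      by (rule ennreal_mult'') simp
    finally show ?thesis by (simp add: mult.assoc)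
  qed (simp add: w0)
  show ?thesis
    unfolding eq
  proof (rule lborel.minkowski_nn_integral_le[OF p _ _ w m])
    fix r assume "ennreal (w r * r powr (- 1 / p)) \<noteq> 0"
    then have r: "1 < r" using w0[of r] by (cases "r \<le> 1") auto
    have "(\<integral>\<^sup>+x. epow (ennreal (r powr (1 / p)) * u (x * r)) p \<partial>lborel) = ennreal r * (\<integral>\<^sup>+x. epow (u (0 + r * x)) p \<partial>lborel)"
      using r p by (simp add: epow_mult powr_powr nn_integral_cmult mult.commute)
    also have "\<dots> = (\<integral>\<^sup>+x. epow (u x) p \<partial>lborel)"
      using r nn_integral_real_affine[of "\<lambda>x. epow (u x) p" r 0] by simp
    finally show "(\<integral>\<^sup>+x. epow (ennreal (r powr (1 / p)) * u (x * r)) p \<partial>lborel) \<le> (\<integral>\<^sup>+x. epow (u x) p \<partial>lborel)"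
      by simp
  qed measurable
qed

lemma nn_integral_powr_ge_1:
  assumes p: "1 \<le> p"
  shows "(\<integral>\<^sup>+r. ennreal (r powr (- 1 - 1 / p)) * indicator {1..} r \<partial>lborel) = ennreal p"
proof -
  have "((\<lambda>x. x powr (- 1 - 1 / p)) has_integral - (1 powr ((- 1 - 1 / p) + 1)) / ((- 1 - 1 / p) + 1)) {1..}"
    using p by (intro has_integral_powr_to_inf) auto
  then have "((\<lambda>x. x powr (- 1 - 1 / p)) has_integral p) {1..}" using p by simp
  then show ?thesis by (intro nn_integral_has_integral_lebesgue') auto
qed

section \<open>The weighted density and the two Hardy operators\<close>

definition wpos :: "real \<Rightarrow> (real \<Rightarrow> complex) \<Rightarrow> real \<Rightarrow> ennreal" where
  "wpos a F t = ennreal (t powr a * norm (F t)) * indicator {0<..} t"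

lemma wpos_measurable [measurable]:
  assumes [measurable]: "F \<in> borel_measurable borel"
  shows "wpos a F \<in> borel_measurable borel"
  unfolding wpos_def[abs_def] by measurable

text \<open>The Weyl integral of the absolute value of \<open>F\<close>, cut off to the positive
  half-line. As a nonnegative integral it presupposes no integrability.\<close>

definition phi :: "real \<Rightarrow> (real \<Rightarrow> complex) \<Rightarrow> real \<Rightarrow> ennreal" where
  "phi a F v = indicator {0<..} v * (\<integral>\<^sup>+s. ennreal (rk a s) * ennreal (norm (F (v - s))) \<partial>lborel)"

lemma phi_measurable [measurable]:
  assumes [measurable]: "F \<in> borel_measurable borel"
  shows "phi a F \<in> borel_measurable borel"
  unfolding phi_def[abs_def] by measurable

definition hardy_tail :: "real \<Rightarrow> (real \<Rightarrow> complex) \<Rightarrow> real \<Rightarrow> ennreal" where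
  "hardy_tail a F x = indicator {0<..} x * (\<integral>\<^sup>+t. ennreal (t powr (a - 1)) * ennreal (norm (F t)) * indicator {0..} (t - x) \<partial>lborel)"

lemma hardy_tail_measurable [measurable]:
  assumes [measurable]: "F \<in> borel_measurable borel"
  shows "hardy_tail a F \<in> borel_measurable borel"
  unfolding hardy_tail_def[abs_def] by measurable

text \<open>The substitution s = v - v r writes \<open>phi a F\<close> as a superposition of dilates
  of \<open>wpos a F\<close>: the weight t^a exactly compensates the homogeneity of the
  kernel.\<close>

lemma hardy_phi:
  assumes p: "1 \<le> p" and a: "0 < a"
  shows "\<exists>C\<ge>0. \<forall>F\<in>borel_measurable borel.
    (\<integral>\<^sup>+v. epow (phi a F v) p \<partial>lborel) \<le> ennreal (C powr p) * (\<integral>\<^sup>+t. epow (wpos a F t) p \<partial>lborel)"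
proof -
  note G = Gamma_real_pos[OF a]
  \<comment> \<open>The factor \<open>r powr (- a)\<close> undoes the power of \<open>r\<close> that
    \<open>wpos\<close> contains at the point \<open>v * r\<close>.\<close>
  define w where "w r = (if r > 1 then (r - 1) powr (a - 1) * r powr (- a) / Gamma a else 0)" for r :: real
  have [measurable]: "w \<in> borel_measurable borel" unfolding w_def[abs_def] by measurable
  \<comment> \<open>With r = 1 + u, the part u \<le> 1 contributes 1/a, from the singularity of the
    kernel, and the part u \<ge> 1 contributes \<open>p\<close>, from the tail
    \<open>u powr (- 1 - 1 / p)\<close>.\<close>
  define m where "m = (1 / Gamma a) * (1 / a + p)"
  have m: "0 \<le> m" using G a p by (simp add: m_def)
  have wm: "(\<integral>\<^sup>+r. ennreal (w r * r powr (- 1 / p)) \<partial>lborel) \<le> ennreal m"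
  proof -
    have le: "ennreal (w (1 + 1 * u) * (1 + 1 * u) powr (- 1 / p)) \<le>
       ennreal (1 / Gamma a) * (ennreal (u powr (a - 1)) * indicator {0..1} u + ennreal (u powr (- 1 - 1 / p)) * indicator {1..} u)" for u :: real
    proof (cases "0 < u")
      case True
      have "w (1 + u) * (1 + u) powr (- 1 / p) = (1 / Gamma a) * (u powr (a - 1) * (1 + u) powr (- a - 1 / p))"
        using True by (simp add: w_def mult.assoc powr_add[symmetric])
      also have "u powr (a - 1) * (1 + u) powr (- a - 1 / p) \<le> u powr (a - 1) * indicator {0..1} u + u powr (- 1 - 1 / p) * indicator {1..} u"
      proof (cases "u \<le> 1")
        case True
        have "(1 + u) powr (- a - 1 / p) \<le> (1 + u) powr 0"
          using \<open>0 < u\<close> a p by (intro powr_mono) (auto intro: order_trans[of _ 0])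
        then have "u powr (a - 1) * (1 + u) powr (- a - 1 / p) \<le> u powr (a - 1) * 1"
          using \<open>0 < u\<close> by (intro mult_left_mono) auto
        then show ?thesis using True \<open>0 < u\<close> by (auto simp: add_increasing2 split: split_indicator)
      next
        case False
        have "(1 + u) powr (- a - 1 / p) \<le> u powr (- a - 1 / p)"
          using \<open>0 < u\<close> a p by (intro powr_mono2') (auto intro: order_trans[of _ 0])
        then have "u powr (a - 1) * (1 + u) powr (- a - 1 / p) \<le> u powr (a - 1) * u powr (- a - 1 / p)"
          by (intro mult_left_mono) auto
        also have "\<dots> = u powr (- 1 - 1 / p)" by (simp add: powr_add[symmetric])
        finally show ?thesis using False by simp
      qed
      finally have "w (1 + u) * (1 + u) powr (- 1 / p) \<le> (1 / Gamma a) * (u powr (a - 1) * indicator {0..1} u + u powr (- 1 - 1 / p) * indicator {1..} u)"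
        using G by (simp add: divide_right_mono)
      then have "ennreal (w (1 + u) * (1 + u) powr (- 1 / p)) \<le> ennreal ((1 / Gamma a) * (u powr (a - 1) * indicator {0..1} u + u powr (- 1 - 1 / p) * indicator {1..} u))"
        by (rule ennreal_leI)
      also have "\<dots> = ennreal (1 / Gamma a) * (ennreal (u powr (a - 1)) * indicator {0..1} u + ennreal (u powr (- 1 - 1 / p)) * indicator {1..} u)"
        using G by (subst ennreal_mult) (auto simp: ennreal_mult ennreal_plus ennreal_indicator)
      finally show ?thesis by simp
    qed (simp add: w_def)
    have "(\<integral>\<^sup>+r. ennreal (w r * r powr (- 1 / p)) \<partial>lborel) = ennreal \<bar>1\<bar> * (\<integral>\<^sup>+u. ennreal (w (1 + 1 * u) * (1 + 1 * u) powr (- 1 / p)) \<partial>lborel)"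
      by (rule nn_integral_real_affine) auto
    also have "\<dots> \<le> ennreal \<bar>1\<bar> * (\<integral>\<^sup>+u. ennreal (1 / Gamma a) * (ennreal (u powr (a - 1)) * indicator {0..1} u + ennreal (u powr (- 1 - 1 / p)) * indicator {1..} u) \<partial>lborel)"
      by (intro mult_left_mono nn_integral_mono le) auto
    also have "\<dots> = ennreal (1 / Gamma a) * ((\<integral>\<^sup>+u. ennreal (u powr (a - 1)) * indicator {0..1} u \<partial>lborel)
        + (\<integral>\<^sup>+u. ennreal (u powr (- 1 - 1 / p)) * indicator {1..} u \<partial>lborel))"
      by (subst nn_integral_cmult) (auto simp: nn_integral_add)
    also have "(\<integral>\<^sup>+u. ennreal (u powr (a - 1)) * indicator {0..1} u \<partial>lborel) = ennreal (1 powr (a - 1 + 1) / (a - 1 + 1))"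
      by (rule nn_integral_has_integral_lebesgue') (use a has_integral_powr_from_0[of "a - 1" 1] in auto)
    also have "ennreal (1 / Gamma a) * (ennreal (1 powr (a - 1 + 1) / (a - 1 + 1)) + (\<integral>\<^sup>+u. ennreal (u powr (- 1 - 1 / p)) * indicator {1..} u \<partial>lborel)) = ennreal m"
      using G a p by (simp add: nn_integral_powr_ge_1 m_def ennreal_mult[symmetric] ennreal_plus[symmetric] del: ennreal_plus)
    finally show ?thesis .
  qed
  have eq: "phi a F v = indicator {0<..} v * (\<integral>\<^sup>+r. ennreal (w r) * wpos a F (v * r) \<partial>lborel)"
    if [measurable]: "F \<in> borel_measurable borel" for F v
  proof (cases "0 < v")
    case True
    have *: "ennreal v * (ennreal (rk a (v + (- v) * r)) * ennreal (norm (F (v - (v + (- v) * r))))) = ennreal (w r) * wpos a F (v * r)" for r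
    proof (cases "1 < r")
      case r: True
      have neg: "v - v * r < 0" using r True by simp
      have "v * rk a (v - v * r) = w r * (v * r) powr a"
      proof -
        have "(- (v - v * r)) powr (a - 1) = v powr (a - 1) * (r - 1) powr (a - 1)"
          using powr_mult[of v "r - 1" "a - 1"] r True by (simp add: algebra_simps)
        moreover have "(v * r) powr a = v powr a * r powr a" using r True by (simp add: powr_mult)
        moreover have "v * v powr (a - 1) = v powr a" using True powr_add[of v 1 "a - 1"] by simp
        moreover have "r powr (- a) * r powr a = 1" using r by (simp add: powr_add[symmetric])
        ultimately show ?thesis using neg r G by (simp add: rk_def w_def field_simps)
      qed
      moreover have "0 \<le> w r" using r G by (simp add: w_def)
      ultimately show ?thesis
        using True r rk_nonneg[OF a] by (simp add: wpos_def ennreal_mult[symmetric] mult.assoc[symmetric])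
    next
      case False
      then have "\<not> v - v * r < 0" using True by (simp add: not_less mult_le_cancel_left1)
      then show ?thesis using False by (simp add: rk_def w_def)
    qed
    have "(\<integral>\<^sup>+s. ennreal (rk a s) * ennreal (norm (F (v - s))) \<partial>lborel)
       = ennreal \<bar>- v\<bar> * (\<integral>\<^sup>+r. ennreal (rk a (v + (- v) * r)) * ennreal (norm (F (v - (v + (- v) * r)))) \<partial>lborel)"
      using True by (intro nn_integral_real_affine) auto
    also have "\<dots> = (\<integral>\<^sup>+r. ennreal v * (ennreal (rk a (v + (- v) * r)) * ennreal (norm (F (v - (v + (- v) * r))))) \<partial>lborel)"
      using True by (subst nn_integral_cmult[symmetric]) auto
    also have "\<dots> = (\<integral>\<^sup>+r. ennreal (w r) * wpos a F (v * r) \<partial>lborel)"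
      unfolding * ..
    finally show ?thesis by (simp add: phi_def)
  qed (simp add: phi_def)
  have "(\<integral>\<^sup>+v. epow (phi a F v) p \<partial>lborel) \<le> ennreal (m powr p) * (\<integral>\<^sup>+t. epow (wpos a F t) p \<partial>lborel)"
    if [measurable]: "F \<in> borel_measurable borel" for F
  proof -
    have "(\<integral>\<^sup>+v. epow (phi a F v) p \<partial>lborel) \<le> (\<integral>\<^sup>+v. epow (\<integral>\<^sup>+r. ennreal (w r) * wpos a F (v * r) \<partial>lborel) p \<partial>lborel)"
      using p by (intro nn_integral_mono epow_mono) (auto simp: eq split: split_indicator)
    also have "\<dots> \<le> ennreal (m powr p) * (\<integral>\<^sup>+t. epow (wpos a F t) p \<partial>lborel)"
      by (rule dilation_nn_integral_le[OF p _ _ _ m wm]) (auto simp: w_def)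
    finally show ?thesis .
  qed
  with m show ?thesis by blast
qed

text \<open>Here the dilation weight is 1/r for r > 1, and its integral against r^(-1/p) is exactly
  \<open>p\<close>.\<close>

lemma hardy_tail_bound:
  assumes p: "1 \<le> p" and [measurable]: "F \<in> borel_measurable borel"
  shows "(\<integral>\<^sup>+v. epow (hardy_tail a F v) p \<partial>lborel) \<le> ennreal (p powr p) * (\<integral>\<^sup>+t. epow (wpos a F t) p \<partial>lborel)"
proof -
  define w where "w r = (if r > 1 then 1 / r else 0)" for r :: real
  have [measurable]: "w \<in> borel_measurable borel" unfolding w_def[abs_def] by measurable
  have "ennreal (w r * r powr (- 1 / p)) \<le> ennreal (r powr (- 1 - 1 / p)) * indicator {1..} r" for r
    using powr_diff[of r "- 1 / p" 1] by (auto simp: w_def add.commute minus_diff_commute)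
  then have wm: "(\<integral>\<^sup>+r. ennreal (w r * r powr (- 1 / p)) \<partial>lborel) \<le> ennreal p"
    unfolding nn_integral_powr_ge_1[OF p, symmetric] by (intro nn_integral_mono)
  have eq: "hardy_tail a F v = indicator {0<..} v * (\<integral>\<^sup>+r. ennreal (w r) * wpos a F (v * r) \<partial>lborel)" for v
  proof (cases "0 < v")
    case True
    have "(\<integral>\<^sup>+t. ennreal (t powr (a - 1)) * ennreal (norm (F t)) * indicator {0..} (t - v) \<partial>lborel)
       = ennreal \<bar>v\<bar> * (\<integral>\<^sup>+r. ennreal ((0 + v * r) powr (a - 1)) * ennreal (norm (F (0 + v * r))) * indicator {0..} (0 + v * r - v) \<partial>lborel)"
      using True by (intro nn_integral_real_affine) auto
    also have "\<dots> = (\<integral>\<^sup>+r. ennreal v * (ennreal ((v * r) powr (a - 1)) * ennreal (norm (F (v * r))) * indicator {0..} (v * r - v)) \<partial>lborel)"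
      using True by (subst nn_integral_cmult[symmetric]) auto
    also have "\<dots> = (\<integral>\<^sup>+r. ennreal (w r) * wpos a F (v * r) \<partial>lborel)"
    \<comment> \<open>The cut-off in \<open>hardy_tail\<close> includes the boundary point r = 1
      while \<open>w\<close> vanishes there; a single point is negligible.\<close>
    proof (rule nn_integral_cong_AE, rule AE_mp[OF AE_lborel_singleton[of 1]], rule AE_I2, rule impI)
      fix r :: real assume "r \<noteq> 1"
      show "ennreal v * (ennreal ((v * r) powr (a - 1)) * ennreal (norm (F (v * r))) * indicator {0..} (v * r - v)) = ennreal (w r) * wpos a F (v * r)"
      proof (cases "1 < r")
        case r: True
        have "v * (v * r) powr (a - 1) = w r * (v * r) powr a"
          using True r powr_add[of "v * r" 1 "a - 1"] by (simp add: w_def)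
        then show ?thesis
          using True r by (simp add: wpos_def ennreal_mult[symmetric] mult.assoc[symmetric] w_def)
      next
        case False
        then show ?thesis using \<open>r \<noteq> 1\<close> True by (simp add: w_def mult_le_cancel_left1)
      qed
    qed
    finally show ?thesis by (simp add: hardy_tail_def)
  qed (simp add: hardy_tail_def)
  have "(\<integral>\<^sup>+v. epow (hardy_tail a F v) p \<partial>lborel) \<le> (\<integral>\<^sup>+v. epow (\<integral>\<^sup>+r. ennreal (w r) * wpos a F (v * r) \<partial>lborel) p \<partial>lborel)"
    using p by (intro nn_integral_mono epow_mono) (auto simp: eq split: split_indicator)
  also have "\<dots> \<le> ennreal (p powr p) * (\<integral>\<^sup>+t. epow (wpos a F t) p \<partial>lborel)"
    by (rule dilation_nn_integral_le[OF p _ _ _ _ wm]) (use p in \<open>auto simp: w_def\<close>)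
  finally show ?thesis .
qed

section \<open>The convolution estimate\<close>

text \<open>Complements \<open>weyl_plus_rapid\<close>, which is silent on the negative half-line. A
  crude polynomial bound suffices there, since it will meet rapidly decaying factors.\<close>

lemma weyl_plus_growth:
  assumes f: "f \<in> schwartz" and a: "0 < a"
  shows "\<exists>k C. 0 \<le> C \<and> (\<forall>y. norm (weyl_plus a f y) \<le> C * (1 + \<bar>y\<bar>) ^ k)"
proof -
  let ?n = "nat \<lfloor>a\<rfloor> + 1"
  define b where "b = real ?n - a"
  have b: "0 < b" unfolding b_def using a by linarith
  define k where "k = nat \<lceil>b\<rceil> + 2"
  define h where "h = sderiv ?n f"
  have h: "h \<in> schwartz" unfolding h_def using f by (rule schwartz_sderiv)
  have temp: "tempered k (kap b)" unfolding k_def using b by (rule kap_tempered)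
  obtain C where C: "0 \<le> C" "\<And>x. norm (h x) \<le> C / (1 + \<bar>x\<bar>) ^ k" using schwartz_decay[OF h] by blast
  define D where "D = (\<integral>s. norm (kap b s) / (1 + \<bar>s\<bar>) ^ k \<partial>lborel)"
  have D: "0 \<le> D" unfolding D_def by (intro integral_nonneg_AE AE_I2) auto
  have "norm (conv h (kap b) y) \<le> C * D * (1 + \<bar>y\<bar>) ^ k" for y
  proof -
    have "norm (conv h (kap b) y) \<le> (\<integral>s. C * (1 + \<bar>y\<bar>) ^ k * (norm (kap b s) / (1 + \<bar>s\<bar>) ^ k) \<partial>lborel)"
      unfolding conv_def
    proof (rule Bochner_Integration.integral_norm_bound_integral)
      show "integrable lborel (\<lambda>s. h (y - s) * kap b s)" by (rule schwartz_conv_integrable[OF h temp])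
      show "integrable lborel (\<lambda>s. C * (1 + \<bar>y\<bar>) ^ k * (norm (kap b s) / (1 + \<bar>s\<bar>) ^ k))"
        using temp by (intro integrable_mult_right) (simp only: tempered_def)
      fix s
      have "norm (h (y - s)) \<le> C * (1 / (1 + \<bar>y - s\<bar>) ^ k)" using C(2)[of "y - s"] by simp
      also have "\<dots> \<le> C * ((1 + \<bar>y\<bar>) ^ k / (1 + \<bar>s\<bar>) ^ k)"
        by (intro mult_left_mono inverse_one_plus_abs_shift C)
      finally have "norm (h (y - s)) * norm (kap b s) \<le> C * ((1 + \<bar>y\<bar>) ^ k / (1 + \<bar>s\<bar>) ^ k) * norm (kap b s)"
        by (rule mult_right_mono) simp
      then show "norm (h (y - s) * kap b s) \<le> C * (1 + \<bar>y\<bar>) ^ k * (norm (kap b s) / (1 + \<bar>s\<bar>) ^ k)"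
        by (simp add: norm_mult)
    qed
    also have "\<dots> = C * (1 + \<bar>y\<bar>) ^ k * D" unfolding D_def by (rule integral_mult_right_zero)
    finally show ?thesis by (simp add: mult_ac)
  qed
  then show ?thesis
    using C D by (intro exI[of _ k] exI[of _ "C * D"]) (auto simp: weyl_plus_eq[OF f a] h_def b_def)
qed

text \<open>For \<open>y < x\<close> the inner integral is the Weyl integral of the absolute value
  of \<open>F\<close> at the positive point \<open>x - y\<close>. Its rapid decay as
  \<open>y\<close> tends to minus infinity beats the polynomial growth of \<open>G\<close>.\<close>

lemma nn_integral_below_finite:
  fixes F G :: "real \<Rightarrow> complex"
  assumes F: "rapid F" and a: "0 < a" and [measurable]: "G \<in> borel_measurable borel"
    and G: "\<exists>k C. 0 \<le> C \<and> (\<forall>y. norm (G y) \<le> C * (1 + \<bar>y\<bar>) ^ k)"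
  shows "(\<integral>\<^sup>+y. indicator {..<x} y * ennreal (norm (G y)) *
     (\<integral>\<^sup>+t. ennreal (rk a (x - y - t)) * ennreal (norm (F t)) \<partial>lborel) \<partial>lborel) < top"
proof -
  have [measurable]: "F \<in> borel_measurable borel" using F by (rule rapid_measurable)
  obtain k C where C: "0 \<le> C" "\<And>y. norm (G y) \<le> C * (1 + \<bar>y\<bar>) ^ k" using G by blast
  \<comment> \<open>Decay of order \<open>k + 2\<close>: \<open>k\<close> against the growth of
    \<open>G\<close>, and 2 for integrability in \<open>y\<close>.\<close>
  obtain B where B: "0 \<le> B" "\<And>v. 0 \<le> v \<Longrightarrow>
      (\<integral>\<^sup>+s. ennreal (rk a s) * ennreal (norm (F (v - s))) \<partial>lborel) \<le> ennreal (B / (1 + v) ^ (k + 2))"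
    using rapid_nn_conv_kap[OF F a] by blast
  have "indicator {..<x} y * ennreal (norm (G y)) * (\<integral>\<^sup>+t. ennreal (rk a (x - y - t)) * ennreal (norm (F t)) \<partial>lborel)
      \<le> ennreal (C * (1 + \<bar>x\<bar>) ^ k * B) * ennreal (1 / (1 + \<bar>x - y\<bar>) ^ 2)" for y
  proof (cases "y < x")
    case True
    have "norm (G y) \<le> C * ((1 + \<bar>x - y\<bar>) * (1 + \<bar>x\<bar>)) ^ k"
      by (rule order_trans[OF C(2)]) (intro mult_left_mono power_mono one_plus_abs_mult C, auto)
    also have "\<dots> = C * (1 + \<bar>x\<bar>) ^ k * (1 + \<bar>x - y\<bar>) ^ k" by (simp add: power_mult_distrib del: power_mult_distrib[symmetric])
    finally have g: "norm (G y) \<le> C * (1 + \<bar>x\<bar>) ^ k * (1 + \<bar>x - y\<bar>) ^ k" .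
    have "(\<integral>\<^sup>+t. ennreal (rk a (x - y - t)) * ennreal (norm (F t)) \<partial>lborel) = (\<integral>\<^sup>+s. ennreal (rk a s) * ennreal (norm (F (x - y - s))) \<partial>lborel)"
      using nn_convolution_commute[of "\<lambda>s. ennreal (norm (F s))" "\<lambda>s. ennreal (rk a s)" "x - y"] by (simp add: mult.commute)
    also have "\<dots> \<le> ennreal (B / (1 + \<bar>x - y\<bar>) ^ (k + 2))" using B(2)[of "x - y"] True by simp
    finally have "ennreal (norm (G y)) * (\<integral>\<^sup>+t. ennreal (rk a (x - y - t)) * ennreal (norm (F t)) \<partial>lborel)
       \<le> ennreal (C * (1 + \<bar>x\<bar>) ^ k * (1 + \<bar>x - y\<bar>) ^ k) * ennreal (B / (1 + \<bar>x - y\<bar>) ^ (k + 2))"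
      using g by (intro mult_mono ennreal_leI) auto
    also have "\<dots> = ennreal (C * (1 + \<bar>x\<bar>) ^ k * (1 + \<bar>x - y\<bar>) ^ k * (B / (1 + \<bar>x - y\<bar>) ^ (k + 2)))"
      by (rule ennreal_mult[symmetric]) (use C B in auto)
    also have "C * (1 + \<bar>x\<bar>) ^ k * (1 + \<bar>x - y\<bar>) ^ k * (B / (1 + \<bar>x - y\<bar>) ^ (k + 2)) = C * (1 + \<bar>x\<bar>) ^ k * B * (1 / (1 + \<bar>x - y\<bar>) ^ 2)"
      using abs_ge_zero[of "x - y"] by (simp only: power_add) (auto simp: field_simps)
    also have "ennreal \<dots> = ennreal (C * (1 + \<bar>x\<bar>) ^ k * B) * ennreal (1 / (1 + \<bar>x - y\<bar>) ^ 2)"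
      by (rule ennreal_mult) (use C B in auto)
    finally show ?thesis using True by simp
  qed simp
  then have "(\<integral>\<^sup>+y. indicator {..<x} y * ennreal (norm (G y)) *
     (\<integral>\<^sup>+t. ennreal (rk a (x - y - t)) * ennreal (norm (F t)) \<partial>lborel) \<partial>lborel) \<le>
     (\<integral>\<^sup>+y. ennreal (C * (1 + \<bar>x\<bar>) ^ k * B) * ennreal (1 / (1 + \<bar>x - y\<bar>) ^ 2) \<partial>lborel)"
    by (intro nn_integral_mono)
  also have "\<dots> = ennreal (C * (1 + \<bar>x\<bar>) ^ k * B) * (\<integral>\<^sup>+y. ennreal (1 / (1 + \<bar>x - y\<bar>) ^ 2) \<partial>lborel)"
    by (rule nn_integral_cmult) measurable
  also have "(\<integral>\<^sup>+y. ennreal (1 / (1 + \<bar>x - y\<bar>) ^ 2) \<partial>lborel) = (\<integral>\<^sup>+y. ennreal (1 / (1 + \<bar>y\<bar>) ^ 2) \<partial>lborel)"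
    by (rule nn_integral_lborel_shift(2)) measurable
  also have "ennreal (C * (1 + \<bar>x\<bar>) ^ k * B) * (\<integral>\<^sup>+y. ennreal (1 / (1 + \<bar>y\<bar>) ^ 2) \<partial>lborel) < top"
    using order_le_less_trans[OF nn_integral_one_plus_square, of top] by (simp add: ennreal_mult_less_top)
  finally show ?thesis .
qed

text \<open>For a \<ge> 1 the point is x (t + y - x) \<le> t y, which is (t - x)(y - x) \<ge> 0
  expanded; for a < 1 the two powers are compared separately. The bound separates the variables: the
  power of \<open>y\<close> is the weight of \<open>wpos\<close>, that of \<open>t\<close> the
  weight of \<open>hardy_tail\<close>.\<close>

lemma corner_kernel_bound:
  assumes a: "0 < a" and x: "0 < x" "x \<le> t" "x \<le> y"
  shows "x powr a * rk a (x - y - t) \<le> 1 / Gamma a * (y powr a * t powr (a - 1))"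
proof -
  note G = Gamma_real_pos[OF a]
  have "x powr a * (t + y - x) powr (a - 1) \<le> y powr a * t powr (a - 1)"
  proof (cases "1 \<le> a")
    case True
    have "0 \<le> (t - x) * (y - x)" using x by simp
    then have le: "x * (t + y - x) \<le> t * y" by (simp add: algebra_simps)
    have split: "z powr a = z * z powr (a - 1)" if "0 < z" for z :: real
      using that powr_add[of z 1 "a - 1"] by simp
    have "x powr a * (t + y - x) powr (a - 1) = x * (x * (t + y - x)) powr (a - 1)"
      using x by (simp add: split powr_mult)
    also have "\<dots> \<le> y * (t * y) powr (a - 1)"
    proof (rule mult_mono)
      show "(x * (t + y - x)) powr (a - 1) \<le> (t * y) powr (a - 1)"
        using x True le by (intro powr_mono2[OF _ _ le]) (auto intro!: mult_nonneg_nonneg)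
    qed (use x in auto)
    also have "\<dots> = y powr a * t powr (a - 1)"
      using x by (simp add: split powr_mult)
    finally show ?thesis .
  next
    case False
    then show ?thesis using x a by (intro mult_mono powr_mono2 powr_mono2') auto
  qed
  then have "x powr a * (t + y - x) powr (a - 1) / Gamma a \<le> y powr a * t powr (a - 1) / Gamma a"
    using G by (intro divide_right_mono) auto
  moreover have "rk a (x - y - t) = (t + y - x) powr (a - 1) / Gamma a"
    using x by (simp add: rk_def algebra_simps)
  ultimately show ?thesis by simp
qed

text \<open>\<open>?T1\<close> and \<open>?T2\<close> come from the half-planes y \<ge> x and t
  \<ge> x, \<open>?T3\<close> and \<open>?T4\<close> from the region where both variables are below
  \<open>x\<close>, and \<open>?T5\<close> from the corner where both are above. Decay and growth of
  \<open>F\<close> and \<open>G\<close> give the absolute convergence behind the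
  decomposition.\<close>

lemma weyl_conv_pointwise:
  fixes F G :: "real \<Rightarrow> complex"
  assumes F: "rapid F" "\<exists>k C. 0 \<le> C \<and> (\<forall>y. norm (F y) \<le> C * (1 + \<bar>y\<bar>) ^ k)"
    and G: "rapid G" "\<exists>k C. 0 \<le> C \<and> (\<forall>y. norm (G y) \<le> C * (1 + \<bar>y\<bar>) ^ k)"
    and f: "f = conv F (kap a)" and g: "g = conv G (kap a)"
    and a: "0 < a" and x: "0 < x"
  shows "ennreal (x powr a) * ennreal (norm (conv f G x)) \<le>
     (\<integral>\<^sup>+y. wpos a G y * ennreal (norm (f (x - y))) \<partial>lborel) +
     (\<integral>\<^sup>+y. ennreal (norm (g y)) * wpos a F (x - y) \<partial>lborel) +
     ennreal (2 powr a) * ((\<integral>\<^sup>+y. wpos a G y * phi a F (x - y) \<partial>lborel) + (\<integral>\<^sup>+y. phi a G y * wpos a F (x - y) \<partial>lborel)) +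
     ennreal (1 / Gamma a) * (\<integral>\<^sup>+y. wpos a G y \<partial>lborel) * hardy_tail a F x"
    (is "_ \<le> ?T1 + ?T2 + _ * (?T3 + ?T4) + ?T5")
proof (cases "?T5 = top")
  \<comment> \<open>If \<open>?T5\<close> is infinite there is nothing to prove. Otherwise its
    finiteness bounds the corner integral \<open>R3\<close> and with it the full double
    integral.\<close>
  case False
  note Gam = Gamma_real_pos[OF a]
  have [measurable]: "F \<in> borel_measurable borel" "G \<in> borel_measurable borel"
    using F G by (auto simp: rapid_measurable)
  have [measurable]: "f \<in> borel_measurable borel" "g \<in> borel_measurable borel"
    unfolding f g by measurable
  define q where "q = (\<lambda>y t. kap a (x - y - t) * F t * G y)"
  define nq where "nq = (\<lambda>y t. ennreal (rk a (x - y - t)) * ennreal (norm (F t)) * ennreal (norm (G y)))"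
  have nq: "ennreal (norm (q y t)) = nq y t" for y t
    using rk_nonneg[OF a] by (simp add: q_def nq_def norm_mult ennreal_mult)
  have [measurable]: "case_prod q \<in> borel_measurable (lborel \<Otimes>\<^sub>M lborel)"
    unfolding q_def by measurable
  have [measurable]: "case_prod nq \<in> borel_measurable (lborel \<Otimes>\<^sub>M lborel)"
    unfolding nq_def by measurable
  define R1 where "R1 = (\<integral>\<^sup>+y. \<integral>\<^sup>+t. indicator {..<x} y * nq y t \<partial>lborel \<partial>lborel)"
  define R2 where "R2 = (\<integral>\<^sup>+y. \<integral>\<^sup>+t. indicator {..<x} t * nq y t \<partial>lborel \<partial>lborel)"
  define R3 where "R3 = (\<integral>\<^sup>+y. \<integral>\<^sup>+t. indicator {x..} y * indicator {x..} t * nq y t \<partial>lborel \<partial>lborel)"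
  define R4 where "R4 = (\<integral>\<^sup>+y. \<integral>\<^sup>+t. indicator {..<x} y * indicator {..<x} t * nq y t \<partial>lborel \<partial>lborel)"
  have R1: "R1 < top"
  proof -
    have "R1 = (\<integral>\<^sup>+y. \<integral>\<^sup>+t. (indicator {..<x} y * ennreal (norm (G y))) * (ennreal (rk a (x - y - t)) * ennreal (norm (F t))) \<partial>lborel \<partial>lborel)"
      unfolding R1_def nq_def by (simp only: mult_ac)
    also have "\<dots> = (\<integral>\<^sup>+y. (indicator {..<x} y * ennreal (norm (G y))) * (\<integral>\<^sup>+t. (ennreal (rk a (x - y - t)) * ennreal (norm (F t))) \<partial>lborel) \<partial>lborel)"
      by (intro nn_integral_cong nn_integral_cmult) measurable
    also have "\<dots> < top" by (rule nn_integral_below_finite[OF F(1) a _ G(2)]) measurable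
    finally show ?thesis .
  qed
  have R2: "R2 < top"
  proof -
    have "R2 = (\<integral>\<^sup>+t. \<integral>\<^sup>+y. indicator {..<x} t * nq y t \<partial>lborel \<partial>lborel)"
      unfolding R2_def by (rule lborel_pair.Fubini'[symmetric]) measurable
    also have "\<dots> = (\<integral>\<^sup>+t. \<integral>\<^sup>+y. (indicator {..<x} t * ennreal (norm (F t))) * (ennreal (rk a (x - t - y)) * ennreal (norm (G y))) \<partial>lborel \<partial>lborel)"
      unfolding nq_def by (simp add: mult_ac diff_diff_eq add.commute)
    also have "\<dots> = (\<integral>\<^sup>+t. (indicator {..<x} t * ennreal (norm (F t))) * (\<integral>\<^sup>+y. (ennreal (rk a (x - t - y)) * ennreal (norm (G y))) \<partial>lborel) \<partial>lborel)"
      by (intro nn_integral_cong nn_integral_cmult) measurable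
    also have "\<dots> < top" by (rule nn_integral_below_finite[OF G(1) a _ F(2)]) measurable
    finally show ?thesis .
  qed
  have R3: "ennreal (x powr a) * R3 \<le> ?T5"
  proof -
    have "ennreal (x powr a) * R3 = (\<integral>\<^sup>+y. \<integral>\<^sup>+t. ennreal (x powr a) * (indicator {x..} y * indicator {x..} t * nq y t) \<partial>lborel \<partial>lborel)"
      unfolding R3_def by (simp add: nn_integral_cmult)
    also have "\<dots> \<le> (\<integral>\<^sup>+y. \<integral>\<^sup>+t. ennreal (1 / Gamma a) * wpos a G y * (ennreal (t powr (a - 1)) * ennreal (norm (F t)) * indicator {0..} (t - x)) \<partial>lborel \<partial>lborel)"
    proof (intro nn_integral_mono)
      fix y t
      show "ennreal (x powr a) * (indicator {x..} y * indicator {x..} t * nq y t) \<le>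
          ennreal (1 / Gamma a) * wpos a G y * (ennreal (t powr (a - 1)) * ennreal (norm (F t)) * indicator {0..} (t - x))"
      proof (cases "x \<le> y \<and> x \<le> t")
        case True
        have "x powr a * (rk a (x - y - t) * norm (F t) * norm (G y)) = (x powr a * rk a (x - y - t)) * (norm (F t) * norm (G y))"
          by simp
        also have "\<dots> \<le> (1 / Gamma a * (y powr a * t powr (a - 1))) * (norm (F t) * norm (G y))"
          using True a x by (intro mult_right_mono corner_kernel_bound) auto
        also have "\<dots> = 1 / Gamma a * (y powr a * norm (G y)) * (t powr (a - 1) * norm (F t))" by simp
        finally have "ennreal (x powr a * (rk a (x - y - t) * norm (F t) * norm (G y))) \<le> ennreal \<dots>" by (rule ennreal_leI)
        then show ?thesis using True x Gam rk_nonneg[OF a]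
          by (simp add: nq_def wpos_def ennreal_mult[symmetric])
      qed (auto split: split_indicator)
    qed
    also have "\<dots> = (\<integral>\<^sup>+y. ennreal (1 / Gamma a) * wpos a G y * hardy_tail a F x \<partial>lborel)"
      using x by (simp add: hardy_tail_def nn_integral_cmult)
    also have "\<dots> = ?T5"
      by (simp add: nn_integral_cmult nn_integral_multc)
    finally show ?thesis .
  qed
  have R4: "ennreal (x powr a) * R4 \<le> ennreal (2 powr a) * (?T3 + ?T4)"
  proof -
    have "ennreal (x powr a) * R4 = (\<integral>\<^sup>+y. \<integral>\<^sup>+t. ennreal (x powr a) * (indicator {..<x} y * indicator {..<x} t * nq y t) \<partial>lborel \<partial>lborel)"
      unfolding R4_def by (simp add: nn_integral_cmult)
    also have "\<dots> \<le> (\<integral>\<^sup>+y. \<integral>\<^sup>+t. ennreal (2 powr a) * (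
        (wpos a G y * indicator {0<..} (x - y)) * (ennreal (rk a (x - y - t)) * ennreal (norm (F t))) +
        (wpos a F t * indicator {0<..} (x - t)) * (ennreal (rk a (x - t - y)) * ennreal (norm (G y)))) \<partial>lborel \<partial>lborel)"
    proof (intro nn_integral_mono)
      fix y t
      show "ennreal (x powr a) * (indicator {..<x} y * indicator {..<x} t * nq y t) \<le> ennreal (2 powr a) * (
        (wpos a G y * indicator {0<..} (x - y)) * (ennreal (rk a (x - y - t)) * ennreal (norm (F t))) +
        (wpos a F t * indicator {0<..} (x - t)) * (ennreal (rk a (x - t - y)) * ennreal (norm (G y))))"
      proof (cases "y < x \<and> t < x \<and> x - y - t < 0")
        case True
        \<comment> \<open>Both variables are below \<open>x\<close> while their sum exceeds
          \<open>x\<close>. Hence both are positive and the larger is at least x/2, the source of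
          the factor \<open>2 powr a\<close>.\<close>
        then have pos: "0 < y" "0 < t" by auto
        have "x \<le> 2 * max y t" using True by auto
        then have "x powr a \<le> (2 * max y t) powr a" using x a by (intro powr_mono2) auto
        also have "\<dots> = 2 powr a * max y t powr a" using pos by (simp add: powr_mult)
        also have "max y t powr a \<le> y powr a + t powr a" by (auto simp: max_def)
        finally have le: "x powr a \<le> 2 powr a * (y powr a + t powr a)" by simp
        have "x powr a * (rk a (x - y - t) * norm (F t) * norm (G y)) \<le> 2 powr a * (y powr a + t powr a) * (rk a (x - y - t) * norm (F t) * norm (G y))"
          using rk_nonneg[OF a] by (intro mult_right_mono le) auto
        also have "\<dots> = 2 powr a * ((y powr a * norm (G y)) * (rk a (x - y - t) * norm (F t)) + (t powr a * norm (F t)) * (rk a (x - t - y) * norm (G y)))"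
          by (simp add: algebra_simps)
        finally have "ennreal (x powr a * (rk a (x - y - t) * norm (F t) * norm (G y))) \<le> ennreal \<dots>" by (rule ennreal_leI)
        then show ?thesis using True pos x rk_nonneg[OF a]
          by (simp add: nq_def wpos_def ennreal_mult[symmetric] ennreal_plus[symmetric] del: ennreal_plus)
      next
        case False
        then show ?thesis by (auto simp: nq_def rk_def split: split_indicator)
      qed
    qed
    also have "\<dots> = ennreal (2 powr a) * (
       (\<integral>\<^sup>+y. \<integral>\<^sup>+t. (wpos a G y * indicator {0<..} (x - y)) * (ennreal (rk a (x - y - t)) * ennreal (norm (F t))) \<partial>lborel \<partial>lborel) +
       (\<integral>\<^sup>+y. \<integral>\<^sup>+t. (wpos a F t * indicator {0<..} (x - t)) * (ennreal (rk a (x - t - y)) * ennreal (norm (G y))) \<partial>lborel \<partial>lborel))"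
      by (simp add: nn_integral_cmult nn_integral_add)
    also have "(\<integral>\<^sup>+y. \<integral>\<^sup>+t. (wpos a F t * indicator {0<..} (x - t)) * (ennreal (rk a (x - t - y)) * ennreal (norm (G y))) \<partial>lborel \<partial>lborel)
        = (\<integral>\<^sup>+t. \<integral>\<^sup>+y. (wpos a F t * indicator {0<..} (x - t)) * (ennreal (rk a (x - t - y)) * ennreal (norm (G y))) \<partial>lborel \<partial>lborel)"
      by (rule lborel_pair.Fubini'[symmetric]) measurable
    also have "\<dots> = (\<integral>\<^sup>+t. wpos a F t * phi a G (x - t) \<partial>lborel)"
    proof (intro nn_integral_cong)
      fix t
      have "(\<integral>\<^sup>+y. ennreal (rk a (x - t - y)) * ennreal (norm (G y)) \<partial>lborel) = (\<integral>\<^sup>+s. ennreal (rk a s) * ennreal (norm (G (x - t - s))) \<partial>lborel)"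
        using nn_convolution_commute[of "\<lambda>s. ennreal (norm (G s))" "\<lambda>s. ennreal (rk a s)" "x - t"] by (simp add: mult.commute)
      then show "(\<integral>\<^sup>+y. (wpos a F t * indicator {0<..} (x - t)) * (ennreal (rk a (x - t - y)) * ennreal (norm (G y))) \<partial>lborel) = wpos a F t * phi a G (x - t)"
        by (simp add: nn_integral_cmult phi_def mult.assoc)
    qed
    also have "\<dots> = ?T4" by (rule nn_convolution_commute) measurable
    also have "(\<integral>\<^sup>+y. \<integral>\<^sup>+t. (wpos a G y * indicator {0<..} (x - y)) * (ennreal (rk a (x - y - t)) * ennreal (norm (F t))) \<partial>lborel \<partial>lborel) = ?T3"
    proof (intro nn_integral_cong)
      fix y
      have "(\<integral>\<^sup>+t. ennreal (rk a (x - y - t)) * ennreal (norm (F t)) \<partial>lborel) = (\<integral>\<^sup>+s. ennreal (rk a s) * ennreal (norm (F (x - y - s))) \<partial>lborel)"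
        using nn_convolution_commute[of "\<lambda>s. ennreal (norm (F s))" "\<lambda>s. ennreal (rk a s)" "x - y"] by (simp add: mult.commute)
      then show "(\<integral>\<^sup>+t. (wpos a G y * indicator {0<..} (x - y)) * (ennreal (rk a (x - y - t)) * ennreal (norm (F t))) \<partial>lborel) = wpos a G y * phi a F (x - y)"
        by (simp add: nn_integral_cmult phi_def mult.assoc)
    qed
    finally show ?thesis .
  qed
  have R3_fin: "R3 < top"
    using R3 False x by (cases "R3 = top") (auto simp: ennreal_mult_top top_unique less_top)
  have Q: "integrable (lborel \<Otimes>\<^sub>M lborel) (case_prod q)"
  proof (rule integrableI_bounded)
    have "(\<integral>\<^sup>+z. ennreal (norm (case_prod q z)) \<partial>(lborel \<Otimes>\<^sub>M lborel)) = (\<integral>\<^sup>+y. \<integral>\<^sup>+t. nq y t \<partial>lborel \<partial>lborel)"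
      by (subst lborel.nn_integral_fst[symmetric]) (auto simp: nq)
    \<comment> \<open>The half-planes y < x and t < x together with the corner cover the
      plane.\<close>
    also have "\<dots> \<le> (\<integral>\<^sup>+y. \<integral>\<^sup>+t. indicator {..<x} y * nq y t + (indicator {..<x} t * nq y t + indicator {x..} y * indicator {x..} t * nq y t) \<partial>lborel \<partial>lborel)"
      by (intro nn_integral_mono) (auto split: split_indicator)
    also have "\<dots> = R1 + (R2 + R3)"
      unfolding R1_def R2_def R3_def by (simp add: nn_integral_add)
    also have "\<dots> < \<infinity>" using R1 R2 R3_fin by simp
    finally show "(\<integral>\<^sup>+z. ennreal (norm (case_prod q z)) \<partial>(lborel \<Otimes>\<^sub>M lborel)) < \<infinity>" .
  qed measurable
  define ix where "ix = (\<lambda>y. of_bool (x \<le> y) :: complex)"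
  have [measurable]: "ix \<in> borel_measurable borel" unfolding ix_def by measurable
  have int: "integrable (lborel \<Otimes>\<^sub>M lborel) (\<lambda>z. c (fst z) (snd z) * case_prod q z)"
    if [measurable]: "case_prod c \<in> borel_measurable (lborel \<Otimes>\<^sub>M lborel)" and c: "\<And>y t. norm (c y t) \<le> 1" for c :: "real \<Rightarrow> real \<Rightarrow> complex"
  proof (rule Bochner_Integration.integrable_bound[OF Q])
    show "(\<lambda>z. c (fst z) (snd z) * case_prod q z) \<in> borel_measurable (lborel \<Otimes>\<^sub>M lborel)" by measurable
    show "AE z in lborel \<Otimes>\<^sub>M lborel. norm (c (fst z) (snd z) * case_prod q z) \<le> norm (case_prod q z)"
      using c by (intro AE_I2) (simp add: norm_mult mult_left_le_one_le)
  qed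
  let ?cA = "\<lambda>y t. ix y" and ?cB = "\<lambda>y t. ix t" and ?cC = "\<lambda>y t. ix y * ix t" and ?cD = "\<lambda>y t. (1 - ix y) * (1 - ix t)"
  let ?I = "\<lambda>c. (\<integral>z. c (fst z) (snd z) * case_prod q z \<partial>(lborel \<Otimes>\<^sub>M lborel))"
  have iA: "integrable (lborel \<Otimes>\<^sub>M lborel) (\<lambda>z. ?cA (fst z) (snd z) * case_prod q z)"
    by (rule int) (auto simp: ix_def)
  have iB: "integrable (lborel \<Otimes>\<^sub>M lborel) (\<lambda>z. ?cB (fst z) (snd z) * case_prod q z)"
    by (rule int) (auto simp: ix_def)
  have iC: "integrable (lborel \<Otimes>\<^sub>M lborel) (\<lambda>z. ?cC (fst z) (snd z) * case_prod q z)"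
    by (rule int) (auto simp: ix_def)
  have iD: "integrable (lborel \<Otimes>\<^sub>M lborel) (\<lambda>z. ?cD (fst z) (snd z) * case_prod q z)"
    by (rule int) (auto simp: ix_def)
  have fq: "(\<integral>t. q y t \<partial>lborel) = f (x - y) * G y" for y
    unfolding f conv_commute[of F] by (simp add: q_def conv_def)
  have gq: "(\<integral>y. q y t \<partial>lborel) = g (x - t) * F t" for t
    unfolding g conv_commute[of G] by (simp add: q_def conv_def mult_ac diff_diff_eq add.commute)
  have "conv f G x = (\<integral>y. \<integral>t. q y t \<partial>lborel \<partial>lborel)"
    unfolding fq conv_def ..
  also have "\<dots> = (\<integral>z. case_prod q z \<partial>(lborel \<Otimes>\<^sub>M lborel))"
    by (rule lborel_pair.integral_fst[OF Q])
  \<comment> \<open>The identity 1 = A + B - A B + (1 - A)(1 - B) for the indicators A of y \<ge> x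
    and B of t \<ge> x.\<close>
  also have "\<dots> = (\<integral>z. ?cA (fst z) (snd z) * case_prod q z + ?cB (fst z) (snd z) * case_prod q z
      - ?cC (fst z) (snd z) * case_prod q z + ?cD (fst z) (snd z) * case_prod q z \<partial>(lborel \<Otimes>\<^sub>M lborel))"
    by (intro Bochner_Integration.integral_cong refl) (simp add: algebra_simps)
  also have "\<dots> = ?I ?cA + ?I ?cB - ?I ?cC + ?I ?cD"
    by (simp only: Bochner_Integration.integral_add Bochner_Integration.integral_diff
        Bochner_Integration.integrable_add Bochner_Integration.integrable_diff iA iB iC iD)
  finally have "norm (conv f G x) \<le> norm (?I ?cA) + norm (?I ?cB) + norm (?I ?cC) + norm (?I ?cD)"
    by (simp only:) (intro order_trans[OF norm_triangle_ineq] order_trans[OF norm_triangle_ineq4] add_mono order_refl)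
  then have "ennreal (x powr a) * ennreal (norm (conv f G x)) \<le> ennreal (x powr a) * ennreal (norm (?I ?cA) + norm (?I ?cB) + norm (?I ?cC) + norm (?I ?cD))"
    by (intro mult_left_mono ennreal_leI) auto
  also have "\<dots> = ennreal (x powr a) * ennreal (norm (?I ?cA)) + ennreal (x powr a) * ennreal (norm (?I ?cB))
      + ennreal (x powr a) * ennreal (norm (?I ?cC)) + ennreal (x powr a) * ennreal (norm (?I ?cD))"
    by (simp add: distrib_left)
  also have "\<dots> \<le> ?T1 + ?T2 + ?T5 + ennreal (2 powr a) * (?T3 + ?T4)"
  proof (intro add_mono)
    \<comment> \<open>A variable that is at least \<open>x\<close> takes over the weight x^a. The
      other variable runs over the whole line, and its integral returns \<open>f\<close> or
      \<open>g\<close>.\<close>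
    have up: "ennreal (x powr a) * (ennreal (norm (ix y)) * ennreal (norm (H y))) \<le> wpos a H y" for y H
      using x a by (auto simp: ix_def wpos_def ennreal_mult[symmetric] intro!: ennreal_leI mult_right_mono powr_mono2)
    have "?I ?cA = (\<integral>y. \<integral>t. ix y * q y t \<partial>lborel \<partial>lborel)"
      using lborel_pair.integral_fst'[OF iA] by simp
    also have "\<dots> = (\<integral>y. ix y * (f (x - y) * G y) \<partial>lborel)" by (simp add: fq)
    finally have "ennreal (norm (?I ?cA)) \<le> (\<integral>\<^sup>+y. ennreal (norm (ix y)) * ennreal (norm (G y)) * ennreal (norm (f (x - y))) \<partial>lborel)"
      using norm_integral_le_nn_integral[of lborel "\<lambda>y. ix y * (f (x - y) * G y)"] by (simp add: norm_mult ennreal_mult mult_ac)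
    then have "ennreal (x powr a) * ennreal (norm (?I ?cA)) \<le> ennreal (x powr a) * \<dots>" by (rule mult_left_mono) simp
    also have "\<dots> = (\<integral>\<^sup>+y. (ennreal (x powr a) * (ennreal (norm (ix y)) * ennreal (norm (G y)))) * ennreal (norm (f (x - y))) \<partial>lborel)"
      by (subst nn_integral_cmult[symmetric]) (auto simp: mult.assoc)
    also have "\<dots> \<le> ?T1"
      by (intro nn_integral_mono mult_right_mono up) auto
    finally show "ennreal (x powr a) * ennreal (norm (?I ?cA)) \<le> ?T1" .
    have "?I ?cB = (\<integral>t. \<integral>y. ix t * q y t \<partial>lborel \<partial>lborel)"
      using lborel_pair.integral_snd[of "\<lambda>y t. ix t * q y t"] iB by (simp add: case_prod_beta')
    also have "\<dots> = (\<integral>t. ix t * (g (x - t) * F t) \<partial>lborel)" by (simp add: gq)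
    finally have "ennreal (norm (?I ?cB)) \<le> (\<integral>\<^sup>+t. ennreal (norm (ix t)) * ennreal (norm (F t)) * ennreal (norm (g (x - t))) \<partial>lborel)"
      using norm_integral_le_nn_integral[of lborel "\<lambda>y. ix y * (g (x - y) * F y)"] by (simp add: norm_mult ennreal_mult mult_ac)
    then have "ennreal (x powr a) * ennreal (norm (?I ?cB)) \<le> ennreal (x powr a) * \<dots>" by (rule mult_left_mono) simp
    also have "\<dots> = (\<integral>\<^sup>+y. (ennreal (x powr a) * (ennreal (norm (ix y)) * ennreal (norm (F y)))) * ennreal (norm (g (x - y))) \<partial>lborel)"
      by (subst nn_integral_cmult[symmetric]) (auto simp: mult.assoc)
    also have "\<dots> \<le> (\<integral>\<^sup>+y. wpos a F y * ennreal (norm (g (x - y))) \<partial>lborel)"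
      by (intro nn_integral_mono mult_right_mono up) auto
    also have "\<dots> = ?T2" by (rule nn_convolution_commute) measurable
    finally show "ennreal (x powr a) * ennreal (norm (?I ?cB)) \<le> ?T2" .
    have "ennreal (norm (?I ?cC)) \<le> (\<integral>\<^sup>+z. ennreal (norm (?cC (fst z) (snd z) * case_prod q z)) \<partial>(lborel \<Otimes>\<^sub>M lborel))"
      by (rule norm_integral_le_nn_integral)
    also have "\<dots> = R3"
      unfolding R3_def by (subst lborel.nn_integral_fst[symmetric])
        (auto simp: nq[symmetric] norm_mult ix_def intro!: nn_integral_cong split: split_indicator)
    finally show "ennreal (x powr a) * ennreal (norm (?I ?cC)) \<le> ?T5"
      by (intro order_trans[OF mult_left_mono R3]) auto
    have "ennreal (norm (?I ?cD)) \<le> (\<integral>\<^sup>+z. ennreal (norm (?cD (fst z) (snd z) * case_prod q z)) \<partial>(lborel \<Otimes>\<^sub>M lborel))"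
      by (rule norm_integral_le_nn_integral)
    also have "\<dots> = R4"
      unfolding R4_def by (subst lborel.nn_integral_fst[symmetric])
        (auto simp: nq[symmetric] norm_mult ix_def intro!: nn_integral_cong split: split_indicator)
    finally show "ennreal (x powr a) * ennreal (norm (?I ?cD)) \<le> ennreal (2 powr a) * (?T3 + ?T4)"
      by (intro order_trans[OF mult_left_mono R4]) auto
  qed
  finally show ?thesis by (simp add: add_ac)
qed simp

section \<open>The embedding and the convolution bound on one half-line\<close>

lemma norm_le_phi:
  assumes f: "f \<in> schwartz" and a: "0 < a" and v: "0 < v"
  shows "ennreal (norm (f v)) \<le> phi a (weyl_plus a f) v"
proof -
  have "ennreal (norm (f v)) = ennreal (norm (conv (weyl_plus a f) (kap a) v))"
    by (simp add: weyl_plus_inverse[OF f a])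
  also have "\<dots> \<le> (\<integral>\<^sup>+s. ennreal (norm (kap a s)) * ennreal (norm (weyl_plus a f (v - s))) \<partial>lborel)"
    by (rule norm_conv_le)
  also have "\<dots> = phi a (weyl_plus a f) v"
    using v rk_nonneg[OF a] by (simp add: phi_def)
  finally show ?thesis .
qed

definition wpos_int :: "real \<Rightarrow> real \<Rightarrow> (real \<Rightarrow> complex) \<Rightarrow> ennreal" where
  "wpos_int a p f = (\<integral>\<^sup>+t. epow (wpos a (weyl_plus a f) t) p \<partial>lborel)"

lemma weyl_plus_measurable:
  "f \<in> schwartz \<Longrightarrow> 0 < a \<Longrightarrow> weyl_plus a f \<in> borel_measurable borel"
  by (intro rapid_measurable weyl_plus_rapid)

text \<open>On the positive half-line \<open>f\<close> is the Weyl integral of its Weyl derivative,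
  so Hardy's inequality for \<open>phi\<close> applies. The negative half-line is the same statement
  for the reflected function.\<close>

lemma embedding_nn:
  assumes a: "0 < a" and p: "1 \<le> p"
  shows "\<exists>C\<ge>0. \<forall>f\<in>schwartz. (\<integral>\<^sup>+v. epow (ennreal (norm (f v))) p \<partial>lborel)
      \<le> ennreal (C powr p) * (wpos_int a p f + wpos_int a p (\<lambda>x. f (- x)))"
proof -
  obtain C where C: "0 \<le> C" "\<And>F. F \<in> borel_measurable borel \<Longrightarrow>
    (\<integral>\<^sup>+v. epow (phi a F v) p \<partial>lborel) \<le> ennreal (C powr p) * (\<integral>\<^sup>+t. epow (wpos a F t) p \<partial>lborel)"
    using hardy_phi[OF p a] by blast
  have "(\<integral>\<^sup>+v. epow (ennreal (norm (f v))) p \<partial>lborel) \<le> ennreal (C powr p) * (wpos_int a p f + wpos_int a p (\<lambda>x. f (- x)))"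
    if f: "f \<in> schwartz" for f
  proof -
    note fr = schwartz_reflect[OF f]
    note [measurable] = weyl_plus_measurable[OF f a] weyl_plus_measurable[OF fr a]
    have "(\<integral>\<^sup>+v. epow (ennreal (norm (f v))) p \<partial>lborel) \<le>
        (\<integral>\<^sup>+v. epow (phi a (weyl_plus a f) v) p + epow (phi a (weyl_plus a (\<lambda>x. f (- x))) (- v)) p \<partial>lborel)"
    proof (rule nn_integral_mono_AE, rule AE_mp[OF AE_lborel_singleton[of 0]], rule AE_I2, rule impI)
      fix v :: real assume "v \<noteq> 0"
      then consider "0 < v" | "0 < - v" by linarith
      then show "epow (ennreal (norm (f v))) p \<le> epow (phi a (weyl_plus a f) v) p + epow (phi a (weyl_plus a (\<lambda>x. f (- x))) (- v)) p"
      proof cases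
        case 1
        then show ?thesis
          using p norm_le_phi[OF f a 1] by (intro add_increasing2 epow_mono) auto
      next
        case 2
        then show ?thesis
          using p norm_le_phi[OF fr a 2] by (intro add_increasing epow_mono) auto
      qed
    qed
    also have "\<dots> = (\<integral>\<^sup>+v. epow (phi a (weyl_plus a f) v) p \<partial>lborel) + (\<integral>\<^sup>+v. epow (phi a (weyl_plus a (\<lambda>x. f (- x))) (- v)) p \<partial>lborel)"
      by (rule nn_integral_add) measurable
    also have "(\<integral>\<^sup>+v. epow (phi a (weyl_plus a (\<lambda>x. f (- x))) (- v)) p \<partial>lborel) = (\<integral>\<^sup>+v. epow (phi a (weyl_plus a (\<lambda>x. f (- x))) v) p \<partial>lborel)"
      by (rule nn_integral_lborel_shift(3)) measurable
    also have "(\<integral>\<^sup>+v. epow (phi a (weyl_plus a f) v) p \<partial>lborel) + (\<integral>\<^sup>+v. epow (phi a (weyl_plus a (\<lambda>x. f (- x))) v) p \<partial>lborel)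
       \<le> ennreal (C powr p) * wpos_int a p f + ennreal (C powr p) * wpos_int a p (\<lambda>x. f (- x))"
      unfolding wpos_int_def by (intro add_mono C) measurable
    finally show ?thesis by (simp add: distrib_left)
  qed
  with C show ?thesis by blast
qed

lemma epow_sum5_le:
  assumes p: "0 \<le> p"
  shows "epow (t1 + t2 + (t3 + t4) + t5) p \<le> ennreal ((2 powr p) ^ 3) * (epow t1 p + epow t2 p + (epow t3 p + epow t4 p) + epow t5 p)"
proof -
  let ?c = "ennreal (2 powr p)"
  have c1: "1 \<le> ?c" using p by (simp add: ge_one_powr_ge_zero)
  have "epow (t1 + t2 + (t3 + t4) + t5) p \<le> ?c * (epow (t1 + t2 + (t3 + t4)) p + epow t5 p)"
    by (rule epow_add_le[OF p])
  also have "\<dots> \<le> ?c * (?c * (epow (t1 + t2) p + epow (t3 + t4) p) + epow t5 p)"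
    by (intro mult_left_mono add_mono epow_add_le p) auto
  also have "\<dots> \<le> ?c * (?c * (?c * (epow t1 p + epow t2 p) + ?c * (epow t3 p + epow t4 p)) + (?c * ?c) * epow t5 p)"
    using c1 mult_mono[OF c1 c1] mult_right_mono[of 1 "?c * ?c" "epow t5 p"]
    by (intro mult_left_mono add_mono epow_add_le p) auto
  also have "\<dots> = ?c * ?c * ?c * (epow t1 p + epow t2 p + (epow t3 p + epow t4 p) + epow t5 p)"
    by (simp add: distrib_left mult.assoc)
  also have "?c * ?c * ?c = ennreal ((2 powr p) ^ 3)"
    by (simp add: ennreal_mult[symmetric] power3_eq_cube)
  finally show ?thesis .
qed

text \<open>\<open>m\<close> bounds the weighted 1-norm of \<open>g\<close> and is a real number,
  the form in which Young's inequality takes the mass of its kernel. Each of the five terms of the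
  pointwise bound combines a 1-norm built from \<open>g\<close> with a p-norm built from
  \<open>f\<close>.\<close>

lemma wpos_int_conv:
  assumes a: "0 < a" and p: "1 \<le> p"
  shows "\<exists>C\<ge>0. \<forall>f\<in>schwartz. \<forall>g\<in>schwartz. \<forall>m\<ge>0.
     wpos_int a 1 g + wpos_int a 1 (\<lambda>x. g (- x)) \<le> ennreal m \<longrightarrow>
     wpos_int a p (conv f g) \<le> ennreal ((C * m) powr p) * (wpos_int a p f + wpos_int a p (\<lambda>x. f (- x)))"
proof -
  note Gam = Gamma_real_pos[OF a]
  obtain Cp where Cp: "0 \<le> Cp" "\<And>F. F \<in> borel_measurable borel \<Longrightarrow>
    (\<integral>\<^sup>+v. epow (phi a F v) p \<partial>lborel) \<le> ennreal (Cp powr p) * (\<integral>\<^sup>+t. epow (wpos a F t) p \<partial>lborel)"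
    using hardy_phi[OF p a] by blast
  obtain C1 where C1: "0 \<le> C1" "\<And>F. F \<in> borel_measurable borel \<Longrightarrow>
    (\<integral>\<^sup>+v. phi a F v \<partial>lborel) \<le> ennreal C1 * (\<integral>\<^sup>+t. wpos a F t \<partial>lborel)"
    using hardy_phi[OF order_refl a] by auto
  obtain Ep where Ep: "0 \<le> Ep" "\<And>f. f \<in> schwartz \<Longrightarrow> (\<integral>\<^sup>+v. epow (ennreal (norm (f v))) p \<partial>lborel)
      \<le> ennreal (Ep powr p) * (wpos_int a p f + wpos_int a p (\<lambda>x. f (- x)))"
    using embedding_nn[OF a p] by blast
  obtain E1 where E1: "0 \<le> E1" "\<And>f. f \<in> schwartz \<Longrightarrow> (\<integral>\<^sup>+v. ennreal (norm (f v)) \<partial>lborel)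
      \<le> ennreal E1 * (wpos_int a 1 f + wpos_int a 1 (\<lambda>x. f (- x)))"
    using embedding_nn[OF a order_refl] by auto
  define e where "e = 2 powr a"
  have e: "0 \<le> e" by (simp add: e_def)
  \<comment> \<open>Dominates the constants of all five terms: embedding constants for
    \<open>T1\<close> and \<open>T2\<close>, Hardy constants times \<open>e\<close> for
    \<open>T3\<close> and \<open>T4\<close>, and the tail constant for \<open>T5\<close>.\<close>
  define B where "B = Ep + E1 + e * Cp + e * C1 + p / Gamma a"
  have B: "Ep \<le> B" "E1 \<le> B" "e * Cp \<le> B" "e * C1 \<le> B" "p / Gamma a \<le> B" "0 \<le> B"
    using Ep E1 Cp C1 e Gam p by (auto simp: B_def add_increasing add_increasing2 intro!: add_nonneg_nonneg)
  \<comment> \<open>The cube comes from splitting the sum in three nested applications of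
    \<open>epow_add_le\<close>, the 5 from the number of terms; the p-th root lets both move inside
    the power.\<close>
  define C where "C = (5 * (2 powr p) ^ 3) powr (1 / p) * B"
  have C: "0 \<le> C" using B by (simp add: C_def)
  have "wpos_int a p (conv f g) \<le> ennreal ((C * m) powr p) * (wpos_int a p f + wpos_int a p (\<lambda>x. f (- x)))"
    if f: "f \<in> schwartz" and g: "g \<in> schwartz" and m: "0 \<le> m"
      and N: "wpos_int a 1 g + wpos_int a 1 (\<lambda>x. g (- x)) \<le> ennreal m" for f g m
  proof -
    let ?F = "weyl_plus a f" and ?G = "weyl_plus a g"
    let ?N = "wpos_int a p f + wpos_int a p (\<lambda>x. f (- x))"
    note [measurable] = weyl_plus_measurable[OF f a] weyl_plus_measurable[OF g a]
      schwartz_measurable[OF f] schwartz_measurable[OF g]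
    have N1: "(\<integral>\<^sup>+t. wpos a ?G t \<partial>lborel) \<le> ennreal m"
      using N by (simp add: wpos_int_def) (metis add_increasing2 order_refl order_trans zero_le)
    have N2: "(\<integral>\<^sup>+t. phi a ?G t \<partial>lborel) \<le> ennreal (C1 * m)"
      using order_trans[OF C1(2)[OF weyl_plus_measurable[OF g a]] mult_left_mono[OF N1]] C1 m by (simp add: ennreal_mult)
    have N3: "(\<integral>\<^sup>+t. ennreal (norm (g t)) \<partial>lborel) \<le> ennreal (E1 * m)"
      using order_trans[OF E1(2)[OF g] mult_left_mono[OF N]] E1 m by (simp add: ennreal_mult)
    have Nf: "wpos_int a p f \<le> ?N" by simp
    define T1 where "T1 = (\<lambda>x. \<integral>\<^sup>+y. wpos a ?G y * ennreal (norm (f (x - y))) \<partial>lborel)"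
    define T2 where "T2 = (\<lambda>x. \<integral>\<^sup>+y. ennreal (norm (g y)) * wpos a ?F (x - y) \<partial>lborel)"
    define T3 where "T3 = (\<lambda>x. ennreal e * (\<integral>\<^sup>+y. wpos a ?G y * phi a ?F (x - y) \<partial>lborel))"
    define T4 where "T4 = (\<lambda>x. ennreal e * (\<integral>\<^sup>+y. phi a ?G y * wpos a ?F (x - y) \<partial>lborel))"
    define T5 where "T5 = (\<lambda>x. ennreal (1 / Gamma a) * (\<integral>\<^sup>+y. wpos a ?G y \<partial>lborel) * hardy_tail a ?F x)"
    have [measurable]: "T1 \<in> borel_measurable borel" "T2 \<in> borel_measurable borel" "T3 \<in> borel_measurable borel"
      "T4 \<in> borel_measurable borel" "T5 \<in> borel_measurable borel"
      unfolding T1_def T2_def T3_def T4_def T5_def by measurable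
    have fin: "ennreal (c powr p) * X \<le> ennreal ((B * m) powr p) * ?N"
      if "X \<le> ?N" "0 \<le> c" "c \<le> B * m" for c X
      using that p by (intro mult_mono ennreal_leI powr_mono2) auto
    have mult: "ennreal (c powr p) * (ennreal (d powr p) * X) = ennreal ((c * d) powr p) * X" if "0 \<le> c" "0 \<le> d" for c d X
      using that by (simp add: powr_mult ennreal_mult mult.assoc)
    have I1: "(\<integral>\<^sup>+x. epow (T1 x) p \<partial>lborel) \<le> ennreal ((B * m) powr p) * ?N"
    proof -
      have "(\<integral>\<^sup>+x. epow (T1 x) p \<partial>lborel) \<le> ennreal (m powr p) * (\<integral>\<^sup>+x. epow (ennreal (norm (f x))) p \<partial>lborel)"
        unfolding T1_def by (rule young_nn_integral[OF p _ _ N1 m]) measurable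
      also have "\<dots> \<le> ennreal (m powr p) * (ennreal (Ep powr p) * ?N)"
        by (intro mult_left_mono Ep f) auto
      also have "\<dots> \<le> ennreal ((B * m) powr p) * ?N"
        unfolding mult[OF m Ep(1)] using B m Ep mult_right_mono[of Ep B m] by (intro fin) (auto simp: mult.commute)
      finally show ?thesis .
    qed
    have I2: "(\<integral>\<^sup>+x. epow (T2 x) p \<partial>lborel) \<le> ennreal ((B * m) powr p) * ?N"
    proof -
      have "(\<integral>\<^sup>+x. epow (T2 x) p \<partial>lborel) \<le> ennreal ((E1 * m) powr p) * wpos_int a p f"
        unfolding T2_def wpos_int_def by (rule young_nn_integral[OF p _ _ N3]) (use E1 m in auto)
      also have "\<dots> \<le> ennreal ((B * m) powr p) * ?N"
        using B m E1 by (intro fin Nf) (auto intro!: mult_right_mono)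
      finally show ?thesis .
    qed
    have I3: "(\<integral>\<^sup>+x. epow (T3 x) p \<partial>lborel) \<le> ennreal ((B * m) powr p) * ?N"
    proof -
      have "(\<integral>\<^sup>+x. epow (T3 x) p \<partial>lborel) = ennreal (e powr p) * (\<integral>\<^sup>+x. epow (\<integral>\<^sup>+y. wpos a ?G y * phi a ?F (x - y) \<partial>lborel) p \<partial>lborel)"
        unfolding T3_def using e by (simp add: epow_mult nn_integral_cmult)
      also have "\<dots> \<le> ennreal (e powr p) * (ennreal (m powr p) * (\<integral>\<^sup>+x. epow (phi a ?F x) p \<partial>lborel))"
        by (intro mult_left_mono young_nn_integral[OF p _ _ N1 m]) auto
      also have "\<dots> \<le> ennreal (e powr p) * (ennreal (m powr p) * (ennreal (Cp powr p) * wpos_int a p f))"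
        unfolding wpos_int_def by (intro mult_left_mono Cp) auto
      also have "\<dots> \<le> ennreal ((B * m) powr p) * ?N"
        using e m Cp B mult_right_mono[of "e * Cp" B m]
        by (subst mult, simp, simp, subst mult, simp, simp, intro fin Nf) (auto simp: mult_ac)
      finally show ?thesis .
    qed
    have I4: "(\<integral>\<^sup>+x. epow (T4 x) p \<partial>lborel) \<le> ennreal ((B * m) powr p) * ?N"
    proof -
      have "(\<integral>\<^sup>+x. epow (T4 x) p \<partial>lborel) = ennreal (e powr p) * (\<integral>\<^sup>+x. epow (\<integral>\<^sup>+y. phi a ?G y * wpos a ?F (x - y) \<partial>lborel) p \<partial>lborel)"
        unfolding T4_def using e by (simp add: epow_mult nn_integral_cmult)
      also have "\<dots> \<le> ennreal (e powr p) * (ennreal ((C1 * m) powr p) * wpos_int a p f)"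
        unfolding wpos_int_def
        by (intro mult_left_mono young_nn_integral[OF p _ _ N2]) (use C1 m in auto)
      also have "\<dots> \<le> ennreal ((B * m) powr p) * ?N"
        using e m C1 B mult_right_mono[of "e * C1" B m]
        by (subst mult, simp, simp, intro fin Nf) (auto simp: mult_ac)
      finally show ?thesis .
    qed
    have I5: "(\<integral>\<^sup>+x. epow (T5 x) p \<partial>lborel) \<le> ennreal ((B * m) powr p) * ?N"
    proof -
      have "(\<integral>\<^sup>+x. epow (T5 x) p \<partial>lborel) \<le> (\<integral>\<^sup>+x. epow (ennreal (1 / Gamma a * m) * hardy_tail a ?F x) p \<partial>lborel)"
        unfolding T5_def using p Gam m
        by (intro nn_integral_mono epow_mono mult_right_mono order_trans[OF mult_left_mono[OF N1]])
           (auto simp: ennreal_mult[symmetric])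
      also have "\<dots> = ennreal ((1 / Gamma a * m) powr p) * (\<integral>\<^sup>+x. epow (hardy_tail a ?F x) p \<partial>lborel)"
        using Gam m by (subst nn_integral_cmult[symmetric]) (auto simp: epow_mult)
      also have "\<dots> \<le> ennreal ((1 / Gamma a * m) powr p) * (ennreal (p powr p) * wpos_int a p f)"
        unfolding wpos_int_def by (intro mult_left_mono hardy_tail_bound p) auto
      also have "\<dots> \<le> ennreal ((B * m) powr p) * ?N"
        using p m Gam B mult_right_mono[of "p / Gamma a" B m]
        by (subst mult, simp, simp, intro fin Nf) (auto simp: mult_ac)
      finally show ?thesis .
    qed
    have pw: "wpos a (weyl_plus a (conv f g)) x \<le> T1 x + T2 x + (T3 x + T4 x) + T5 x" for x
    proof (cases "0 < x")
      case True
      have "wpos a (weyl_plus a (conv f g)) x = ennreal (x powr a) * ennreal (norm (conv f ?G x))"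
        using True by (simp add: wpos_def weyl_plus_conv[OF f g a] ennreal_mult)
      also have "\<dots> \<le> T1 x + T2 x + (T3 x + T4 x) + T5 x"
        unfolding T1_def T2_def T3_def T4_def T5_def e_def distrib_left[symmetric]
        by (rule weyl_conv_pointwise)
           (use f g a True in \<open>auto simp: weyl_plus_rapid weyl_plus_growth weyl_plus_inverse\<close>)
      finally show ?thesis .
    qed (simp add: wpos_def)
    have "wpos_int a p (conv f g) \<le> (\<integral>\<^sup>+x. ennreal ((2 powr p) ^ 3) *
        (epow (T1 x) p + epow (T2 x) p + (epow (T3 x) p + epow (T4 x) p) + epow (T5 x) p) \<partial>lborel)"
      unfolding wpos_int_def using p
      by (intro nn_integral_mono order_trans[OF epow_mono[OF pw] epow_sum5_le]) auto
    also have "\<dots> = ennreal ((2 powr p) ^ 3) * ((\<integral>\<^sup>+x. epow (T1 x) p \<partial>lborel) + (\<integral>\<^sup>+x. epow (T2 x) p \<partial>lborel)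
       + ((\<integral>\<^sup>+x. epow (T3 x) p \<partial>lborel) + (\<integral>\<^sup>+x. epow (T4 x) p \<partial>lborel)) + (\<integral>\<^sup>+x. epow (T5 x) p \<partial>lborel))"
      by (simp add: nn_integral_cmult nn_integral_add)
    also have "\<dots> \<le> ennreal ((2 powr p) ^ 3) * (ennreal ((B * m) powr p) * ?N + ennreal ((B * m) powr p) * ?N
       + (ennreal ((B * m) powr p) * ?N + ennreal ((B * m) powr p) * ?N) + ennreal ((B * m) powr p) * ?N)"
      by (intro mult_left_mono add_mono I1 I2 I3 I4 I5) auto
    also have "\<dots> = ennreal ((2 powr p) ^ 3) * (5 * (ennreal ((B * m) powr p) * ?N))"
    proof -
      have five: "(5 :: ennreal) = 1 + 1 + (1 + 1) + 1" by simp
      show ?thesis unfolding five by (simp only: distrib_right mult_1)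
    qed
    also have "\<dots> = ennreal (5 * (2 powr p) ^ 3) * (ennreal ((B * m) powr p) * ?N)"
      by (simp add: ennreal_mult mult_ac)
    also have "\<dots> = ennreal ((C * m) powr p) * ?N"
    proof -
      have "(C * m) powr p = (5 * (2 powr p) ^ 3) * (B * m) powr p"
        using B m p by (simp add: C_def powr_mult powr_powr mult_ac)
      then show ?thesis by (simp add: ennreal_mult mult.assoc)
    qed
    finally show ?thesis .
  qed
  with C show ?thesis by blast
qed

section \<open>The weighted derivative on both half-lines\<close>

definition wD :: "real \<Rightarrow> (real \<Rightarrow> complex) \<Rightarrow> real \<Rightarrow> complex" where
  "wD a f t = complex_of_real (\<bar>t\<bar> powr a) * weyl0 a f t"

lemma tnorm_eq: "tnorm a p f = lpn p (wD a f) / Gamma (a + 1)"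
  by (simp add: tnorm_def lpn_def wD_def norm_mult mult.commute)

lemma lp_dist_eq: "lp_dist p f g = lpn p (\<lambda>x. f x - g x)"
  by (simp add: lp_dist_def lpn_def)

lemma wD_0: "wD 0 f t = (if t = 0 then 0 else f t)"
  by (simp add: wD_def weyl0_def weyl_minus_def weyl_plus_def)

lemma wD_alt:
  assumes f: "f \<in> schwartz" and a: "0 \<le> a"
  shows "wD a f t = complex_of_real (\<bar>t\<bar> powr a) *
    (if t < 0 then weyl_plus a (\<lambda>x. f (- x)) (- t)
     else if t > 0 then exp (\<i> * complex_of_real (pi * a)) * weyl_plus a f t else 0)"
  by (simp add: wD_def weyl0_def weyl_minus_eq[OF f a])

lemma wD_measurable:
  assumes f: "f \<in> schwartz" and a: "0 \<le> a"
  shows "wD a f \<in> borel_measurable borel"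
proof (cases "a = 0")
  case True
  note [measurable] = schwartz_measurable[OF f]
  show ?thesis unfolding True wD_0[abs_def] by measurable
next
  case False
  with a have a': "0 < a" by simp
  note [measurable] = weyl_plus_measurable[OF f a'] weyl_plus_measurable[OF schwartz_reflect[OF f] a']
  show ?thesis unfolding wD_alt[OF f a, abs_def] by measurable
qed

text \<open>At each \<open>t\<close> at most one summand is nonzero, and the phase on the positive
  half-line has modulus 1.\<close>

lemma norm_wD:
  assumes f: "f \<in> schwartz" and a: "0 < a"
  shows "ennreal (norm (wD a f t)) = wpos a (weyl_plus a f) t + wpos a (weyl_plus a (\<lambda>x. f (- x))) (- t)"
  using a by (auto simp: wD_alt[OF f] wpos_def norm_mult)

lemma nn_integral_wD:
  assumes f: "f \<in> schwartz" and a: "0 < a" and p: "0 < p"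
  shows "(\<integral>\<^sup>+t. epow (ennreal (norm (wD a f t))) p \<partial>lborel) = wpos_int a p f + wpos_int a p (\<lambda>x. f (- x))"
proof -
  note [measurable] = weyl_plus_measurable[OF f a] weyl_plus_measurable[OF schwartz_reflect[OF f] a]
  have "epow (ennreal (norm (wD a f t))) p = epow (wpos a (weyl_plus a f) t) p + epow (wpos a (weyl_plus a (\<lambda>x. f (- x))) (- t)) p" for t
    unfolding norm_wD[OF f a] by (cases "0 < t") (simp_all add: wpos_def)
  then have "(\<integral>\<^sup>+t. epow (ennreal (norm (wD a f t))) p \<partial>lborel) = wpos_int a p f +
      (\<integral>\<^sup>+t. epow (wpos a (weyl_plus a (\<lambda>x. f (- x))) (- t)) p \<partial>lborel)"
    by (simp add: nn_integral_add wpos_int_def)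
  also have "(\<integral>\<^sup>+t. epow (wpos a (weyl_plus a (\<lambda>x. f (- x))) (- t)) p \<partial>lborel) = wpos_int a p (\<lambda>x. f (- x))"
    unfolding wpos_int_def by (rule nn_integral_lborel_shift(3)) measurable
  finally show ?thesis .
qed

text \<open>Decay of order \<lceil>a\<rceil> + 2 leaves a multiple of 1/(1 + t)^2 after the weight,
  and a number in [0, 1] does not grow when raised to the power p \<ge> 1.\<close>

lemma wpos_int_finite:
  assumes f: "f \<in> schwartz" and a: "0 < a" and p: "1 \<le> p"
  shows "wpos_int a p f < top"
proof -
  let ?j = "nat \<lceil>a\<rceil> + 2"
  obtain C where C: "0 \<le> C" "\<And>t. 0 \<le> t \<Longrightarrow> norm (weyl_plus a f t) \<le> C / (1 + t) ^ ?j"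
    using weyl_plus_rapid[OF f a] unfolding rapid_def by meson
  have "epow (wpos a (weyl_plus a f) t) p \<le> ennreal (C powr p) * ennreal (1 / (1 + \<bar>t\<bar>) ^ 2)" for t
  proof (cases "0 < t")
    case True
    have "t powr a \<le> (1 + t) powr real (nat \<lceil>a\<rceil>)"
    proof -
      have "t powr a \<le> (1 + t) powr a" using True a by (intro powr_mono2) auto
      also have "\<dots> \<le> (1 + t) powr real (nat \<lceil>a\<rceil>)" using True a by (intro powr_mono) linarith+
      finally show ?thesis .
    qed
    also have "\<dots> = (1 + t) ^ nat \<lceil>a\<rceil>" using True by (simp add: powr_realpow)
    finally have "t powr a * norm (weyl_plus a f t) \<le> (1 + t) ^ nat \<lceil>a\<rceil> * (C / (1 + t) ^ ?j)"
      using True C by (intro mult_mono) auto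
    also have "\<dots> = C * (1 / (1 + t) ^ 2)" using True by (simp only: power_add) simp
    finally have "(t powr a * norm (weyl_plus a f t)) powr p \<le> (C * (1 / (1 + t) ^ 2)) powr p"
      using p True by (intro powr_mono2) auto
    also have "\<dots> = C powr p * (1 / (1 + t) ^ 2) powr p" using C True by (subst powr_mult) auto
    also have "(1 / (1 + t) ^ 2) powr p \<le> (1 / (1 + t) ^ 2) powr 1"
      using p True by (intro powr_mono') (auto simp: one_le_power)
    finally have "(t powr a * norm (weyl_plus a f t)) powr p \<le> C powr p * (1 / (1 + t) ^ 2)"
      using True by (simp add: mult_left_mono)
    then show ?thesis using True by (simp add: wpos_def ennreal_mult[symmetric] ennreal_leI)
  qed (simp add: wpos_def)
  then have "wpos_int a p f \<le> (\<integral>\<^sup>+t. ennreal (C powr p) * ennreal (1 / (1 + \<bar>t\<bar>) ^ 2) \<partial>lborel)"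
    unfolding wpos_int_def by (rule nn_integral_mono)
  also have "\<dots> = ennreal (C powr p) * (\<integral>\<^sup>+t. ennreal (1 / (1 + \<bar>t\<bar>) ^ 2) \<partial>lborel)"
    by (rule nn_integral_cmult) measurable
  also have "\<dots> < top"
    using order_le_less_trans[OF nn_integral_one_plus_square, of top] by (simp add: ennreal_mult_less_top)
  finally show ?thesis .
qed

lemma schwartz_in_Lp:
  assumes f: "f \<in> schwartz" and p: "1 \<le> p"
  shows "in_Lp p f"
proof -
  note [measurable] = schwartz_measurable[OF f]
  obtain C where C: "0 \<le> C" "\<And>x. norm (f x) \<le> C / (1 + \<bar>x\<bar>) ^ 2" using schwartz_decay[OF f] by blast
  have "integrable lborel (\<lambda>x. norm (f x) powr p)"
  proof (rule Bochner_Integration.integrable_bound)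
    show "integrable lborel (\<lambda>x::real. C powr p * (1 / (1 + \<bar>x\<bar>) ^ 2))"
      using integrable_one_plus_square by (rule integrable_mult_right)
    show "AE x in lborel. norm (norm (f x) powr p) \<le> norm (C powr p * (1 / (1 + \<bar>x\<bar>) ^ 2))"
    proof (rule AE_I2)
      fix x :: real
      have "norm (f x) powr p \<le> (C * (1 / (1 + \<bar>x\<bar>) ^ 2)) powr p"
        using C(2)[of x] p by (intro powr_mono2) auto
      also have "\<dots> = C powr p * (1 / (1 + \<bar>x\<bar>) ^ 2) powr p" using C by (subst powr_mult) auto
      also have "(1 / (1 + \<bar>x\<bar>) ^ 2) powr p \<le> (1 / (1 + \<bar>x\<bar>) ^ 2) powr 1"
        using p by (intro powr_mono') (auto simp: one_le_power)
      finally show "norm (norm (f x) powr p) \<le> norm (C powr p * (1 / (1 + \<bar>x\<bar>) ^ 2))"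
        by (simp add: mult_left_mono)
    qed
  qed measurable
  then show ?thesis by (simp add: in_Lp_def)
qed

text \<open>The exceptional point is the origin, where \<open>weyl0\<close> has the value 0.\<close>

lemma wD_0_AE: "AE t in lborel. wD 0 f t = f t"
  by (rule AE_mp[OF AE_lborel_singleton[of 0]]) (simp add: wD_0)

lemma lpn_wD_0:
  assumes f: "f \<in> schwartz"
  shows "lpn p (wD 0 f) = lpn p f"
proof -
  note [measurable] = wD_measurable[OF f order_refl] schwartz_measurable[OF f]
  have "AE t in lborel. norm (wD 0 f t) powr p = norm (f t) powr p"
    using wD_0_AE[of f] by eventually_elim simp
  then show ?thesis unfolding lpn_def by (subst integral_cong_AE) auto
qed

lemma wD_in_Lp:
  assumes f: "f \<in> schwartz" and a: "0 \<le> a" and p: "1 \<le> p"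
  shows "in_Lp p (wD a f)"
proof (cases "a = 0")
  case True
  note [measurable] = wD_measurable[OF f order_refl] schwartz_measurable[OF f]
  have "AE t in lborel. norm (wD 0 f t) powr p = norm (f t) powr p"
    using wD_0_AE[of f] by eventually_elim simp
  then have "integrable lborel (\<lambda>x. norm (wD 0 f x) powr p) \<longleftrightarrow> integrable lborel (\<lambda>x. norm (f x) powr p)"
    by (intro integrable_cong_AE) auto
  then show ?thesis
    using schwartz_in_Lp[OF f p] wD_measurable[OF f a] True by (simp add: in_Lp_def)
next
  case False
  with a have a': "0 < a" by simp
  have "(\<integral>\<^sup>+t. epow (ennreal (norm (wD a f t))) p \<partial>lborel) < top"
    using nn_integral_wD[OF f a', of p] wpos_int_finite[OF f a' p] wpos_int_finite[OF schwartz_reflect[OF f] a' p] p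
    by simp
  then obtain c where "0 \<le> c" "(\<integral>\<^sup>+t. epow (ennreal (norm (wD a f t))) p \<partial>lborel) = ennreal c"
    by (cases "\<integral>\<^sup>+t. epow (ennreal (norm (wD a f t))) p \<partial>lborel") auto
  then show ?thesis
    using p by (intro in_LpI[OF wD_measurable[OF f a], of p "c powr (1 / p)"]) (auto simp: powr_powr)
qed

lemma wD_diff:
  assumes f: "f \<in> schwartz" and g: "g \<in> schwartz" and a: "0 \<le> a"
  shows "wD a (\<lambda>x. f x - g x) t = wD a f t - wD a g t"
proof (cases "a = 0")
  case True
  then show ?thesis by (simp add: wD_0)
next
  case False
  with a have a': "0 < a" by simp
  show ?thesis
    by (auto simp: wD_alt[OF f a] wD_alt[OF g a] wD_alt[OF schwartz_diff[OF f g] a] weyl_plus_diff[OF f g a']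
        weyl_plus_diff[OF schwartz_reflect[OF f] schwartz_reflect[OF g] a'] right_diff_distrib)
qed

lemma lpn_conv:
  assumes f: "in_Lp p f" and g: "in_Lp 1 g" and p: "1 \<le> p"
  shows conv_in_Lp: "in_Lp p (conv f g)" and "lpn p (conv f g) \<le> lpn p f * lpn 1 g"
proof -
  note [measurable] = in_Lp_measurable[OF f] in_Lp_measurable[OF g]
  have g1: "(\<integral>\<^sup>+x. ennreal (norm (g x)) \<partial>lborel) \<le> ennreal (lpn 1 g)"
    using nn_integral_eq_lpn[OF g] by simp
  have "(\<integral>\<^sup>+x. epow (ennreal (norm (conv f g x))) p \<partial>lborel) \<le>
      (\<integral>\<^sup>+x. epow (\<integral>\<^sup>+y. ennreal (norm (g y)) * ennreal (norm (f (x - y))) \<partial>lborel) p \<partial>lborel)"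
    using p by (intro nn_integral_mono epow_mono norm_conv_le) auto
  also have "\<dots> \<le> ennreal (lpn 1 g powr p) * (\<integral>\<^sup>+x. epow (ennreal (norm (f x))) p \<partial>lborel)"
    by (rule young_nn_integral[OF p _ _ g1]) auto
  also have "\<dots> = ennreal ((lpn p f * lpn 1 g) powr p)"
    using p by (simp only: nn_integral_eq_lpn[OF f]) (simp add: powr_mult ennreal_mult mult.commute)
  finally have le: "(\<integral>\<^sup>+x. epow (ennreal (norm (conv f g x))) p \<partial>lborel) \<le> ennreal ((lpn p f * lpn 1 g) powr p)" .
  show "in_Lp p (conv f g)" "lpn p (conv f g) \<le> lpn p f * lpn 1 g"
    by (rule lpn_leI[OF _ _ _ le]; use p in simp)+
qed

text \<open>For a = 0 this is Young's inequality. For a > 0 each half-line is bounded by the full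
  norms of both factors, and adding the two p-th powers costs \<open>2 powr (1 / p)\<close>.\<close>

lemma lpn_wD_conv:
  assumes a: "0 \<le> a" and p: "1 \<le> p"
  shows "\<exists>C\<ge>0. \<forall>f\<in>schwartz. \<forall>g\<in>schwartz. lpn p (wD a (conv f g)) \<le> C * lpn p (wD a f) * lpn 1 (wD a g)"
proof (cases "a = 0")
  case True
  then show ?thesis
    using lpn_conv(2)[OF schwartz_in_Lp schwartz_in_Lp p] p
    by (intro exI[of _ 1]) (simp add: lpn_wD_0 schwartz_conv)
next
  case False
  with a have a': "0 < a" by simp
  obtain C where C: "0 \<le> C" "\<And>f g m. f \<in> schwartz \<Longrightarrow> g \<in> schwartz \<Longrightarrow> 0 \<le> m \<Longrightarrow>
     wpos_int a 1 g + wpos_int a 1 (\<lambda>x. g (- x)) \<le> ennreal m \<Longrightarrow>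
     wpos_int a p (conv f g) \<le> ennreal ((C * m) powr p) * (wpos_int a p f + wpos_int a p (\<lambda>x. f (- x)))"
    using wpos_int_conv[OF a' p] by blast
  define K where "K = 2 powr (1 / p) * C"
  have K: "0 \<le> K" using C by (simp add: K_def)
  have "lpn p (wD a (conv f g)) \<le> K * lpn p (wD a f) * lpn 1 (wD a g)" if f: "f \<in> schwartz" and g: "g \<in> schwartz" for f g
  proof (rule lpn_leI(2))
    note fr = schwartz_reflect[OF f] and gr = schwartz_reflect[OF g]
    let ?m = "lpn 1 (wD a g)" and ?l = "lpn p (wD a f)"
    show "wD a (conv f g) \<in> borel_measurable borel" by (intro wD_measurable schwartz_conv f g a)
    have g1: "wpos_int a 1 g + wpos_int a 1 (\<lambda>x. g (- x)) = ennreal ?m"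
      using nn_integral_wD[OF g a', of 1] nn_integral_eq_lpn[OF wD_in_Lp[OF g a order_refl]] by simp
    have fp: "wpos_int a p f + wpos_int a p (\<lambda>x. f (- x)) = ennreal (?l powr p)"
      using nn_integral_wD[OF f a', of p] nn_integral_eq_lpn[OF wD_in_Lp[OF f a p]] p by simp
    have refl: "(\<lambda>x. conv f g (- x)) = conv (\<lambda>x. f (- x)) (\<lambda>x. g (- x))"
      by (rule ext) (simp add: conv_reflect)
    have "(\<integral>\<^sup>+t. epow (ennreal (norm (wD a (conv f g) t))) p \<partial>lborel)
        = wpos_int a p (conv f g) + wpos_int a p (conv (\<lambda>x. f (- x)) (\<lambda>x. g (- x)))"
      using nn_integral_wD[OF schwartz_conv[OF f g] a', of p] p by (simp add: refl)
    also have "\<dots> \<le> ennreal ((C * ?m) powr p) * (wpos_int a p f + wpos_int a p (\<lambda>x. f (- x)))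
        + ennreal ((C * ?m) powr p) * (wpos_int a p (\<lambda>x. f (- x)) + wpos_int a p (\<lambda>x. f (- (- x))))"
      using g1 by (intro add_mono C f g fr gr) (auto simp: add.commute)
    also have "\<dots> = ennreal ((C * ?m) powr p) * ennreal (?l powr p) + ennreal ((C * ?m) powr p) * ennreal (?l powr p)"
      unfolding fp[symmetric] by (simp add: add.commute)
    also have "\<dots> = ennreal ((K * ?l * ?m) powr p)"
      using C p by (simp add: K_def powr_mult powr_powr ennreal_mult[symmetric] ennreal_plus[symmetric] mult_ac del: ennreal_plus)
    finally show "(\<integral>\<^sup>+t. epow (ennreal (norm (wD a (conv f g) t))) p \<partial>lborel) \<le> ennreal ((K * ?l * ?m) powr p)" .
  qed (use p K in auto)
  with K show ?thesis by blast
qed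

section \<open>Closability\<close>

text \<open>The Borel sets over which \<open>h\<close> integrates to 0 form a Dynkin system, and the
  rays are a generator of the Borel sets that is stable under intersection. The total integral
  enters for complements.\<close>

lemma AE_zero_of_tail_integrals:
  fixes h :: "real \<Rightarrow> complex"
  assumes h: "integrable lborel h" and tot: "(\<integral>t. h t \<partial>lborel) = 0"
    and tails: "\<And>x. (\<integral>t. indicator {x<..} t *\<^sub>R h t \<partial>lborel) = 0"
  shows "AE t in lborel. h t = 0"
proof (rule sigma_finite_measure.density_zero[OF sigma_finite_lborel h])
  fix A :: "real set" assume "A \<in> sets lborel"
  then have A: "A \<in> sigma_sets UNIV (range greaterThan)"
    unfolding sets_lborel by (subst (asm) borel_Ioi) simp
  have borel: "B \<in> sets borel" if "B \<in> sigma_sets UNIV (range (greaterThan :: real \<Rightarrow> _))" for B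
    using that by (subst borel_Ioi) simp
  have int: "set_integrable lborel B h" if "B \<in> sigma_sets UNIV (range (greaterThan :: real \<Rightarrow> _))" for B
    unfolding set_integrable_def using borel[OF that] by (intro integrable_mult_indicator h) simp
  have "Int_stable (range (greaterThan :: real \<Rightarrow> _))"
    unfolding Int_stable_def
  proof safe
    fix x y :: real
    have "{x<..} \<inter> {y<..} = {max x y<..}" by auto
    then show "{x<..} \<inter> {y<..} \<in> range greaterThan" by blast
  qed
  moreover have "range (greaterThan :: real \<Rightarrow> _) \<subseteq> Pow UNIV" by simp
  ultimately show "set_lebesgue_integral lborel A h = 0"
    using A
  proof (induction rule: sigma_sets_induct_disjoint)
    case (basic A)
    then show ?case using tails by (auto simp: set_lebesgue_integral_def)
  next
    case empty
    then show ?case by (simp add: set_lebesgue_integral_def)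
  next
    case (compl A)
    have "set_lebesgue_integral lborel (UNIV - A) h = (\<integral>t. h t - indicator A t *\<^sub>R h t \<partial>lborel)"
      unfolding set_lebesgue_integral_def
      by (intro Bochner_Integration.integral_cong) (auto split: split_indicator)
    also have "\<dots> = (\<integral>t. h t \<partial>lborel) - set_lebesgue_integral lborel A h"
      using h int[OF compl(1)] unfolding set_lebesgue_integral_def set_integrable_def
      by (rule Bochner_Integration.integral_diff)
    finally show ?case using compl tot by simp
  next
    case (union A)
    have "set_lebesgue_integral lborel (\<Union>i. A i) h = (\<Sum>i. set_lebesgue_integral lborel (A i) h)"
    proof (rule lebesgue_integral_countable_add)
      show "A i \<in> sets lborel" for i using union(2) borel by auto
      show "A i \<inter> A j = {}" if "i \<noteq> j" for i j
        using union(1) that by (auto simp: disjoint_family_on_def)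
      show "set_integrable lborel (\<Union>i. A i) h"
        using union(2) by (intro int sigma_sets.Union) auto
    qed
    then show ?case using union by simp
  qed
qed

section \<open>Truncated moments determine a function\<close>

lemma power_diff_le:
  fixes c d :: real
  assumes "0 \<le> d" "d \<le> c"
  shows "c ^ Suc m - d ^ Suc m \<le> real (Suc m) * (c - d) * c ^ m"
proof (induction m)
  case (Suc m)
  have "c ^ Suc (Suc m) - d ^ Suc (Suc m) = c * (c ^ Suc m - d ^ Suc m) + (c - d) * d ^ Suc m"
    by (simp add: algebra_simps)
  also have "\<dots> \<le> c * (real (Suc m) * (c - d) * c ^ m) + (c - d) * c ^ Suc m"
    using assms by (intro add_mono mult_left_mono Suc power_mono) auto
  also have "\<dots> = real (Suc (Suc m)) * (c - d) * c ^ Suc m"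
    by (simp add: algebra_simps)
  finally show ?case .
qed simp

text \<open>Differentiation in \<open>x\<close> lowers the degree of a truncated power by one. The
  moments vanish for all positive \<open>x\<close>, hence so do their difference quotients, and
  dominated convergence passes to the derivative.\<close>

lemma truncated_moment_step:
  fixes u :: "real \<Rightarrow> complex"
  assumes [measurable]: "u \<in> borel_measurable borel"
    and int: "\<And>x. 0 < x \<Longrightarrow> integrable lborel (\<lambda>t. indicator {x<..} t * t ^ Suc m * norm (u t))"
    and zero: "\<And>x. 0 < x \<Longrightarrow> (\<integral>t. complex_of_real (max 0 (t - x) ^ Suc m) * u t \<partial>lborel) = 0"
    and x: "0 < x"
  shows "(\<integral>t. complex_of_real (indicator {x<..} t * (t - x) ^ m) * u t \<partial>lborel) = 0"
proof -
  have bnd: "integrable lborel (\<lambda>t. complex_of_real (max 0 (t - y) ^ Suc m) * u t)" if y: "0 < y" for y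
  proof (rule Bochner_Integration.integrable_bound[OF int[OF y]])
    show "AE t in lborel. norm (complex_of_real (max 0 (t - y) ^ Suc m) * u t) \<le> norm (indicator {y<..} t * t ^ Suc m * norm (u t))"
    proof (rule AE_I2)
      fix t
      have "max 0 (t - y) ^ Suc m \<le> indicator {y<..} t * \<bar>t\<bar> ^ Suc m"
        using y by (cases "y < t") (auto intro!: mult_mono power_mono simp del: power_Suc)
      then have "max 0 (t - y) ^ Suc m * norm (u t) \<le> indicator {y<..} t * \<bar>t\<bar> ^ Suc m * norm (u t)"
        by (intro mult_right_mono) auto
      then show "norm (complex_of_real (max 0 (t - y) ^ Suc m) * u t) \<le> norm (indicator {y<..} t * t ^ Suc m * norm (u t))"
        by (simp add: norm_mult abs_mult power_abs norm_power del: power_Suc)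
    qed
  qed measurable
  define h where "h = (\<lambda>k::nat. 1 / real (Suc k))"
  have h: "0 < h k" for k by (simp add: h_def)
  have hlim: "h \<longlonglongrightarrow> 0" unfolding h_def by (rule LIMSEQ_Suc[OF lim_1_over_n])
  define Q where "Q = (\<lambda>k t. complex_of_real ((max 0 (t - x) ^ Suc m - max 0 (t - (x + h k)) ^ Suc m) / h k) * u t)"
  have Q0: "(\<integral>t. Q k t \<partial>lborel) = 0" for k
  proof -
    have "Q k t = (1 / complex_of_real (h k)) * (complex_of_real (max 0 (t - x) ^ Suc m) * u t - complex_of_real (max 0 (t - (x + h k)) ^ Suc m) * u t)" for t
      unfolding Q_def by (simp only: of_real_divide of_real_diff) (simp add: field_simps del: power_Suc)
    then have "(\<integral>t. Q k t \<partial>lborel) = (1 / complex_of_real (h k)) * ((\<integral>t. complex_of_real (max 0 (t - x) ^ Suc m) * u t \<partial>lborel) - (\<integral>t. complex_of_real (max 0 (t - (x + h k)) ^ Suc m) * u t \<partial>lborel))"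
      using x h[of k] by (simp only: integral_mult_right_zero Bochner_Integration.integral_diff bnd add_pos_pos)
    then show ?thesis using zero[OF x] zero[of "x + h k"] x h[of k] by (simp only: add_pos_pos) simp
  qed
  have "(\<lambda>k. \<integral>t. Q k t \<partial>lborel) \<longlonglongrightarrow> (\<integral>t. complex_of_real (real (Suc m) * (indicator {x<..} t * (t - x) ^ m)) * u t \<partial>lborel)"
  proof (rule integral_dominated_convergence)
    \<comment> \<open>The quotients are of size t^m; the factor t/x, larger than 1 on the support,
      raises this to the power in the integrability hypothesis.\<close>
    show "integrable lborel (\<lambda>t. real (Suc m) / x * (indicator {x<..} t * t ^ Suc m * norm (u t)))"
      by (intro integrable_mult_right int x)
    show "AE t in lborel. (\<lambda>k. Q k t) \<longlonglongrightarrow> complex_of_real (real (Suc m) * (indicator {x<..} t * (t - x) ^ m)) * u t"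
    proof (rule AE_I2)
      fix t
      show "(\<lambda>k. Q k t) \<longlonglongrightarrow> complex_of_real (real (Suc m) * (indicator {x<..} t * (t - x) ^ m)) * u t"
      proof (cases "x < t")
        case True
        have "((\<lambda>s. - ((t - s) ^ Suc m)) has_field_derivative real (Suc m) * (t - x) ^ m) (at x)"
          by (auto intro!: derivative_eq_intros simp del: power_Suc)
        then have "((\<lambda>e. (- ((t - (x + e)) ^ Suc m) - - ((t - x) ^ Suc m)) / e) \<longlongrightarrow> real (Suc m) * (t - x) ^ m) (at 0)"
          by (simp only: DERIV_def)
        then have lim: "(\<lambda>k. (- ((t - (x + h k)) ^ Suc m) - - ((t - x) ^ Suc m)) / h k) \<longlonglongrightarrow> real (Suc m) * (t - x) ^ m"
          unfolding tendsto_at_iff_sequentially using h hlim by (auto simp: o_def less_imp_neq[symmetric] dest: spec[of _ h])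
        have "\<forall>\<^sub>F k in sequentially. h k < t - x"
          using hlim True by (intro order_tendstoD) auto
        then have "\<forall>\<^sub>F k in sequentially. (- ((t - (x + h k)) ^ Suc m) - - ((t - x) ^ Suc m)) / h k
            = (max 0 (t - x) ^ Suc m - max 0 (t - (x + h k)) ^ Suc m) / h k"
        proof eventually_elim
          case (elim k)
          then show ?case using True by (simp add: max_def del: power_Suc)
        qed
        from Lim_transform_eventually[OF lim this]
        show ?thesis using True unfolding Q_def by (intro tendsto_mult tendsto_of_real) auto
      next
        case False
        have "Q k t = 0" for k using False h[of k] by (simp add: Q_def max_def)
        then show ?thesis using False by simp
      qed
    qed
    show "AE t in lborel. norm (Q k t) \<le> real (Suc m) / x * (indicator {x<..} t * t ^ Suc m * norm (u t))" for k
    proof (rule AE_I2)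
      fix t
      show "norm (Q k t) \<le> real (Suc m) / x * (indicator {x<..} t * t ^ Suc m * norm (u t))"
      proof (cases "x < t")
        case True
        let ?c = "max 0 (t - x)" and ?d = "max 0 (t - (x + h k))"
        have cd: "0 \<le> ?d" "?d \<le> ?c" "?c - ?d \<le> h k" using h[of k] by auto
        have "?c ^ Suc m - ?d ^ Suc m \<le> real (Suc m) * (?c - ?d) * ?c ^ m"
          by (rule power_diff_le) (use cd in auto)
        also have "\<dots> \<le> real (Suc m) * h k * t ^ m"
          using True x cd by (intro mult_mono power_mono) auto
        finally have "(?c ^ Suc m - ?d ^ Suc m) / h k \<le> real (Suc m) * t ^ m"
          using h[of k] by (simp add: pos_divide_le_eq mult_ac del: power_Suc)
        also have "\<dots> \<le> real (Suc m) * t ^ m * (t / x)"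
          using True x mult_left_mono[of 1 "t / x" "real (Suc m) * t ^ m"] by simp
        also have "\<dots> = real (Suc m) / x * t ^ Suc m" by simp
        finally have le: "(?c ^ Suc m - ?d ^ Suc m) / h k \<le> real (Suc m) / x * t ^ Suc m" .
        have "0 \<le> (?c ^ Suc m - ?d ^ Suc m) / h k"
          using h[of k] power_mono[OF cd(2,1), of "Suc m"] by (simp del: power_Suc)
        then have "norm (Q k t) = (?c ^ Suc m - ?d ^ Suc m) / h k * norm (u t)"
          unfolding Q_def norm_mult norm_of_real by (simp only: abs_of_nonneg)
        also have "\<dots> \<le> real (Suc m) / x * t ^ Suc m * norm (u t)"
          by (intro mult_right_mono le) simp
        finally show ?thesis using True by (simp add: mult_ac del: power_Suc)
      next
        case False
        have "Q k t = 0" using False h[of k] by (simp add: Q_def max_def)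
        then show ?thesis using False by simp
      qed
    qed
    show "Q k \<in> borel_measurable lborel" for k unfolding Q_def by measurable
  qed measurable
  then have "(\<integral>t. complex_of_real (real (Suc m) * (indicator {x<..} t * (t - x) ^ m)) * u t \<partial>lborel) = 0"
    unfolding Q0 by (simp add: LIMSEQ_const_iff)
  moreover have "(\<lambda>t. complex_of_real (real (Suc m) * (indicator {x<..} t * (t - x) ^ m)) * u t)
     = (\<lambda>t. of_nat (Suc m) * (complex_of_real (indicator {x<..} t * (t - x) ^ m) * u t))"
    by (auto simp: fun_eq_iff)
  ultimately show ?thesis by (simp only: integral_mult_right_zero mult_eq_0_iff) (use of_nat_neq_0 in blast)
qed

text \<open>Induction on the degree, each step differentiating the moments once in \<open>x\<close>.
  Degree 0 leaves integrals over rays.\<close>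

lemma truncated_moments_zero:
  fixes u :: "real \<Rightarrow> complex"
  assumes [measurable]: "u \<in> borel_measurable borel"
    and int: "\<And>x. 0 < x \<Longrightarrow> integrable lborel (\<lambda>t. indicator {x<..} t * t ^ m * norm (u t))"
    and zero: "\<And>x. 0 < x \<Longrightarrow> (\<integral>t. complex_of_real (indicator {x<..} t * (t - x) ^ m) * u t \<partial>lborel) = 0"
  shows "AE t in lborel. 0 < t \<longrightarrow> u t = 0"
  using int zero
proof (induction m)
  case 0
  \<comment> \<open>Integrability is known only away from 0, so the half-line is exhausted by
    countably many rays.\<close>
  have "AE t in lborel. 1 / real (Suc k) < t \<longrightarrow> u t = 0" for k
  proof -
    let ?x = "1 / real (Suc k)"
    let ?h = "\<lambda>t. complex_of_real (indicator {?x<..} t) * u t"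
    have int: "integrable lborel ?h"
      by (rule Bochner_Integration.integrable_bound[OF 0(1)[of ?x]]) (auto simp: norm_mult)
    have z: "(\<integral>t. complex_of_real (indicator {y<..} t) * u t \<partial>lborel) = 0" if "0 < y" for y
      using 0(2)[OF that] by simp
    have "AE t in lborel. ?h t = 0"
    proof (rule AE_zero_of_tail_integrals[OF int])
      show "(\<integral>t. ?h t \<partial>lborel) = 0" by (rule z) simp
      fix y :: real
      have "(\<integral>t. indicator {y<..} t *\<^sub>R ?h t \<partial>lborel) = (\<integral>t. complex_of_real (indicator {max y ?x<..} t) * u t \<partial>lborel)"
        by (intro Bochner_Integration.integral_cong) (auto split: split_indicator)
      also have "\<dots> = 0" by (rule z) (simp add: less_max_iff_disj)
      finally show "(\<integral>t. indicator {y<..} t *\<^sub>R ?h t \<partial>lborel) = 0" .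
    qed
    then show ?thesis by eventually_elim (auto split: split_indicator_asm)
  qed
  then have "AE t in lborel. \<forall>k. 1 / real (Suc k) < t \<longrightarrow> u t = 0"
    by (simp only: AE_all_countable) blast
  then show ?case
    by eventually_elim (metis inverse_eq_divide reals_Archimedean)
next
  case (Suc m)
  show ?case
  proof (rule Suc.IH)
    fix x :: real assume x: "0 < x"
    show "integrable lborel (\<lambda>t. indicator {x<..} t * t ^ m * norm (u t))"
    proof (rule Bochner_Integration.integrable_bound[OF integrable_mult_right[OF Suc.prems(1)[OF x], of "1 / x"]])
      show "AE t in lborel. norm (indicator {x<..} t * t ^ m * norm (u t)) \<le> norm (1 / x * (indicator {x<..} t * t ^ Suc m * norm (u t)))"
      proof (rule AE_I2)
        fix t
        show "norm (indicator {x<..} t * t ^ m * norm (u t)) \<le> norm (1 / x * (indicator {x<..} t * t ^ Suc m * norm (u t)))"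
        proof (cases "x < t")
          case True
          have "t ^ m * norm (u t) * 1 \<le> t ^ m * norm (u t) * (t / x)"
            using True x by (intro mult_left_mono) auto
          then show ?thesis using True x by (simp add: abs_mult mult_ac)
        qed simp
      qed
    qed measurable
    show "(\<integral>t. complex_of_real (indicator {x<..} t * (t - x) ^ m) * u t \<partial>lborel) = 0"
    proof (rule truncated_moment_step[OF _ Suc.prems(1) _ x])
      fix y :: real assume y: "0 < y"
      have "(\<integral>t. complex_of_real (max 0 (t - y) ^ Suc m) * u t \<partial>lborel) = (\<integral>t. complex_of_real (indicator {y<..} t * (t - y) ^ Suc m) * u t \<partial>lborel)"
        by (intro Bochner_Integration.integral_cong) (auto simp: max_def split: split_indicator)
      then show "(\<integral>t. complex_of_real (max 0 (t - y) ^ Suc m) * u t \<partial>lborel) = 0"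
        using Suc.prems(2)[OF y] by simp
    qed measurable
  qed
qed

text \<open>The substitution \<open>v \<mapsto> -1/v\<close> turns this integral into a Beta integral; the powers of \<open>v\<close> cancel.\<close>

lemma inversion_kernel:
  assumes a: "0 < a" and b: "0 < b" and x: "0 < x" "x < t"
  shows "(\<integral>\<^sup>+v. ennreal (indicator {x<..} v * (v - x) powr (b - 1) * v powr (- (a + b))) * ennreal (rk a (v - t)) \<partial>lborel)
    = ennreal (Gamma b / Gamma (a + b) * x powr (- a) * ((t - x) powr (a + b - 1) * t powr (- b)))"
proof -
  note Ga = Gamma_real_pos[OF a] and Gb = Gamma_real_pos[OF b] and Gab = Gamma_real_pos[OF add_pos_pos[OF a b]]
  have t: "0 < t" using x by simp
  define f where "f = (\<lambda>v. (v - x) powr (b - 1) * v powr (- (a + b)) * ((t - v) powr (a - 1) / Gamma a))"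
  define g where "g = (\<lambda>w::real. - 1 / w)"
  define g' where "g' = (\<lambda>w::real. 1 / w ^ 2)"
  let ?A = "- 1 / x" and ?B = "- 1 / t"
  \<comment> \<open>The image of the interval from \<open>x\<close> to \<open>t\<close> under v to
    -1/v has length -\<tau>, and the transformed integral is the convolution of two kernels
    evaluated at \<tau>.\<close>
  define \<tau> where "\<tau> = 1 / t - 1 / x"
  define c where "c = x powr (b - 1) * t powr (a - 1) * Gamma b"
  have [measurable]: "f \<in> borel_measurable borel" unfolding f_def by measurable
  have gA: "g ?A = x" and gB: "g ?B = t" using x t by (auto simp: g_def)
  have AB: "?A \<le> ?B" using x t by (simp add: field_simps)
  have B0: "?B < 0" using t by simp
  have c: "0 \<le> c" using Gb by (simp add: c_def)
  have "(\<integral>\<^sup>+v. ennreal (indicator {x<..} v * (v - x) powr (b - 1) * v powr (- (a + b))) * ennreal (rk a (v - t)) \<partial>lborel)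
      = (\<integral>\<^sup>+v. ennreal (f v * indicator {g ?A..g ?B} v) \<partial>lborel)"
    unfolding gA gB
  proof (intro nn_integral_cong)
    fix v
    consider "v \<le> x" | "t \<le> v" | "x < v" "v < t" by linarith
    then show "ennreal (indicator {x<..} v * (v - x) powr (b - 1) * v powr (- (a + b))) * ennreal (rk a (v - t)) = ennreal (f v * indicator {x..t} v)"
    proof cases
      case 1
      then show ?thesis by (cases "v = x") (auto simp: f_def)
    next
      case 2
      then show ?thesis using x by (cases "v = t") (auto simp: f_def rk_def)
    next
      case 3
      then show ?thesis
        using x Ga by (simp add: f_def rk_def ennreal_mult[symmetric])
    qed
  qed
  also have "\<dots> = (\<integral>\<^sup>+w. ennreal (f (g w) * g' w * indicator {?A..?B} w) \<partial>lborel)"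
  proof (rule nn_integral_substitution)
    show "set_borel_measurable borel {g ?A..g ?B} f" unfolding set_borel_measurable_def by measurable
    show "(g has_real_derivative g' w) (at w)" if "w \<in> {?A..?B}" for w
      using that B0 unfolding g_def g'_def
      by (auto intro!: derivative_eq_intros simp: power2_eq_square)
    show "continuous_on {?A..?B} g'"
      using B0 unfolding g'_def by (intro continuous_intros) auto
  qed (use AB in \<open>auto simp: g'_def\<close>)
  also have "\<dots> = (\<integral>\<^sup>+w. ennreal c * (\<lambda>u. ennreal (rk b u) * ennreal (rk a (\<tau> - u))) (- 1 / x - w) \<partial>lborel)"
  proof (intro nn_integral_cong)
    fix w
    consider "w < ?A" | "w = ?A" | "w = ?B" | "?B < w" | "?A < w" "w < ?B" by linarith
    then show "ennreal (f (g w) * g' w * indicator {?A..?B} w) = ennreal c * (\<lambda>u. ennreal (rk b u) * ennreal (rk a (\<tau> - u))) (- 1 / x - w)"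
    proof cases
      case 1
      then show ?thesis by (simp add: rk_def)
    next
      case 2
      then show ?thesis using gA by (simp add: rk_def f_def)
    next
      case 3
      then show ?thesis using gB by (simp add: rk_def f_def \<tau>_def)
    next
      case 4
      then show ?thesis by (simp add: rk_def \<tau>_def)
    next
      case 5
      define v where "v = g w"
      have w: "w < 0" using 5(2) B0 by (rule less_trans)
      have v: "0 < v" using w by (simp add: v_def g_def field_simps)
      have wv: "w = - 1 / v" using w by (simp add: v_def g_def)
      have pos1: "0 < 1 / x + w" using 5 by (simp add: field_simps)
      have pos2: "0 < - 1 / t - w" using 5 by simp
      have e1: "v - x = v * (x * (1 / x + w))" using x v by (simp add: wv field_simps)
      have e2: "t - v = v * (t * (- 1 / t - w))" using t v by (simp add: wv field_simps)
      have p1: "(v - x) powr (b - 1) = v powr (b - 1) * (x powr (b - 1) * (1 / x + w) powr (b - 1))"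
        unfolding e1 using v x pos1 by (simp add: powr_mult)
      have p2: "(t - v) powr (a - 1) = v powr (a - 1) * (t powr (a - 1) * (- 1 / t - w) powr (a - 1))"
        unfolding e2 using v t pos2 by (simp add: powr_mult)
      have p3: "g' w = v powr 2" using v by (simp add: g'_def wv power2_eq_square)
      have p4: "v powr (b - 1) * v powr (- (a + b)) * v powr (a - 1) * v powr 2 = 1"
        using v by (simp only: powr_add[symmetric]) simp
      have "f v * g' w = (v powr (b - 1) * v powr (- (a + b)) * v powr (a - 1) * v powr 2) *
         (x powr (b - 1) * (1 / x + w) powr (b - 1) * (t powr (a - 1) * (- 1 / t - w) powr (a - 1)) / Gamma a)"
        unfolding f_def p1 p2 p3 by simp
      also have "\<dots> = c * (rk b (- 1 / x - w) * rk a (\<tau> - (- 1 / x - w)))"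
      proof -
        have "rk b (- 1 / x - w) = (1 / x + w) powr (b - 1) / Gamma b"
          using pos1 by (simp add: rk_def add.commute)
        moreover have "rk a (\<tau> - (- 1 / x - w)) = (- 1 / t - w) powr (a - 1) / Gamma a"
          using pos2 by (simp add: rk_def \<tau>_def)
        ultimately show ?thesis unfolding p4 using Gb by (simp add: c_def)
      qed
      finally show ?thesis
        using 5 c rk_nonneg[OF a] rk_nonneg[OF b] by (simp add: v_def[symmetric] ennreal_mult[symmetric])
    qed
  qed
  also have "\<dots> = ennreal c * (\<integral>\<^sup>+w. (\<lambda>u. ennreal (rk b u) * ennreal (rk a (\<tau> - u))) (- 1 / x - w) \<partial>lborel)"
    by (rule nn_integral_cmult) measurable
  also have "(\<integral>\<^sup>+w. (\<lambda>u. ennreal (rk b u) * ennreal (rk a (\<tau> - u))) (- 1 / x - w) \<partial>lborel) = (\<integral>\<^sup>+u. ennreal (rk b u) * ennreal (rk a (\<tau> - u)) \<partial>lborel)"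
    by (rule nn_integral_lborel_shift(2)) measurable
  also have "\<dots> = ennreal (rk (a + b) \<tau>)" by (rule nn_integral_rk_rk[OF a b])
  also have "ennreal c * ennreal (rk (a + b) \<tau>) = ennreal (c * rk (a + b) \<tau>)"
    using c by (simp add: ennreal_mult')
  also have "c * rk (a + b) \<tau> = Gamma b / Gamma (a + b) * x powr (- a) * ((t - x) powr (a + b - 1) * t powr (- b))"
  proof -
    have "\<tau> < 0" using x t by (simp add: \<tau>_def field_simps)
    have "- \<tau> = (t - x) / (x * t)" using x t by (simp add: \<tau>_def field_simps)
    then have "(- \<tau>) powr (a + b - 1) = (t - x) powr (a + b - 1) / (x powr (a + b - 1) * t powr (a + b - 1))"
      using x t by (simp add: powr_divide powr_mult)
    moreover have "x powr (b - 1) / x powr (a + b - 1) = x powr (- a)" "t powr (a - 1) / t powr (a + b - 1) = t powr (- b)"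
      by (simp_all flip: powr_diff)
    moreover have "c * rk (a + b) \<tau> = Gamma b * (x powr (b - 1) * t powr (a - 1) * (- \<tau>) powr (a + b - 1)) / Gamma (a + b)"
      using \<open>\<tau> < 0\<close> by (simp add: rk_def c_def)
    moreover have "x powr (b - 1) * t powr (a - 1) * ((t - x) powr (a + b - 1) / (x powr (a + b - 1) * t powr (a + b - 1)))
      = (x powr (b - 1) / x powr (a + b - 1)) * ((t - x) powr (a + b - 1) * (t powr (a - 1) / t powr (a + b - 1)))"
      by simp
    ultimately show ?thesis by (simp only:) simp
  qed
  finally show ?thesis .
qed

text \<open>\<open>K\<close> is replaced by the Weyl integral of its derivative, the integrals are
  interchanged, and the inner one is \<open>inversion_kernel\<close>. One side sees only
  \<open>K\<close>, the other only its Weyl derivative, so limits of the two can be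
  compared.\<close>

lemma weyl_inversion:
  assumes K: "K \<in> schwartz" and a: "0 < a" and b1: "1 \<le> b" and x: "0 < x"
  shows "(\<integral>v. complex_of_real (indicator {x<..} v * (v - x) powr (b - 1) * v powr (- (a + b))) * K v \<partial>lborel)
    = complex_of_real (Gamma b / Gamma (a + b) * x powr (- a)) *
      (\<integral>t. complex_of_real (indicator {x<..} t * ((t - x) powr (a + b - 1) * t powr (- b))) * weyl_plus a K t \<partial>lborel)"
proof -
  have b: "0 < b" using b1 by simp
  note Gb = Gamma_real_pos[OF b] and Gab = Gamma_real_pos[OF add_pos_pos[OF a b]]
  define F where "F = weyl_plus a K"
  have [measurable]: "F \<in> borel_measurable borel" unfolding F_def by (rule weyl_plus_measurable[OF K a])
  define k where "k = (\<lambda>v. indicator {x<..} v * (v - x) powr (b - 1) * v powr (- (a + b)))"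
  have [measurable]: "k \<in> borel_measurable borel" unfolding k_def by measurable
  have k: "0 \<le> k v" for v by (simp add: k_def)
  define c where "c = Gamma b / Gamma (a + b) * x powr (- a)"
  have c: "0 \<le> c" using Gb Gab by (simp add: c_def)
  define j where "j = (\<lambda>t. indicator {x<..} t * ((t - x) powr (a + b - 1) * t powr (- b)))"
  have j: "0 \<le> j t" for t by (simp add: j_def)
  have kj: "(\<integral>\<^sup>+v. ennreal (k v) * ennreal (rk a (v - t)) \<partial>lborel) = ennreal (c * j t)" for t
  proof (cases "x < t")
    case True
    then show ?thesis using inversion_kernel[OF a b x True] by (simp add: k_def c_def j_def)
  next
    case False
    have "(\<integral>\<^sup>+v. ennreal (k v) * ennreal (rk a (v - t)) \<partial>lborel) = (\<integral>\<^sup>+(v::real). 0 \<partial>lborel)"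
      using False by (intro nn_integral_cong) (auto simp: k_def rk_def split: split_indicator)
    then show ?thesis using False by (simp add: j_def)
  qed
  have kj': "(\<integral>v. complex_of_real (k v) * kap a (v - t) \<partial>lborel) = complex_of_real (c * j t)" for t
  proof -
    have "has_bochner_integral lborel (\<lambda>v. k v * rk a (v - t)) (c * j t)"
      using kj[of t] k rk_nonneg[OF a] c j by (intro has_bochner_integral_nn_integral) (auto simp: ennreal_mult)
    then have "(\<integral>v. complex_of_real (k v * rk a (v - t)) \<partial>lborel) = complex_of_real (c * j t)"
      by (simp add: has_bochner_integral_iff del: of_real_mult)
    then show ?thesis by simp
  qed
  define Q where "Q = (\<lambda>t v. complex_of_real (k v) * kap a (v - t) * F t)"
  have Q: "integrable (lborel \<Otimes>\<^sub>M lborel) (case_prod Q)"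
  proof (rule integrableI_bounded)
    show "case_prod Q \<in> borel_measurable (lborel \<Otimes>\<^sub>M lborel)" unfolding Q_def by measurable
    have "(\<integral>\<^sup>+z. ennreal (norm (case_prod Q z)) \<partial>(lborel \<Otimes>\<^sub>M lborel)) = (\<integral>\<^sup>+t. \<integral>\<^sup>+v. ennreal (norm (Q t v)) \<partial>lborel \<partial>lborel)"
      unfolding Q_def by (subst lborel.nn_integral_fst[symmetric]) auto
    also have "\<dots> = (\<integral>\<^sup>+t. \<integral>\<^sup>+v. ennreal (norm (F t)) * (ennreal (k v) * ennreal (rk a (v - t))) \<partial>lborel \<partial>lborel)"
      unfolding Q_def using k rk_nonneg[OF a] by (simp add: norm_mult ennreal_mult mult_ac)
    also have "\<dots> = (\<integral>\<^sup>+t. ennreal (norm (F t)) * ennreal (c * j t) \<partial>lborel)"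
      by (simp add: nn_integral_cmult kj)
    \<comment> \<open>For t > x the kernel is at most t^a / x, so the weighted 1-norm of
      \<open>K\<close> gives absolute convergence.\<close>
    also have "\<dots> \<le> (\<integral>\<^sup>+t. ennreal (c / x) * wpos a F t \<partial>lborel)"
    proof (intro nn_integral_mono)
      fix t
      show "ennreal (norm (F t)) * ennreal (c * j t) \<le> ennreal (c / x) * wpos a F t"
      proof (cases "x < t")
        case True
        have "(t - x) powr (a + b - 1) * t powr (- b) \<le> t powr (a - 1) * (t / x)"
        proof -
          have "(t - x) powr (a + b - 1) \<le> t powr (a + b - 1)" using True x a b1 by (intro powr_mono2) auto
          then have "(t - x) powr (a + b - 1) * t powr (- b) \<le> t powr (a + b - 1) * t powr (- b)"
            by (intro mult_right_mono) auto
          also have "\<dots> = t powr (a - 1) * 1" by (simp add: powr_add[symmetric])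
          also have "\<dots> \<le> t powr (a - 1) * (t / x)" using True x by (intro mult_left_mono) auto
          finally show ?thesis .
        qed
        also have "\<dots> = 1 / x * t powr a" using True x powr_add[of t "a - 1" 1] by simp
        finally have "c * ((t - x) powr (a + b - 1) * t powr (- b)) \<le> c * (1 / x * t powr a)"
          using c by (intro mult_left_mono) auto
        then have "norm (F t) * (c * j t) \<le> norm (F t) * (c * (1 / x * t powr a))"
          using True by (intro mult_left_mono[OF _ norm_ge_zero]) (simp add: j_def)
        then have "ennreal (norm (F t) * (c * j t)) \<le> ennreal (c / x * (t powr a * norm (F t)))"
          by (intro ennreal_leI) (simp add: mult_ac)
        then show ?thesis using True x c j by (simp add: wpos_def ennreal_mult[symmetric])
      qed (simp add: j_def)
    qed
    also have "\<dots> = ennreal (c / x) * wpos_int a 1 K"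
      unfolding wpos_int_def F_def[symmetric] by (simp add: nn_integral_cmult)
    also have "\<dots> < \<infinity>" using wpos_int_finite[OF K a order_refl] by (simp add: ennreal_mult_less_top)
    finally show "(\<integral>\<^sup>+z. ennreal (norm (case_prod Q z)) \<partial>(lborel \<Otimes>\<^sub>M lborel)) < \<infinity>" .
  qed
  have "K v = (\<integral>t. kap a (v - t) * F t \<partial>lborel)" for v
    using fun_cong[OF weyl_plus_inverse[OF K a], of v]
    unfolding F_def[symmetric] conv_commute[of F] by (simp add: conv_def)
  then have "(\<integral>v. complex_of_real (k v) * K v \<partial>lborel) = (\<integral>v. \<integral>t. Q t v \<partial>lborel \<partial>lborel)"
    by (simp add: Q_def mult.assoc)
  also have "\<dots> = (\<integral>t. \<integral>v. Q t v \<partial>lborel \<partial>lborel)" by (rule lborel_pair.Fubini_integral[OF Q])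
  also have "\<dots> = (\<integral>t. complex_of_real c * (complex_of_real (j t) * F t) \<partial>lborel)"
  proof (intro Bochner_Integration.integral_cong refl)
    fix t
    show "(\<integral>v. Q t v \<partial>lborel) = complex_of_real c * (complex_of_real (j t) * F t)"
      unfolding Q_def integral_mult_left_zero kj' by simp
  qed
  also have "\<dots> = complex_of_real c * (\<integral>t. complex_of_real (j t) * F t \<partial>lborel)"
    by (rule integral_mult_right_zero)
  finally show ?thesis unfolding k_def c_def j_def F_def .
qed

section \<open>Weak limits of Weyl derivatives and closability\<close>

lemma nn_integral_one_plus_powr:
  assumes q: "1 < q"
  shows "(\<integral>\<^sup>+t. ennreal ((1 + \<bar>t\<bar>) powr (- q)) \<partial>lborel) \<le> ennreal (2 / (q - 1))"
proof -
  define h where "h = (\<lambda>t. ennreal (t powr (- q)) * indicator {1..} t)"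
  have [measurable]: "h \<in> borel_measurable borel" unfolding h_def by measurable
  have "((\<lambda>x. x powr (- q)) has_integral - (1 powr (- q + 1)) / (- q + 1)) {1..}"
    using q by (intro has_integral_powr_to_inf) auto
  then have "((\<lambda>x. x powr (- q)) has_integral 1 / (q - 1)) {1..}"
    using q by (simp add: minus_divide_right)
  then have I: "(\<integral>\<^sup>+t. h t \<partial>lborel) = ennreal (1 / (q - 1))"
    unfolding h_def by (intro nn_integral_has_integral_lebesgue') auto
  have "(\<integral>\<^sup>+t. ennreal ((1 + \<bar>t\<bar>) powr (- q)) \<partial>lborel) \<le> (\<integral>\<^sup>+t. h (t - (- 1)) + h (1 - t) \<partial>lborel)"
    by (intro nn_integral_mono) (auto simp: h_def add.commute split: split_indicator)
  also have "\<dots> = (\<integral>\<^sup>+t. h (t - (- 1)) \<partial>lborel) + (\<integral>\<^sup>+t. h (1 - t) \<partial>lborel)"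
    by (rule nn_integral_add) measurable
  also have "\<dots> = ennreal (1 / (q - 1)) + ennreal (1 / (q - 1))"
    by (simp only: nn_integral_lborel_shift[OF \<open>h \<in> borel_measurable borel\<close>] I)
  also have "\<dots> = ennreal (2 / (q - 1))"
    using q by (simp add: ennreal_plus[symmetric] del: ennreal_plus)
  finally show ?thesis .
qed

text \<open>Hoelder's inequality against 1/(1 + |t|), which lies in L^q for the conjugate exponent
  \<open>q\<close>. It is Jensen's inequality with weight (1 + |t|)^(-q), because (q - 1) p =
  q.\<close>

lemma weighted_L1_le_lpn:
  assumes p: "1 < p"
  shows "\<exists>C\<ge>0. \<forall>u. in_Lp p u \<longrightarrow> (\<integral>\<^sup>+t. ennreal (norm (u t) / (1 + \<bar>t\<bar>)) \<partial>lborel) \<le> ennreal (C * lpn p u)"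
proof -
  define q where "q = p / (p - 1)"
  have q: "1 < q" "(q - 1) * p = q" using p by (auto simp: q_def field_simps)
  define m where "m = 2 / (q - 1)"
  have m: "0 \<le> m" using q by (simp add: m_def)
  define C where "C = m powr ((p - 1) / p)"
  have "(\<integral>\<^sup>+t. ennreal (norm (u t) / (1 + \<bar>t\<bar>)) \<partial>lborel) \<le> ennreal (C * lpn p u)" if u: "in_Lp p u" for u
  proof -
    note [measurable] = in_Lp_measurable[OF u]
    let ?w = "\<lambda>t::real. ennreal ((1 + \<bar>t\<bar>) powr (- q))"
    let ?v = "\<lambda>t. ennreal (norm (u t) * (1 + \<bar>t\<bar>) powr (q - 1))"
    let ?S = "\<integral>\<^sup>+t. ennreal (norm (u t) / (1 + \<bar>t\<bar>)) \<partial>lborel"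
    have wv: "?w t * ?v t = ennreal (norm (u t) / (1 + \<bar>t\<bar>))" for t
    proof -
      have "(1 + \<bar>t\<bar>) powr (- q) * (norm (u t) * (1 + \<bar>t\<bar>) powr (q - 1)) = norm (u t) * (1 + \<bar>t\<bar>) powr (- 1)"
        by (simp add: powr_add[symmetric] mult.left_commute)
      also have "\<dots> = norm (u t) / (1 + \<bar>t\<bar>)" by (simp add: powr_minus divide_inverse)
      finally show ?thesis by (simp add: ennreal_mult[symmetric])
    qed
    have wp: "?w t * epow (?v t) p = epow (ennreal (norm (u t))) p" for t
    proof -
      have "(1 + \<bar>t\<bar>) powr (- q) * (norm (u t) * (1 + \<bar>t\<bar>) powr (q - 1)) powr p
          = norm (u t) powr p * ((1 + \<bar>t\<bar>) powr (- q) * (1 + \<bar>t\<bar>) powr ((q - 1) * p))"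
        by (simp add: powr_mult powr_powr)
      also have "\<dots> = norm (u t) powr p" unfolding q(2) by (simp add: powr_add[symmetric])
      finally show ?thesis by (simp add: ennreal_mult[symmetric])
    qed
    have "epow ?S p = epow (\<integral>\<^sup>+t. ?w t * ?v t \<partial>lborel) p" unfolding wv ..
    also have "\<dots> \<le> ennreal (m powr (p - 1)) * (\<integral>\<^sup>+t. ?w t * epow (?v t) p \<partial>lborel)"
      using p m nn_integral_one_plus_powr[OF q(1)] by (intro epow_nn_integral_le) (auto simp: m_def)
    also have "\<dots> = ennreal (m powr (p - 1)) * ennreal (lpn p u powr p)"
      unfolding wp using p by (subst nn_integral_eq_lpn[OF u]) auto
    also have "\<dots> = ennreal ((C * lpn p u) powr p)"
      using p by (simp add: C_def powr_mult powr_powr ennreal_mult)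
    finally have "epow (epow ?S p) (1 / p) \<le> epow (ennreal ((C * lpn p u) powr p)) (1 / p)"
      using p by (intro epow_mono) auto
    then show ?thesis using p by (simp add: epow_powr powr_powr C_def)
  qed
  moreover have "0 \<le> C" by (simp add: C_def)
  ultimately show ?thesis by blast
qed

text \<open>By \<open>weyl_inversion\<close> the pairings of the Weyl derivatives with truncated
  powers are pairings of \<open>K n\<close> with a kernel bounded by a multiple of 1/(1 + |v|), and
  these tend to 0. They also tend to the pairings of \<open>Psi\<close>. Weighted L^1 convergence
  suffices for this, as the test functions have the same decay.\<close>

lemma weyl_limit_zero:
  fixes K :: "nat \<Rightarrow> real \<Rightarrow> complex" and Psi :: "real \<Rightarrow> complex"
  assumes a: "0 < a" and p: "1 < p" and K: "\<And>n. K n \<in> schwartz" and K0: "(\<lambda>n. lpn p (K n)) \<longlonglongrightarrow> 0"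
    and [measurable]: "Psi \<in> borel_measurable borel"
    and lim: "(\<lambda>n. \<integral>\<^sup>+t. indicator {0<..} t *
       ennreal (norm (complex_of_real (t powr a) * weyl_plus a (K n) t - Psi t) / (1 + \<bar>t\<bar>)) \<partial>lborel) \<longlonglongrightarrow> 0"
  shows "AE t in lborel. 0 < t \<longrightarrow> Psi t = 0"
proof -
  \<comment> \<open>\<open>a + b = N\<close> is an integer, so the kernel (t - x)^(a + b - 1) is a
    polynomial of degree \<open>m\<close>, equal to N - 1. The extra 1 in \<open>N\<close> ensures b
    \<ge> 1.\<close>
  define N where "N = Suc (nat \<lceil>a\<rceil>)"
  define m where "m = nat \<lceil>a\<rceil>"
  define b where "b = real N - a"
  have b: "1 \<le> b" using a unfolding b_def N_def by linarith
  have ab: "a + b = real N" by (simp add: b_def)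
  note [measurable] = weyl_plus_measurable[OF K a] schwartz_measurable[OF K]
  define u where "u = (\<lambda>t. complex_of_real (indicator {0<..} t * t powr (- real N)) * Psi t)"
  have [measurable]: "u \<in> borel_measurable borel" unfolding u_def by measurable
  have inv: "1 / t \<le> (1 + x) / x * (1 / (1 + \<bar>t\<bar>))" if "0 < x" "x < t" for x t :: real
  proof -
    have "x * (1 + t) \<le> t * (1 + x)" using that by (simp add: algebra_simps)
    then show ?thesis using that by (simp add: frac_le_eq divide_le_eq le_divide_eq mult_ac)
  qed
  have tm: "t ^ m * t powr (- real N) = 1 / t" if "0 < t" for t
  proof -
    have "t ^ m * t powr (- real N) = t powr (real m + - real N)"
      using that by (simp only: powr_add powr_realpow)
    also have "real m + - real N = - 1" by (simp add: m_def N_def)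
    finally show ?thesis using that by (simp add: powr_minus divide_inverse)
  qed
  have PsiI: "(\<integral>\<^sup>+t. indicator {0<..} t * ennreal (norm (Psi t) / (1 + \<bar>t\<bar>)) \<partial>lborel) < top"
  proof -
    have "\<forall>\<^sub>F n in sequentially. (\<integral>\<^sup>+t. indicator {0<..} t *
       ennreal (norm (complex_of_real (t powr a) * weyl_plus a (K n) t - Psi t) / (1 + \<bar>t\<bar>)) \<partial>lborel) < 1"
      using lim by (intro order_tendstoD) auto
    then obtain n where n: "(\<integral>\<^sup>+t. indicator {0<..} t *
       ennreal (norm (complex_of_real (t powr a) * weyl_plus a (K n) t - Psi t) / (1 + \<bar>t\<bar>)) \<partial>lborel) < 1"
      by (auto simp: eventually_sequentially)
    have "(\<integral>\<^sup>+t. indicator {0<..} t * ennreal (norm (Psi t) / (1 + \<bar>t\<bar>)) \<partial>lborel) \<le>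
       (\<integral>\<^sup>+t. indicator {0<..} t * ennreal (norm (complex_of_real (t powr a) * weyl_plus a (K n) t - Psi t) / (1 + \<bar>t\<bar>))
         + wpos a (weyl_plus a (K n)) t \<partial>lborel)"
    proof (intro nn_integral_mono)
      fix t
      show "indicator {0<..} t * ennreal (norm (Psi t) / (1 + \<bar>t\<bar>)) \<le>
         indicator {0<..} t * ennreal (norm (complex_of_real (t powr a) * weyl_plus a (K n) t - Psi t) / (1 + \<bar>t\<bar>))
         + wpos a (weyl_plus a (K n)) t"
      proof (cases "0 < t")
        case True
        let ?z = "complex_of_real (t powr a) * weyl_plus a (K n) t"
        have "norm (Psi t) \<le> norm (?z - Psi t) + norm ?z"
          by (metis norm_minus_commute norm_triangle_sub add.commute)
        then have "norm (Psi t) / (1 + \<bar>t\<bar>) \<le> norm (?z - Psi t) / (1 + \<bar>t\<bar>) + norm ?z / (1 + \<bar>t\<bar>)"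
          by (simp add: add_divide_distrib[symmetric] divide_right_mono)
        also have "norm ?z / (1 + \<bar>t\<bar>) \<le> norm ?z / 1" by (intro divide_left_mono) auto
        finally have "ennreal (norm (Psi t) / (1 + \<bar>t\<bar>)) \<le> ennreal (norm (?z - Psi t) / (1 + \<bar>t\<bar>) + norm ?z)"
          by (intro ennreal_leI) simp
        then show ?thesis using True by (simp add: wpos_def norm_mult)
      qed simp
    qed
    also have "\<dots> = (\<integral>\<^sup>+t. indicator {0<..} t * ennreal (norm (complex_of_real (t powr a) * weyl_plus a (K n) t - Psi t) / (1 + \<bar>t\<bar>)) \<partial>lborel)
        + wpos_int a 1 (K n)"
      unfolding wpos_int_def epow_one by (rule nn_integral_add) measurable
    also have "\<dots> < top"
      using n wpos_int_finite[OF K a order_refl, of n] by (auto intro: less_trans)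
    finally show ?thesis .
  qed
  have "AE t in lborel. 0 < t \<longrightarrow> u t = 0"
  proof (rule truncated_moments_zero[where m = m])
    fix x :: real assume x: "0 < x"
    \<comment> \<open>For t > x the ratio of 1/t to 1/(1 + |t|) is at most this number.\<close>
    define cx where "cx = (1 + x) / x"
    have cx: "0 \<le> cx" using x by (simp add: cx_def)
    show "integrable lborel (\<lambda>t. indicator {x<..} t * t ^ m * norm (u t))"
    proof (rule integrableI_bounded)
      have "(\<integral>\<^sup>+t. ennreal (norm (indicator {x<..} t * t ^ m * norm (u t))) \<partial>lborel) \<le>
         (\<integral>\<^sup>+t. ennreal cx * (indicator {0<..} t * ennreal (norm (Psi t) / (1 + \<bar>t\<bar>))) \<partial>lborel)"
      proof (intro nn_integral_mono)
        fix t
        show "ennreal (norm (indicator {x<..} t * t ^ m * norm (u t))) \<le> ennreal cx * (indicator {0<..} t * ennreal (norm (Psi t) / (1 + \<bar>t\<bar>)))"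
        proof (cases "x < t")
          case True
          then have "norm (indicator {x<..} t * t ^ m * norm (u t)) = (t ^ m * t powr (- real N)) * norm (Psi t)"
            using x by (simp add: u_def norm_mult abs_mult)
          also have "\<dots> \<le> (cx * (1 / (1 + \<bar>t\<bar>))) * norm (Psi t)"
            using True x inv[OF x True] tm[of t] by (intro mult_right_mono) (auto simp: cx_def)
          finally have "ennreal (norm (indicator {x<..} t * t ^ m * norm (u t))) \<le> ennreal (cx * (norm (Psi t) / (1 + \<bar>t\<bar>)))"
            by (intro ennreal_leI) simp
          then show ?thesis using True x cx by (simp add: ennreal_mult del: times_divide_eq_right)
        qed simp
      qed
      also have "\<dots> < \<infinity>" using PsiI by (simp add: nn_integral_cmult ennreal_mult_less_top)
      finally show "(\<integral>\<^sup>+t. ennreal (norm (indicator {x<..} t * t ^ m * norm (u t))) \<partial>lborel) < \<infinity>" .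
    qed measurable
    \<comment> \<open>The test function for \<open>Psi\<close>; multiplied by
      \<open>t powr a\<close> it becomes the kernel on the right of
      \<open>weyl_inversion\<close>.\<close>
    define w where "w = (\<lambda>t. indicator {x<..} t * ((t - x) ^ m * t powr (- real N)))"
    have [measurable]: "w \<in> borel_measurable borel" unfolding w_def by measurable
    have w: "0 \<le> w t" "w t \<le> cx * (indicator {0<..} t / (1 + \<bar>t\<bar>))" for t
    proof -
      show "0 \<le> w t" by (cases "x < t") (auto simp: w_def)
      show "w t \<le> cx * (indicator {0<..} t / (1 + \<bar>t\<bar>))"
      proof (cases "x < t")
        case True
        then have "(t - x) ^ m * t powr (- real N) \<le> t ^ m * t powr (- real N)"
          using x by (intro mult_right_mono power_mono) auto
        also have "\<dots> \<le> cx * (1 / (1 + \<bar>t\<bar>))" using True x inv[OF x True] tm[of t] by (simp add: cx_def)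
        finally show ?thesis using True x by (simp add: w_def)
      qed (simp add: w_def cx)
    qed
    let ?z = "\<lambda>n t. complex_of_real (t powr a) * weyl_plus a (K n) t"
    define I where "I = (\<integral>t. complex_of_real (w t) * Psi t \<partial>lborel)"
    define J where "J = (\<lambda>n. \<integral>t. complex_of_real (w t) * ?z n t \<partial>lborel)"
    have ipsi: "integrable lborel (\<lambda>t. complex_of_real (w t) * Psi t)"
    proof (rule integrableI_bounded)
      have "(\<integral>\<^sup>+t. ennreal (norm (complex_of_real (w t) * Psi t)) \<partial>lborel) \<le> (\<integral>\<^sup>+t. ennreal cx * (indicator {0<..} t * ennreal (norm (Psi t) / (1 + \<bar>t\<bar>))) \<partial>lborel)"
      proof (intro nn_integral_mono)
        fix t
        have "w t * norm (Psi t) \<le> cx * (indicator {0<..} t / (1 + \<bar>t\<bar>)) * norm (Psi t)" by (intro mult_right_mono w) simp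
        then have "ennreal (w t * norm (Psi t)) \<le> ennreal (cx * (indicator {0<..} t * (norm (Psi t) / (1 + \<bar>t\<bar>))))"
          by (intro ennreal_leI) simp
        then show "ennreal (norm (complex_of_real (w t) * Psi t)) \<le> ennreal cx * (indicator {0<..} t * ennreal (norm (Psi t) / (1 + \<bar>t\<bar>)))"
          using cx w(1)[of t] by (simp add: norm_mult ennreal_mult ennreal_indicator del: times_divide_eq_right)
      qed
      also have "\<dots> < \<infinity>" using PsiI by (simp add: nn_integral_cmult ennreal_mult_less_top)
      finally show "(\<integral>\<^sup>+t. ennreal (norm (complex_of_real (w t) * Psi t)) \<partial>lborel) < \<infinity>" .
    qed measurable
    have iz: "integrable lborel (\<lambda>t. complex_of_real (w t) * ?z n t)" for n
    proof (rule integrableI_bounded)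
      have "(\<integral>\<^sup>+t. ennreal (norm (complex_of_real (w t) * ?z n t)) \<partial>lborel) \<le> (\<integral>\<^sup>+t. ennreal cx * wpos a (weyl_plus a (K n)) t \<partial>lborel)"
      proof (intro nn_integral_mono)
        fix t
        have "cx * (indicator {0<..} t / (1 + \<bar>t\<bar>)) \<le> cx * indicator {0<..} t"
          using cx by (intro mult_left_mono) (auto split: split_indicator)
        with w(2)[of t] have "w t \<le> cx * indicator {0<..} t" by (rule order_trans)
        then have "w t * norm (?z n t) \<le> cx * indicator {0<..} t * norm (?z n t)" by (intro mult_right_mono) auto
        then have "ennreal (w t * norm (?z n t)) \<le> ennreal (cx * (norm (?z n t) * indicator {0<..} t))"
          by (intro ennreal_leI) (simp add: mult_ac)
        then show "ennreal (norm (complex_of_real (w t) * ?z n t)) \<le> ennreal cx * wpos a (weyl_plus a (K n)) t"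
          using cx w(1)[of t] by (simp add: norm_mult ennreal_mult ennreal_indicator wpos_def)
      qed
      also have "\<dots> = ennreal cx * wpos_int a 1 (K n)" by (simp add: wpos_int_def nn_integral_cmult)
      also have "\<dots> < \<infinity>" using wpos_int_finite[OF K a order_refl, of n] by (simp add: ennreal_mult_less_top)
      finally show "(\<integral>\<^sup>+t. ennreal (norm (complex_of_real (w t) * ?z n t)) \<partial>lborel) < \<infinity>" .
    qed measurable
    have "J \<longlonglongrightarrow> I"
    proof -
      define e where "e = (\<lambda>n. \<integral>\<^sup>+t. indicator {0<..} t * ennreal (norm (?z n t - Psi t) / (1 + \<bar>t\<bar>)) \<partial>lborel)"
      have le: "ennreal (norm (J n - I)) \<le> ennreal cx * e n" for n
      proof -
        have "J n - I = (\<integral>t. complex_of_real (w t) * ?z n t - complex_of_real (w t) * Psi t \<partial>lborel)"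
          unfolding J_def I_def using iz[of n] ipsi by (rule Bochner_Integration.integral_diff[symmetric])
        also have "\<dots> = (\<integral>t. complex_of_real (w t) * (?z n t - Psi t) \<partial>lborel)"
          by (simp only: right_diff_distrib)
        finally have "ennreal (norm (J n - I)) \<le> (\<integral>\<^sup>+t. ennreal (norm (complex_of_real (w t) * (?z n t - Psi t))) \<partial>lborel)"
          using norm_integral_le_nn_integral by (simp only:)
        also have "\<dots> \<le> (\<integral>\<^sup>+t. ennreal cx * (indicator {0<..} t * ennreal (norm (?z n t - Psi t) / (1 + \<bar>t\<bar>))) \<partial>lborel)"
        proof (intro nn_integral_mono)
          fix t
          have "w t * norm (?z n t - Psi t) \<le> cx * (indicator {0<..} t / (1 + \<bar>t\<bar>)) * norm (?z n t - Psi t)" by (intro mult_right_mono w) simp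
          then have "ennreal (w t * norm (?z n t - Psi t)) \<le> ennreal (cx * (indicator {0<..} t * (norm (?z n t - Psi t) / (1 + \<bar>t\<bar>))))"
            by (intro ennreal_leI) simp
          then show "ennreal (norm (complex_of_real (w t) * (?z n t - Psi t))) \<le> ennreal cx * (indicator {0<..} t * ennreal (norm (?z n t - Psi t) / (1 + \<bar>t\<bar>)))"
            using cx w(1)[of t] by (simp add: norm_mult ennreal_mult ennreal_indicator del: times_divide_eq_right)
        qed
        also have "\<dots> = ennreal cx * e n" unfolding e_def by (rule nn_integral_cmult) measurable
        finally show ?thesis .
      qed
      have e0: "(\<lambda>n. ennreal cx * e n) \<longlonglongrightarrow> ennreal cx * 0"
        using lim unfolding e_def by (intro ennreal_tendsto_cmult) (rule ennreal_less_top)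
      have "(\<lambda>n. ennreal (norm (J n - I))) \<longlonglongrightarrow> ennreal 0"
      proof (rule tendsto_sandwich)
        show "\<forall>\<^sub>F n in sequentially. ennreal (norm (J n - I)) \<le> ennreal cx * e n"
          by (rule always_eventually) (rule allI, rule le)
        show "\<forall>\<^sub>F n in sequentially. 0 \<le> ennreal (norm (J n - I))" by simp
        show "(\<lambda>n. 0) \<longlonglongrightarrow> ennreal 0" by simp
        show "(\<lambda>n. ennreal cx * e n) \<longlonglongrightarrow> ennreal 0" using e0 by simp
      qed
      then have "(\<lambda>n. norm (J n - I)) \<longlonglongrightarrow> 0"
        by (subst (asm) tendsto_ennreal_iff) auto
      then show ?thesis by (simp add: tendsto_norm_zero_iff LIM_zero_iff)
    qed
    moreover have "J \<longlonglongrightarrow> 0"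
    proof -
      obtain C where C: "0 \<le> C" "\<And>u. in_Lp p u \<Longrightarrow> (\<integral>\<^sup>+t. ennreal (norm (u t) / (1 + \<bar>t\<bar>)) \<partial>lborel) \<le> ennreal (C * lpn p u)"
        using weighted_L1_le_lpn[OF p] by blast
      \<comment> \<open>The kernel paired with \<open>K n\<close>. Since b \<ge> 1 it is bounded at
        \<open>x\<close> and at most v^(-a-1), which is within the reach of
        \<open>weighted_L1_le_lpn\<close>.\<close>
      define k where "k = (\<lambda>v. indicator {x<..} v * (v - x) powr (b - 1) * v powr (- (a + b)))"
      define c where "c = Gamma b / Gamma (a + b) * x powr (- a)"
      have c: "0 < c" using a b x by (simp add: c_def Gamma_real_pos)
      have [measurable]: "k \<in> borel_measurable borel" unfolding k_def by measurable
      have k: "0 \<le> k v" "k v \<le> x powr (- a) * cx * (1 / (1 + \<bar>v\<bar>))" for v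
      proof -
        show "0 \<le> k v" by (simp add: k_def)
        show "k v \<le> x powr (- a) * cx * (1 / (1 + \<bar>v\<bar>))"
        proof (cases "x < v")
          case True
          have "(v - x) powr (b - 1) * v powr (- (a + b)) \<le> v powr (b - 1) * v powr (- (a + b))"
            using True x b by (intro mult_right_mono powr_mono2) auto
          also have "\<dots> = v powr (- a) * (1 / v)"
          proof -
            have "v powr (b - 1) * v powr (- (a + b)) = v powr ((b - 1) + - (a + b))" by (rule powr_add[symmetric])
            also have "(b - 1) + - (a + b) = - a + - 1" by simp
            also have "v powr (- a + - 1) = v powr (- a) * v powr (- 1)" by (rule powr_add)
            finally show ?thesis using True x by (simp add: powr_minus divide_inverse)
          qed
          also have "\<dots> \<le> x powr (- a) * (cx * (1 / (1 + \<bar>v\<bar>)))"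
            using True x a inv[OF x True] by (intro mult_mono powr_mono2') (auto simp: cx_def)
          finally show ?thesis using True by (simp add: k_def mult.assoc)
        qed (use cx in \<open>simp add: k_def\<close>)
      qed
      have J: "J n = (1 / complex_of_real c) * (\<integral>v. complex_of_real (k v) * K n v \<partial>lborel)" for n
      proof -
        have "J n = (\<integral>t. complex_of_real (indicator {x<..} t * ((t - x) powr (a + b - 1) * t powr (- b))) * weyl_plus a (K n) t \<partial>lborel)"
          unfolding J_def
        proof (intro Bochner_Integration.integral_cong refl)
          fix t
          have "w t * t powr a = indicator {x<..} t * ((t - x) powr (a + b - 1) * t powr (- b))"
          proof (cases "x < t")
            case True
            have "t powr (- real N) * t powr a = t powr (- b)" by (simp add: powr_add[symmetric] b_def)
            moreover have "(t - x) ^ m = (t - x) powr (a + b - 1)"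
              unfolding ab using True by (simp add: m_def N_def powr_realpow)
            ultimately show ?thesis using True by (simp add: w_def mult.assoc)
          qed (simp add: w_def)
          then show "complex_of_real (w t) * (complex_of_real (t powr a) * weyl_plus a (K n) t)
             = complex_of_real (indicator {x<..} t * ((t - x) powr (a + b - 1) * t powr (- b))) * weyl_plus a (K n) t"
            by (simp only: mult.assoc[symmetric] of_real_mult[symmetric])
        qed
        then show ?thesis
          using weyl_inversion[OF K a b x, of n] c unfolding k_def c_def[symmetric] by simp
      qed
      have "norm (J n) \<le> 1 / c * (x powr (- a) * cx * (C * lpn p (K n)))" for n
      proof -
        have "ennreal (norm (\<integral>v. complex_of_real (k v) * K n v \<partial>lborel)) \<le> (\<integral>\<^sup>+v. ennreal (norm (complex_of_real (k v) * K n v)) \<partial>lborel)"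
          by (rule norm_integral_le_nn_integral)
        also have "\<dots> \<le> (\<integral>\<^sup>+v. ennreal (x powr (- a) * cx) * ennreal (norm (K n v) / (1 + \<bar>v\<bar>)) \<partial>lborel)"
        proof (intro nn_integral_mono)
          fix v
          have "k v * norm (K n v) \<le> x powr (- a) * cx * (1 / (1 + \<bar>v\<bar>)) * norm (K n v)"
            by (intro mult_right_mono k) simp
          then have "ennreal (k v * norm (K n v)) \<le> ennreal (x powr (- a) * cx * (norm (K n v) / (1 + \<bar>v\<bar>)))"
            by (intro ennreal_leI) simp
          then show "ennreal (norm (complex_of_real (k v) * K n v)) \<le> ennreal (x powr (- a) * cx) * ennreal (norm (K n v) / (1 + \<bar>v\<bar>))"
            using cx k(1)[of v] by (simp add: norm_mult ennreal_mult[symmetric])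
        qed
        also have "\<dots> = ennreal (x powr (- a) * cx) * (\<integral>\<^sup>+v. ennreal (norm (K n v) / (1 + \<bar>v\<bar>)) \<partial>lborel)"
          by (rule nn_integral_cmult) measurable
        also have "\<dots> \<le> ennreal (x powr (- a) * cx) * ennreal (C * lpn p (K n))"
          using p by (intro mult_left_mono C schwartz_in_Lp K) auto
        also have "\<dots> = ennreal (x powr (- a) * cx * (C * lpn p (K n)))"
          using cx C by (intro ennreal_mult[symmetric]) auto
        finally have "norm (\<integral>v. complex_of_real (k v) * K n v \<partial>lborel) \<le> x powr (- a) * cx * (C * lpn p (K n))"
          using cx C by (simp add: ennreal_le_iff)
        then have "1 / c * norm (\<integral>v. complex_of_real (k v) * K n v \<partial>lborel) \<le> 1 / c * (x powr (- a) * cx * (C * lpn p (K n)))"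
          using c by (intro mult_left_mono) auto
        then show ?thesis unfolding J norm_mult using c by (simp add: norm_divide)
      qed
      moreover have "(\<lambda>n. 1 / c * (x powr (- a) * cx * (C * lpn p (K n)))) \<longlonglongrightarrow> 1 / c * (x powr (- a) * cx * (C * 0))"
        by (intro tendsto_intros K0)
      ultimately show ?thesis
        by (intro Lim_null_comparison[of J]) (auto intro: always_eventually)
    qed
    ultimately have "I = 0" by (rule LIMSEQ_unique)
    moreover have "I = (\<integral>t. complex_of_real (indicator {x<..} t * (t - x) ^ m) * u t \<partial>lborel)"
      unfolding I_def using x
      by (intro Bochner_Integration.integral_cong) (auto simp: w_def u_def split: split_indicator)
    ultimately show "(\<integral>t. complex_of_real (indicator {x<..} t * (t - x) ^ m) * u t \<partial>lborel) = 0" by simp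
  qed measurable
  then show ?thesis
    by eventually_elim (auto simp: u_def)
qed

lemma lpn_reflect: "lpn p (\<lambda>x. f (- x)) = lpn p f"
  unfolding lpn_def using lborel_integral_real_affine[of "-1" "\<lambda>x. norm (f x) powr p" 0] by simp

text \<open>The weighted derivatives are a Cauchy sequence in L^p. A pointwise limit
  \<open>U\<close> of a subsequence is shown to vanish on each half-line by
  \<open>weyl_limit_zero\<close>, and the Cauchy property then forces the norms to 0.\<close>

lemma weyl_closable:
  fixes K :: "nat \<Rightarrow> real \<Rightarrow> complex"
  assumes a: "0 \<le> a" and p: "1 < p" and K: "\<And>n. K n \<in> schwartz"
    and cau: "\<And>e. 0 < e \<Longrightarrow> \<exists>N. \<forall>m\<ge>N. \<forall>n\<ge>N. lpn p (wD a (\<lambda>x. K m x - K n x)) < e"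
    and K0: "(\<lambda>n. lpn p (K n)) \<longlonglongrightarrow> 0"
  shows "(\<lambda>n. lpn p (wD a (K n))) \<longlonglongrightarrow> 0"
proof (cases "a = 0")
  case True
  then show ?thesis using K0 by (simp add: lpn_wD_0[OF K])
next
  case False
  with a have a': "0 < a" by simp
  have p1: "1 \<le> p" using p by simp
  define u where "u n = wD a (K n)" for n
  have u_Lp: "in_Lp p (u n)" for n unfolding u_def by (rule wD_in_Lp[OF K a p1])
  note [measurable] = in_Lp_measurable[OF u_Lp]
  have diff: "wD a (\<lambda>x. K m x - K n x) = (\<lambda>t. u m t - u n t)" for m n
    unfolding u_def by (rule ext, rule wD_diff[OF K K a])
  note cau' = cau[unfolded diff]
  obtain C where C: "0 \<le> C" "\<And>u. in_Lp p u \<Longrightarrow> (\<integral>\<^sup>+t. ennreal (norm (u t) / (1 + \<bar>t\<bar>)) \<partial>lborel) \<le> ennreal (C * lpn p u)"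
    using weighted_L1_le_lpn[OF p] by blast
  \<comment> \<open>Division by 1 + |t| turns the Cauchy sequence in L^p into one in L^1, from which
    an almost everywhere convergent subsequence is extracted.\<close>
  define s where "s n t = u n t / complex_of_real (1 + \<bar>t\<bar>)" for n t
  have [measurable]: "s n \<in> borel_measurable borel" for n unfolding s_def by measurable
  have abs1: "norm (complex_of_real (1 + \<bar>t\<bar>)) = 1 + \<bar>t\<bar>" for t
    by (simp only: norm_of_real)
  have s_diff: "ennreal (norm (s i t - s j t)) = ennreal (norm (u i t - u j t) / (1 + \<bar>t\<bar>))" for i j t
    by (simp only: s_def diff_divide_distrib[symmetric] norm_divide abs1)
  have s_int: "integrable lborel (s n)" for n
  proof (rule integrableI_bounded)
    have "(\<integral>\<^sup>+t. ennreal (norm (s n t)) \<partial>lborel) = (\<integral>\<^sup>+t. ennreal (norm (u n t) / (1 + \<bar>t\<bar>)) \<partial>lborel)"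
      by (simp only: s_def norm_divide abs1)
    also have "\<dots> < \<infinity>" using C(2)[OF u_Lp[of n]] by (rule order_le_less_trans) simp
    finally show "(\<integral>\<^sup>+t. ennreal (norm (s n t)) \<partial>lborel) < \<infinity>" .
  qed measurable
  have s_nn: "(\<integral>\<^sup>+t. ennreal (norm (s i t - s j t)) \<partial>lborel) \<le> ennreal (C * lpn p (\<lambda>t. u i t - u j t))" for i j
    unfolding s_diff by (rule C(2)[OF in_Lp_diff[OF u_Lp u_Lp p1]])
  have s_cau: "\<exists>N. \<forall>i\<ge>N. \<forall>j\<ge>N. (\<integral>\<^sup>+t. ennreal (norm (s i t - s j t)) \<partial>lborel) < ennreal e" if e: "0 < e" for e
  proof -
    obtain N where N: "\<And>m n. N \<le> m \<Longrightarrow> N \<le> n \<Longrightarrow> lpn p (\<lambda>t. u m t - u n t) < e / (C + 1)"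
      using cau'[of "e / (C + 1)"] e C by (auto simp: add_nonneg_pos)
    have "(\<integral>\<^sup>+t. ennreal (norm (s i t - s j t)) \<partial>lborel) < ennreal e" if "N \<le> i" "N \<le> j" for i j
    proof -
      have "C * lpn p (\<lambda>t. u i t - u j t) \<le> C * (e / (C + 1))"
        using N[OF that] C by (intro mult_left_mono) auto
      also have "\<dots> < e" using e C by (simp add: field_simps)
      finally have "ennreal (C * lpn p (\<lambda>t. u i t - u j t)) < ennreal e"
        using e by (intro ennreal_lessI) auto
      then show ?thesis using s_nn[of i j] by (rule order_le_less_trans[rotated])
    qed
    then show ?thesis by blast
  qed
  obtain r where r: "strict_mono r" and AEc: "AE t in lborel. Cauchy (\<lambda>i. s (r i) t)"
  proof (rule cauchy_L1_AE_cauchy_subseq[OF s_int])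
    fix e :: real assume e: "0 < e"
    obtain N where N: "\<And>i j. N \<le> i \<Longrightarrow> N \<le> j \<Longrightarrow> (\<integral>\<^sup>+t. ennreal (norm (s i t - s j t)) \<partial>lborel) < ennreal e"
      using s_cau[OF e] by blast
    have "(LINT t|lborel. norm (s i t - s j t)) < e" if "N \<le> i" "N \<le> j" for i j
    proof -
      have "ennreal (LINT t|lborel. norm (s i t - s j t)) = (\<integral>\<^sup>+t. ennreal (norm (s i t - s j t)) \<partial>lborel)"
        using s_int by (intro nn_integral_eq_integral[symmetric] integrable_norm Bochner_Integration.integrable_diff) auto
      then show ?thesis using N[OF that] e by (metis ennreal_less_iff ennreal_lessI linorder_not_less ennreal_leI)
    qed
    then show "\<exists>N. \<forall>i\<ge>N. \<forall>j\<ge>N. (LINT t|lborel. norm (s i t - s j t)) < e" by blast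
  qed blast
  define U where "U t = lim (\<lambda>i. u (r i) t)" for t
  have [measurable]: "U \<in> borel_measurable borel" unfolding U_def[abs_def] by measurable
  have us: "u n t = s n t * complex_of_real (1 + \<bar>t\<bar>)" for n t
  proof -
    have "complex_of_real (1 + \<bar>t\<bar>) \<noteq> 0"
      using abs_ge_zero[of t] by (simp only: of_real_eq_0_iff)
    then show ?thesis by (simp add: s_def del: of_real_add)
  qed
  have AEu: "AE t in lborel. (\<lambda>i. u (r i) t) \<longlonglongrightarrow> U t"
    using AEc
  proof eventually_elim
    case (elim t)
    then obtain l where "(\<lambda>i. s (r i) t) \<longlonglongrightarrow> l" by (meson Cauchy_convergent convergentD)
    then have "(\<lambda>i. u (r i) t) \<longlonglongrightarrow> l * complex_of_real (1 + \<bar>t\<bar>)"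
      unfolding us by (intro tendsto_intros)
    then show ?case unfolding U_def by (simp only: limI)
  qed
  \<comment> \<open>Fatou's lemma: the weighted L^1 distance to \<open>U\<close> is at most the
    lower limit of the distances between members of the subsequence.\<close>
  have L1: "(\<lambda>i. \<integral>\<^sup>+t. ennreal (norm (u (r i) t - U t) / (1 + \<bar>t\<bar>)) \<partial>lborel) \<longlonglongrightarrow> 0"
  proof (rule order_tendstoI)
    fix y :: ennreal assume "0 < y"
    obtain e where e: "0 < e" "ennreal e < y"
    proof (cases y)
      case (real c)
      then have "0 < c" using \<open>0 < y\<close> by simp
      then show ?thesis using real by (intro that[of "c / 2"]) (auto simp: ennreal_less_iff)
    next
      case top
      then show ?thesis by (intro that[of 1]) auto
    qed
    obtain N where N: "\<And>i j. N \<le> i \<Longrightarrow> N \<le> j \<Longrightarrow> (\<integral>\<^sup>+t. ennreal (norm (s i t - s j t)) \<partial>lborel) < ennreal e"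
      using s_cau[OF e(1)] by blast
    have "(\<integral>\<^sup>+t. ennreal (norm (u (r i) t - U t) / (1 + \<bar>t\<bar>)) \<partial>lborel) < y" if i: "N \<le> i" for i
    proof -
      have "(\<integral>\<^sup>+t. ennreal (norm (u (r i) t - U t) / (1 + \<bar>t\<bar>)) \<partial>lborel) = (\<integral>\<^sup>+t. liminf (\<lambda>j. ennreal (norm (s (r i) t - s (r j) t))) \<partial>lborel)"
      proof (rule nn_integral_cong_AE, rule AE_mp[OF AEu], rule AE_I2, rule impI)
        fix t assume lim: "(\<lambda>i. u (r i) t) \<longlonglongrightarrow> U t"
        have "(\<lambda>j. ennreal (norm (u (r i) t - u (r j) t) / (1 + \<bar>t\<bar>))) \<longlonglongrightarrow> ennreal (norm (u (r i) t - U t) / (1 + \<bar>t\<bar>))"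
          by (intro tendsto_ennrealI tendsto_intros lim) auto
        then show "ennreal (norm (u (r i) t - U t) / (1 + \<bar>t\<bar>)) = liminf (\<lambda>j. ennreal (norm (s (r i) t - s (r j) t)))"
          unfolding s_diff by (rule lim_imp_Liminf[OF sequentially_bot, symmetric])
      qed
      also have "\<dots> \<le> liminf (\<lambda>j. \<integral>\<^sup>+t. ennreal (norm (s (r i) t - s (r j) t)) \<partial>lborel)"
        by (rule nn_integral_liminf) measurable
      also have "\<dots> \<le> ennreal e"
      proof (rule Liminf_le)
        show "\<forall>\<^sub>F j in sequentially. (\<integral>\<^sup>+t. ennreal (norm (s (r i) t - s (r j) t)) \<partial>lborel) \<le> ennreal e"
          using N i seq_suble[OF r] unfolding eventually_sequentially
          by (intro exI[of _ N]) (meson order_trans less_imp_le)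
      qed simp
      finally show ?thesis using e(2) by (rule order_le_less_trans)
    qed
    then show "\<forall>\<^sub>F i in sequentially. (\<integral>\<^sup>+t. ennreal (norm (u (r i) t - U t) / (1 + \<bar>t\<bar>)) \<partial>lborel) < y"
      unfolding eventually_sequentially by blast
  qed simp
  have K0r: "(\<lambda>n. lpn p (K (r n))) \<longlonglongrightarrow> 0"
    using LIMSEQ_subseq_LIMSEQ[OF K0 r] by (simp add: o_def)
  \<comment> \<open>The unimodular phase of \<open>weyl0\<close> on the positive half-line is
    divided out before the limit is identified.\<close>
  define \<omega> where "\<omega> = exp (\<i> * complex_of_real (pi * a))"
  have \<omega>: "norm \<omega> = 1" unfolding \<omega>_def by simp
  then have \<omega>0: "\<omega> \<noteq> 0" by auto
  have pos: "AE t in lborel. 0 < t \<longrightarrow> U t = 0"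
  proof -
    have "AE t in lborel. 0 < t \<longrightarrow> U t / \<omega> = 0"
    proof (rule weyl_limit_zero[OF a' p K K0r])
      have le: "(\<integral>\<^sup>+t. indicator {0<..} t * ennreal (norm (complex_of_real (t powr a) * weyl_plus a (K (r n)) t - U t / \<omega>) / (1 + \<bar>t\<bar>)) \<partial>lborel)
         \<le> (\<integral>\<^sup>+t. ennreal (norm (u (r n) t - U t) / (1 + \<bar>t\<bar>)) \<partial>lborel)" for n
      proof (intro nn_integral_mono)
        fix t
        show "indicator {0<..} t * ennreal (norm (complex_of_real (t powr a) * weyl_plus a (K (r n)) t - U t / \<omega>) / (1 + \<bar>t\<bar>))
           \<le> ennreal (norm (u (r n) t - U t) / (1 + \<bar>t\<bar>))"
        proof (cases "0 < t")
          case True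
          from \<omega>0 have "u (r n) t - U t = \<omega> * (complex_of_real (t powr a) * weyl_plus a (K (r n)) t - U t / \<omega>)"
            using True by (simp add: u_def wD_alt[OF K a] \<omega>_def[symmetric] right_diff_distrib del: of_real_mult)
          then have "norm (u (r n) t - U t) = norm (complex_of_real (t powr a) * weyl_plus a (K (r n)) t - U t / \<omega>)"
            by (simp only: norm_mult \<omega> mult_1)
          then show ?thesis using True by simp
        qed simp
      qed
      show "(\<lambda>n. \<integral>\<^sup>+t. indicator {0<..} t * ennreal (norm (complex_of_real (t powr a) * weyl_plus a (K (r n)) t - U t / \<omega>) / (1 + \<bar>t\<bar>)) \<partial>lborel) \<longlonglongrightarrow> 0"
        by (rule tendsto_sandwich[OF _ _ tendsto_const L1]) (auto intro: always_eventually le)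
    qed measurable
    then show ?thesis by eventually_elim (use \<omega>0 in auto)
  qed
  have neg: "AE t in lborel. 0 < t \<longrightarrow> U (- t) = 0"
  proof (rule weyl_limit_zero[OF a' p])
    show "(\<lambda>x. K (r n) (- x)) \<in> schwartz" for n by (rule schwartz_reflect[OF K])
    show "(\<lambda>n. lpn p (\<lambda>x. K (r n) (- x))) \<longlonglongrightarrow> 0" using K0r by (simp only: lpn_reflect)
    have le: "(\<integral>\<^sup>+t. indicator {0<..} t * ennreal (norm (complex_of_real (t powr a) * weyl_plus a (\<lambda>x. K (r n) (- x)) t - U (- t)) / (1 + \<bar>t\<bar>)) \<partial>lborel)
       \<le> (\<integral>\<^sup>+t. ennreal (norm (u (r n) t - U t) / (1 + \<bar>t\<bar>)) \<partial>lborel)" for n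
    proof -
      have "(\<integral>\<^sup>+t. indicator {0<..} t * ennreal (norm (complex_of_real (t powr a) * weyl_plus a (\<lambda>x. K (r n) (- x)) t - U (- t)) / (1 + \<bar>t\<bar>)) \<partial>lborel)
         \<le> (\<integral>\<^sup>+t. ennreal (norm (u (r n) (- t) - U (- t)) / (1 + \<bar>- t\<bar>)) \<partial>lborel)"
        by (intro nn_integral_mono) (auto simp: u_def wD_alt[OF K a] split: split_indicator)
      also have "\<dots> = (\<integral>\<^sup>+t. ennreal (norm (u (r n) t - U t) / (1 + \<bar>t\<bar>)) \<partial>lborel)"
        by (rule nn_integral_lborel_shift(3)) measurable
      finally show ?thesis .
    qed
    show "(\<lambda>n. \<integral>\<^sup>+t. indicator {0<..} t * ennreal (norm (complex_of_real (t powr a) * weyl_plus a (\<lambda>x. K (r n) (- x)) t - U (- t)) / (1 + \<bar>t\<bar>)) \<partial>lborel) \<longlonglongrightarrow> 0"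
      by (rule tendsto_sandwich[OF _ _ tendsto_const L1]) (auto intro: always_eventually le)
  qed measurable
  have neg': "AE t in lborel. t < 0 \<longrightarrow> U t = 0"
    using AE_borel_affine[of "-1" "\<lambda>t. 0 < t \<longrightarrow> U (- t) = 0" 0] neg by simp
  have U0: "AE t in lborel. U t = 0"
    using pos neg' AE_lborel_singleton[of 0] by eventually_elim (metis linorder_neqE)
  have conv0: "AE t in lborel. (\<lambda>i. u (r i) t) \<longlonglongrightarrow> 0"
    using AEu U0 by eventually_elim simp
  \<comment> \<open>Fatou's lemma again, now in L^p: as the subsequence tends to 0 pointwise, the
    norm of \<open>u n\<close> is at most the lower limit of its distances to the
    subsequence.\<close>
  have "\<exists>N. \<forall>n\<ge>N. norm (lpn p (u n) - 0) < e" if e: "0 < e" for e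
  proof -
    obtain N where N: "\<And>m n. N \<le> m \<Longrightarrow> N \<le> n \<Longrightarrow> lpn p (\<lambda>t. u m t - u n t) < e / 2"
      using cau'[of "e / 2"] e by auto
    have le: "lpn p (u n) \<le> e / 2" if n: "N \<le> n" for n
    proof (rule lpn_leI(2))
      have "(\<integral>\<^sup>+t. epow (ennreal (norm (u n t))) p \<partial>lborel) = (\<integral>\<^sup>+t. liminf (\<lambda>i. epow (ennreal (norm (u n t - u (r i) t))) p) \<partial>lborel)"
      proof (rule nn_integral_cong_AE, rule AE_mp[OF conv0], rule AE_I2, rule impI)
        fix t assume lim: "(\<lambda>i. u (r i) t) \<longlonglongrightarrow> 0"
        have "(\<lambda>i. ennreal (norm (u n t - u (r i) t) powr p)) \<longlonglongrightarrow> ennreal (norm (u n t - 0) powr p)"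
          using p by (intro tendsto_ennrealI tendsto_powr' tendsto_intros lim) auto
        from lim_imp_Liminf[OF sequentially_bot this]
        show "epow (ennreal (norm (u n t))) p = liminf (\<lambda>i. epow (ennreal (norm (u n t - u (r i) t))) p)"
          by simp
      qed
      also have "\<dots> \<le> liminf (\<lambda>i. \<integral>\<^sup>+t. epow (ennreal (norm (u n t - u (r i) t))) p \<partial>lborel)"
        by (rule nn_integral_liminf) measurable
      also have "\<dots> \<le> ennreal ((e / 2) powr p)"
      proof (rule Liminf_le)
        have "(\<integral>\<^sup>+t. epow (ennreal (norm (u n t - u (r i) t))) p \<partial>lborel) \<le> ennreal ((e / 2) powr p)" if "N \<le> i" for i
        proof -
          have "N \<le> r i" using seq_suble[OF r, of i] that by simp
          then have "lpn p (\<lambda>t. u n t - u (r i) t) powr p \<le> (e / 2) powr p"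
            using N[OF n, of "r i"] p by (intro powr_mono2) auto
          then show ?thesis
            using p by (subst nn_integral_eq_lpn[OF in_Lp_diff[OF u_Lp u_Lp p1]]) (auto intro: ennreal_leI)
        qed
        then show "\<forall>\<^sub>F i in sequentially. (\<integral>\<^sup>+t. epow (ennreal (norm (u n t - u (r i) t))) p \<partial>lborel) \<le> ennreal ((e / 2) powr p)"
          unfolding eventually_sequentially by blast
      qed simp
      finally show "(\<integral>\<^sup>+t. epow (ennreal (norm (u n t))) p \<partial>lborel) \<le> ennreal ((e / 2) powr p)" .
    qed (use p e in auto)
    have "norm (lpn p (u n) - 0) < e" if "N \<le> n" for n
      using le[OF that] e by simp
    then show ?thesis by blast
  qed
  then show ?thesis unfolding u_def[symmetric] by (intro LIMSEQ_I) auto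
qed

section \<open>The module structure\<close>

lemma lpn_cong_AE:
  assumes "u \<in> borel_measurable borel" "v \<in> borel_measurable borel" "AE t in lborel. u t = v t"
  shows "lpn p u = lpn p v"
proof -
  note [measurable] = assms(1,2)
  have "AE t in lborel. norm (u t) powr p = norm (v t) powr p"
    using assms(3) by eventually_elim simp
  then show ?thesis unfolding lpn_def by (subst integral_cong_AE) auto
qed

text \<open>Young's inequality makes the p-th power of the absolute convolution integrable, hence
  finite almost everywhere.\<close>

lemma nn_conv_finite_AE:
  fixes u w :: "real \<Rightarrow> ennreal"
  assumes p: "1 \<le> p" and [measurable]: "u \<in> borel_measurable borel" "w \<in> borel_measurable borel"
    and u: "(\<integral>\<^sup>+x. epow (u x) p \<partial>lborel) < top" and w: "(\<integral>\<^sup>+x. w x \<partial>lborel) < top"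
  shows "(\<integral>\<^sup>+x. epow (\<integral>\<^sup>+y. w y * u (x - y) \<partial>lborel) p \<partial>lborel) < top"
    and "AE x in lborel. (\<integral>\<^sup>+y. w y * u (x - y) \<partial>lborel) < top"
proof -
  obtain m where m: "0 \<le> m" "(\<integral>\<^sup>+x. w x \<partial>lborel) \<le> ennreal m"
    using w by (cases "\<integral>\<^sup>+x. w x \<partial>lborel") auto
  have "(\<integral>\<^sup>+x. epow (\<integral>\<^sup>+y. w y * u (x - y) \<partial>lborel) p \<partial>lborel) \<le> ennreal (m powr p) * (\<integral>\<^sup>+x. epow (u x) p \<partial>lborel)"
    by (rule young_nn_integral[OF p _ _ m(2,1)]) measurable
  also have "\<dots> < top" using u by (simp add: ennreal_mult_less_top)
  finally show fin: "(\<integral>\<^sup>+x. epow (\<integral>\<^sup>+y. w y * u (x - y) \<partial>lborel) p \<partial>lborel) < top" .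
  then have "AE x in lborel. epow (\<integral>\<^sup>+y. w y * u (x - y) \<partial>lborel) p \<noteq> \<infinity>"
    by (intro nn_integral_noteq_infinite) auto
  then show "AE x in lborel. (\<integral>\<^sup>+y. w y * u (x - y) \<partial>lborel) < top"
    by eventually_elim (metis epow_less_top_iff infinity_ennreal_def less_top)
qed

lemma in_Lp_nn_finite:
  assumes "in_Lp p f" "0 < p"
  shows "(\<integral>\<^sup>+x. epow (ennreal (norm (f x))) p \<partial>lborel) < top"
  by (simp only: nn_integral_eq_lpn[OF assms] ennreal_less_top)

lemma in_L1_nn_finite: "in_Lp 1 g \<Longrightarrow> (\<integral>\<^sup>+x. ennreal (norm (g x)) \<partial>lborel) < top"
  using in_Lp_nn_finite[of 1 g] by simp

lemma conv_integrable_AE: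
  assumes f: "in_Lp p f" and g: "in_Lp 1 g" and p: "1 \<le> p"
  shows "AE t in lborel. integrable lborel (\<lambda>s. f (t - s) * g s)"
proof -
  note [measurable] = in_Lp_measurable[OF f] in_Lp_measurable[OF g]
  have "AE t in lborel. (\<integral>\<^sup>+s. ennreal (norm (g s)) * ennreal (norm (f (t - s))) \<partial>lborel) < top"
    using p by (intro nn_conv_finite_AE(2)[OF p] in_Lp_nn_finite[OF f] in_L1_nn_finite[OF g]) auto
  then show ?thesis
  proof eventually_elim
    case (elim t)
    then show ?case by (intro integrableI_bounded) (auto simp: norm_mult ennreal_mult mult.commute)
  qed
qed

text \<open>Two applications of Young's inequality give, at almost every \<open>t\<close>, the
  absolute convergence that \<open>conv_assoc_at\<close> requires.\<close>

lemma conv_assoc_AE: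
  assumes f: "in_Lp p f" and g: "in_Lp 1 g" and h: "in_Lp 1 h" and p: "1 \<le> p"
  shows "AE t in lborel. conv (conv f g) h t = conv f (conv g h) t"
proof -
  note [measurable] = in_Lp_measurable[OF f] in_Lp_measurable[OF g] in_Lp_measurable[OF h]
  have "(\<integral>\<^sup>+x. epow (\<integral>\<^sup>+s. ennreal (norm (g s)) * ennreal (norm (f (x - s))) \<partial>lborel) p \<partial>lborel) < top"
    using p by (intro nn_conv_finite_AE(1)[OF p] in_Lp_nn_finite[OF f] in_L1_nn_finite[OF g]) auto
  then have "AE t in lborel. (\<integral>\<^sup>+r. ennreal (norm (h r)) *
      (\<integral>\<^sup>+s. ennreal (norm (g s)) * ennreal (norm (f (t - r - s))) \<partial>lborel) \<partial>lborel) < top"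
    by (intro nn_conv_finite_AE(2)[OF p, where u = "\<lambda>x. \<integral>\<^sup>+s. ennreal (norm (g s)) * ennreal (norm (f (x - s))) \<partial>lborel"]
        in_L1_nn_finite[OF h]) auto
  then show ?thesis by eventually_elim (rule conv_assoc_at, auto)
qed

lemma conv_linear_left_AE:
  assumes f: "in_Lp p f" and f': "in_Lp p f'" and g: "in_Lp 1 g" and p: "1 \<le> p"
  shows "AE t in lborel. conv (\<lambda>x. c * f x + f' x) g t = c * conv f g t + conv f' g t"
  using conv_integrable_AE[OF f g p] conv_integrable_AE[OF f' g p]
  by eventually_elim (simp add: conv_def distrib_right mult.assoc)

lemma conv_linear_right_AE:
  assumes f: "in_Lp p f" and g: "in_Lp 1 g" and g': "in_Lp 1 g'" and p: "1 \<le> p"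
  shows "AE t in lborel. conv f (\<lambda>x. c * g x + g' x) t = c * conv f g t + conv f g' t"
  using conv_integrable_AE[OF f g p] conv_integrable_AE[OF f g' p]
  by eventually_elim (simp add: conv_def distrib_left mult.left_commute)

lemma lpn_conv_diff_left:
  assumes f: "in_Lp p f" and f': "in_Lp p f'" and g: "in_Lp 1 g" and p: "1 \<le> p"
  shows "lpn p (\<lambda>x. conv f g x - conv f' g x) \<le> lpn p (\<lambda>x. f x - f' x) * lpn 1 g"
proof -
  note [measurable] = in_Lp_measurable[OF f] in_Lp_measurable[OF f'] in_Lp_measurable[OF g]
  have "AE t in lborel. conv f g t - conv f' g t = conv (\<lambda>x. f x - f' x) g t"
    using conv_integrable_AE[OF f g p] conv_integrable_AE[OF f' g p]
    by eventually_elim (simp add: conv_def left_diff_distrib)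
  then have "lpn p (\<lambda>x. conv f g x - conv f' g x) = lpn p (conv (\<lambda>x. f x - f' x) g)"
    by (intro lpn_cong_AE) auto
  then show ?thesis using lpn_conv(2)[OF in_Lp_diff[OF f f' p] g p] by simp
qed

lemma lpn_conv_diff_right:
  assumes f: "in_Lp p f" and g: "in_Lp 1 g" and g': "in_Lp 1 g'" and p: "1 \<le> p"
  shows "lpn p (\<lambda>x. conv f g x - conv f g' x) \<le> lpn p f * lpn 1 (\<lambda>x. g x - g' x)"
proof -
  note [measurable] = in_Lp_measurable[OF f] in_Lp_measurable[OF g] in_Lp_measurable[OF g']
  have "AE t in lborel. conv f g t - conv f g' t = conv f (\<lambda>x. g x - g' x) t"
    using conv_integrable_AE[OF f g p] conv_integrable_AE[OF f g' p]
    by eventually_elim (simp add: conv_def right_diff_distrib)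
  then have "lpn p (\<lambda>x. conv f g x - conv f g' x) = lpn p (conv f (\<lambda>x. g x - g' x))"
    by (intro lpn_cong_AE) auto
  then show ?thesis using lpn_conv(2)[OF f in_Lp_diff[OF g g' order_refl] p] by simp
qed

section \<open>Approximating sequences and the norm of the completion\<close>

lemma approx_seqD:
  assumes F: "approx_seq a p f F" and a: "0 \<le> a"
  shows "F n \<in> schwartz"
    and "0 < e \<Longrightarrow> \<exists>N. \<forall>m\<ge>N. \<forall>n\<ge>N. lpn p (wD a (\<lambda>x. F m x - F n x)) < e"
    and "in_Lp p f" and "(\<lambda>n. lpn p (\<lambda>x. F n x - f x)) \<longlonglongrightarrow> 0"
proof -
  have G: "0 < Gamma (a + 1)" using a by (intro Gamma_real_pos) simp
  show "F n \<in> schwartz" "in_Lp p f" "(\<lambda>n. lpn p (\<lambda>x. F n x - f x)) \<longlonglongrightarrow> 0"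
    using F by (auto simp: approx_seq_def lp_dist_eq)
  assume e: "0 < e"
  then have "0 < e / Gamma (a + 1)" using G by simp
  then obtain N where "\<forall>m\<ge>N. \<forall>n\<ge>N. tnorm a p (\<lambda>x. F m x - F n x) < e / Gamma (a + 1)"
    using F unfolding approx_seq_def by blast
  then show "\<exists>N. \<forall>m\<ge>N. \<forall>n\<ge>N. lpn p (wD a (\<lambda>x. F m x - F n x)) < e"
    using G by (intro exI[of _ N]) (auto simp: tnorm_eq divide_strict_right_mono_neg divide_less_cancel)
qed

lemma approx_seq_convergent:
  assumes F: "approx_seq a p f F" and a: "0 \<le> a" and p: "1 \<le> p"
  shows "convergent (\<lambda>n. lpn p (wD a (F n)))"
proof -
  note D = approx_seqD[OF F a]
  have "Cauchy (\<lambda>n. lpn p (wD a (F n)))"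
  proof (rule CauchyI)
    fix e :: real assume "0 < e"
    then obtain N where N: "\<And>m n. N \<le> m \<Longrightarrow> N \<le> n \<Longrightarrow> lpn p (wD a (\<lambda>x. F m x - F n x)) < e"
      using D(2) by blast
    have "norm (lpn p (wD a (F m)) - lpn p (wD a (F n))) < e" if "N \<le> m" "N \<le> n" for m n
    proof -
      have "\<bar>lpn p (wD a (F m)) - lpn p (wD a (F n))\<bar> \<le> lpn p (\<lambda>t. wD a (F m) t - wD a (F n) t)"
        by (intro lpn_diff_ineq wD_in_Lp D a p)
      also have "\<dots> = lpn p (wD a (\<lambda>x. F m x - F n x))" by (simp add: wD_diff[OF D(1) D(1) a, abs_def])
      also have "\<dots> < e" by (rule N[OF that])
      finally show ?thesis by simp
    qed
    then show "\<exists>M. \<forall>m\<ge>M. \<forall>n\<ge>M. norm (lpn p (wD a (F m)) - lpn p (wD a (F n))) < e" by blast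
  qed
  then show ?thesis by (rule Cauchy_convergent)
qed

text \<open>The difference of the two sequences is Cauchy in the weighted norm and tends to 0 in
  L^p, so closability applies. This makes \<open>T_norm\<close>, which rests on an arbitrary choice
  of sequence, independent of that choice.\<close>

lemma approx_seq_unique:
  assumes F: "approx_seq a p f F" and H: "approx_seq a p f H" and a: "0 \<le> a" and p: "1 < p"
  shows "(\<lambda>n. lpn p (wD a (F n)) - lpn p (wD a (H n))) \<longlonglongrightarrow> 0"
proof -
  have p1: "1 \<le> p" using p by simp
  note DF = approx_seqD[OF F a] and DH = approx_seqD[OF H a]
  define K where "K n = (\<lambda>x. F n x - H n x)" for n
  have K: "K n \<in> schwartz" for n unfolding K_def by (intro schwartz_diff DF DH)
  note Lp = schwartz_in_Lp[OF _ p1] wD_in_Lp[OF _ a p1]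
  have wK: "wD a (K n) = (\<lambda>t. wD a (F n) t - wD a (H n) t)" for n
    unfolding K_def by (rule ext) (rule wD_diff[OF DF(1) DH(1) a])
  have "(\<lambda>n. lpn p (wD a (K n))) \<longlonglongrightarrow> 0"
  proof (rule weyl_closable[OF a p K])
    fix e :: real assume e: "0 < e"
    obtain N1 where N1: "\<And>m n. N1 \<le> m \<Longrightarrow> N1 \<le> n \<Longrightarrow> lpn p (wD a (\<lambda>x. F m x - F n x)) < e / 2"
      using DF(2)[of "e / 2"] e by auto
    obtain N2 where N2: "\<And>m n. N2 \<le> m \<Longrightarrow> N2 \<le> n \<Longrightarrow> lpn p (wD a (\<lambda>x. H m x - H n x)) < e / 2"
      using DH(2)[of "e / 2"] e by auto
    have "lpn p (wD a (\<lambda>x. K m x - K n x)) < e" if "max N1 N2 \<le> m" "max N1 N2 \<le> n" for m n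
    proof -
      have "wD a (\<lambda>x. K m x - K n x) = (\<lambda>t. wD a (\<lambda>x. F m x - F n x) t + (- 1) * wD a (\<lambda>x. H m x - H n x) t)"
        by (rule ext) (simp add: wD_diff[OF K K a] wK wD_diff[OF DF(1) DF(1) a] wD_diff[OF DH(1) DH(1) a])
      then have "lpn p (wD a (\<lambda>x. K m x - K n x)) = lpn p (\<lambda>t. wD a (\<lambda>x. F m x - F n x) t + (- 1) * wD a (\<lambda>x. H m x - H n x) t)"
        by (simp only:)
      also have "\<dots> \<le> lpn p (wD a (\<lambda>x. F m x - F n x)) + lpn p (\<lambda>t. (- 1) * wD a (\<lambda>x. H m x - H n x) t)"
        using p by (intro lpn_triangle(2) in_Lp_scale(1) Lp schwartz_diff DF DH p1) auto
      also have "lpn p (\<lambda>t. (- 1) * wD a (\<lambda>x. H m x - H n x) t) = lpn p (wD a (\<lambda>x. H m x - H n x))"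
        by (simp add: lpn_def)
      also have "lpn p (wD a (\<lambda>x. F m x - F n x)) + \<dots> < e"
        using N1[of m n] N2[of m n] that by simp
      finally show ?thesis .
    qed
    then show "\<exists>N. \<forall>m\<ge>N. \<forall>n\<ge>N. lpn p (wD a (\<lambda>x. K m x - K n x)) < e" by blast
  next
    have "(\<lambda>n. lpn p (\<lambda>x. F n x - f x) + lpn p (\<lambda>x. H n x - f x)) \<longlonglongrightarrow> 0 + 0"
      by (intro tendsto_add DF DH)
    moreover have "norm (lpn p (K n)) \<le> lpn p (\<lambda>x. F n x - f x) + lpn p (\<lambda>x. H n x - f x)" for n
      using lpn_diff_triangle[OF Lp(1)[OF DF(1)[of n]] DF(3) Lp(1)[OF DH(1)[of n]] p1]
      by (simp add: K_def lpn_minus_commute[of p f])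
    ultimately show "(\<lambda>n. lpn p (K n)) \<longlonglongrightarrow> 0"
      by (intro Lim_null_comparison[of "\<lambda>n. lpn p (K n)"]) (auto intro: always_eventually)
  qed
  moreover have "norm (lpn p (wD a (F n)) - lpn p (wD a (H n))) \<le> lpn p (wD a (K n))" for n
    using lpn_diff_ineq[OF Lp(2)[OF DF(1)[of n]] Lp(2)[OF DH(1)[of n]] p1] by (simp add: wK)
  ultimately show ?thesis
    by (intro Lim_null_comparison[of "\<lambda>n. lpn p (wD a (F n)) - lpn p (wD a (H n))"]) (auto intro: always_eventually)
qed

text \<open>The difference of two products splits into F_m with G_m - G_n and F_m - F_n with G_n.
  The weighted norms of a Cauchy sequence are bounded, so the product estimate makes both parts
  small; Young's inequality identifies the L^p limit.\<close>

lemma approx_seq_conv: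
  assumes F: "approx_seq a p f F" and G: "approx_seq a 1 g G" and a: "0 \<le> a" and p: "1 \<le> p"
  shows "approx_seq a p (conv f g) (\<lambda>n. conv (F n) (G n))"
proof -
  note DF = approx_seqD[OF F a] and DG = approx_seqD[OF G a]
  have Gam: "0 < Gamma (a + 1)" using a by (intro Gamma_real_pos) simp
  obtain C where C: "0 \<le> C" "\<And>f g. f \<in> schwartz \<Longrightarrow> g \<in> schwartz \<Longrightarrow>
      lpn p (wD a (conv f g)) \<le> C * lpn p (wD a f) * lpn 1 (wD a g)"
    using lpn_wD_conv[OF a p] by blast
  obtain A where A: "0 < A" "\<And>n. lpn p (wD a (F n)) \<le> A"
    using approx_seq_convergent[OF F a p, THEN convergent_imp_Bseq] by (auto elim!: BseqE)
  obtain B where B: "0 < B" "\<And>n. lpn 1 (wD a (G n)) \<le> B"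
    using approx_seq_convergent[OF G a order_refl, THEN convergent_imp_Bseq] by (auto elim!: BseqE)
  define H where "H n = conv (F n) (G n)" for n
  have H: "H n \<in> schwartz" for n unfolding H_def by (intro schwartz_conv DF DG)
  have int: "integrable lborel (\<lambda>s. F m (t - s) * G n s)" for m n t
    by (rule schwartz_conv_integrable[OF DF(1) schwartz_tempered[OF DG(1)]])
  have cau: "\<exists>N. \<forall>m\<ge>N. \<forall>n\<ge>N. tnorm a p (\<lambda>x. H m x - H n x) < e" if e: "0 < e" for e
  proof -
    \<comment> \<open>\<open>C + 1\<close> keeps the denominator positive when \<open>C\<close> is
      0, \<open>A + B\<close> collects the two parts of the splitting, and the 2 makes the final
      inequality strict.\<close>
    define d where "d = e * Gamma (a + 1) / (2 * (C + 1) * (A + B))"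
    have d: "0 < d" using e Gam C A B by (simp add: d_def add_nonneg_pos)
    obtain N1 where N1: "\<And>m n. N1 \<le> m \<Longrightarrow> N1 \<le> n \<Longrightarrow> lpn p (wD a (\<lambda>x. F m x - F n x)) < d"
      using DF(2)[OF d] by blast
    obtain N2 where N2: "\<And>m n. N2 \<le> m \<Longrightarrow> N2 \<le> n \<Longrightarrow> lpn 1 (wD a (\<lambda>x. G m x - G n x)) < d"
      using DG(2)[OF d] by blast
    have "tnorm a p (\<lambda>x. H m x - H n x) < e" if "max N1 N2 \<le> m" "max N1 N2 \<le> n" for m n
    proof -
      define X where "X = conv (F m) (G n)"
      have X: "X \<in> schwartz" unfolding X_def by (intro schwartz_conv DF DG)
      have e1: "(\<lambda>x. H m x - X x) = conv (F m) (\<lambda>x. G m x - G n x)"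
        unfolding H_def X_def conv_def[abs_def] by (simp add: right_diff_distrib int)
      have e2: "(\<lambda>x. X x - H n x) = conv (\<lambda>x. F m x - F n x) (G n)"
        unfolding H_def X_def conv_def[abs_def] by (simp add: left_diff_distrib int)
      have "lpn p (wD a (\<lambda>x. H m x - H n x)) = lpn p (\<lambda>t. wD a (H m) t - wD a (H n) t)"
        by (simp add: wD_diff[OF H H a, abs_def])
      also have "\<dots> \<le> lpn p (\<lambda>t. wD a (H m) t - wD a X t) + lpn p (\<lambda>t. wD a X t - wD a (H n) t)"
        by (intro lpn_diff_triangle wD_in_Lp H X a p)
      also have "\<dots> = lpn p (wD a (conv (F m) (\<lambda>x. G m x - G n x))) + lpn p (wD a (conv (\<lambda>x. F m x - F n x) (G n)))"
        unfolding e1[symmetric] e2[symmetric] by (simp add: wD_diff[OF H X a, abs_def] wD_diff[OF X H a, abs_def])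
      also have "\<dots> \<le> C * lpn p (wD a (F m)) * lpn 1 (wD a (\<lambda>x. G m x - G n x)) + C * lpn p (wD a (\<lambda>x. F m x - F n x)) * lpn 1 (wD a (G n))"
        by (intro add_mono C schwartz_diff DF DG)
      also have "\<dots> \<le> C * A * d + C * d * B"
        using N1[of m n] N2[of m n] that A B C d by (intro add_mono mult_mono) auto
      also have "\<dots> = C * (d * (A + B))" by (simp add: algebra_simps)
      also have "\<dots> \<le> (C + 1) * (d * (A + B))" using d A B by (intro mult_right_mono) auto
      also have "\<dots> = e * Gamma (a + 1) / 2"
      proof -
        have "C + 1 \<noteq> 0" "A + B \<noteq> 0" using C A B by linarith+
        moreover have "c * (X / (2 * c * s) * s) = X / 2" if "c \<noteq> 0" "s \<noteq> 0" for c s X :: real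
          using that by simp
        ultimately show ?thesis unfolding d_def by blast
      qed
      also have "\<dots> < e * Gamma (a + 1)" using e Gam by simp
      finally show ?thesis using Gam by (simp add: tnorm_eq pos_divide_less_eq)
    qed
    then show ?thesis by blast
  qed
  have lim: "(\<lambda>n. lpn p (\<lambda>x. H n x - conv f g x)) \<longlonglongrightarrow> 0"
  proof -
    have le: "lpn p (\<lambda>x. H n x - conv f g x) \<le> (lpn p (\<lambda>x. F n x - f x) + lpn p f) * lpn 1 (\<lambda>x. G n x - g x) + lpn p (\<lambda>x. F n x - f x) * lpn 1 g" for n
    proof -
      note F_Lp = schwartz_in_Lp[OF DF(1)[of n] p] and G_Lp = schwartz_in_Lp[OF DG(1)[of n] order_refl]
      have "lpn p (F n) \<le> lpn p (\<lambda>x. F n x - f x) + lpn p f"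
        using lpn_diff_ineq[OF F_Lp DF(3) p] by simp
      moreover have "lpn p (\<lambda>x. H n x - conv f g x) \<le> lpn p (\<lambda>x. H n x - conv (F n) g x) + lpn p (\<lambda>x. conv (F n) g x - conv f g x)"
        by (intro lpn_diff_triangle schwartz_in_Lp H conv_in_Lp[OF F_Lp DG(3) p] conv_in_Lp[OF DF(3) DG(3) p] p)
      moreover have "lpn p (\<lambda>x. H n x - conv (F n) g x) \<le> lpn p (F n) * lpn 1 (\<lambda>x. G n x - g x)"
        unfolding H_def by (rule lpn_conv_diff_right[OF F_Lp G_Lp DG(3) p])
      moreover have "lpn p (\<lambda>x. conv (F n) g x - conv f g x) \<le> lpn p (\<lambda>x. F n x - f x) * lpn 1 g"
        by (rule lpn_conv_diff_left[OF F_Lp DF(3) DG(3) p])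
      ultimately show ?thesis
        using mult_right_mono[of "lpn p (F n)" "lpn p (\<lambda>x. F n x - f x) + lpn p f" "lpn 1 (\<lambda>x. G n x - g x)"] by simp
    qed
    have "(\<lambda>n. (lpn p (\<lambda>x. F n x - f x) + lpn p f) * lpn 1 (\<lambda>x. G n x - g x) + lpn p (\<lambda>x. F n x - f x) * lpn 1 g)
        \<longlonglongrightarrow> (0 + lpn p f) * 0 + 0 * lpn 1 g"
      by (intro tendsto_intros DF DG)
    then have lim0: "(\<lambda>n. (lpn p (\<lambda>x. F n x - f x) + lpn p f) * lpn 1 (\<lambda>x. G n x - g x) + lpn p (\<lambda>x. F n x - f x) * lpn 1 g) \<longlonglongrightarrow> 0"
      by simp
    show ?thesis
      by (rule Lim_null_comparison[OF always_eventually lim0]) (simp add: le)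
  qed
  show ?thesis
    unfolding approx_seq_def lp_dist_eq H_def[symmetric]
    using H cau lim conv_in_Lp[OF DF(3) DG(3) p] by blast
qed

text \<open>The sequence chosen for \<open>conv f g\<close> need not consist of convolutions;
  \<open>approx_seq_unique\<close> shows that its norms have the same limit. Each norm carries
  1/Gamma(a + 1) and two of them stand on the right, whence the factor
  \<open>Gamma (a + 1)\<close>.\<close>

lemma T_norm_conv_le:
  assumes a: "0 \<le> a" and p: "1 < p"
    and C: "\<And>f g. f \<in> schwartz \<Longrightarrow> g \<in> schwartz \<Longrightarrow>
      lpn p (wD a (conv f g)) \<le> C * lpn p (wD a f) * lpn 1 (wD a g)"
    and f: "f \<in> T_space a p" and g: "g \<in> T_space a 1"
  shows "T_norm a p (conv f g) \<le> C * Gamma (a + 1) * T_norm a p f * T_norm a 1 g"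
proof -
  have p1: "1 \<le> p" using p by simp
  have Gam: "0 < Gamma (a + 1)" using a by (intro Gamma_real_pos) simp
  define F where "F = (SOME F. approx_seq a p f F)"
  define G where "G = (SOME G. approx_seq a 1 g G)"
  define H where "H = (SOME H. approx_seq a p (conv f g) H)"
  have F: "approx_seq a p f F" unfolding F_def using f someI_ex[of "approx_seq a p f"] by (simp add: T_space_def)
  have G: "approx_seq a 1 g G" unfolding G_def using g someI_ex[of "approx_seq a 1 g"] by (simp add: T_space_def)
  have FG: "approx_seq a p (conv f g) (\<lambda>n. conv (F n) (G n))" by (rule approx_seq_conv[OF F G a p1])
  then have H: "approx_seq a p (conv f g) H" unfolding H_def by (rule someI[of "approx_seq a p (conv f g)"])
  obtain LF where LF: "(\<lambda>n. lpn p (wD a (F n))) \<longlonglongrightarrow> LF"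
    using approx_seq_convergent[OF F a p1] by (auto simp: convergent_def)
  obtain LG where LG: "(\<lambda>n. lpn 1 (wD a (G n))) \<longlonglongrightarrow> LG"
    using approx_seq_convergent[OF G a order_refl] by (auto simp: convergent_def)
  obtain LH where LH: "(\<lambda>n. lpn p (wD a (H n))) \<longlonglongrightarrow> LH"
    using approx_seq_convergent[OF H a p1] by (auto simp: convergent_def)
  have tnorm_lim: "(\<lambda>n. tnorm a q (X n)) \<longlonglongrightarrow> L / Gamma (a + 1)"
    if "(\<lambda>n. lpn q (wD a (X n))) \<longlonglongrightarrow> L" for q X L
    unfolding tnorm_eq using that Gam by (intro tendsto_intros) auto
  have T: "T_norm a p f = LF / Gamma (a + 1)" "T_norm a 1 g = LG / Gamma (a + 1)" "T_norm a p (conv f g) = LH / Gamma (a + 1)"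
    unfolding T_norm_def F_def[symmetric] G_def[symmetric] H_def[symmetric]
    by (intro limI tnorm_lim LF LG LH)+
  have "(\<lambda>n. lpn p (wD a (H n)) - (lpn p (wD a (H n)) - lpn p (wD a (conv (F n) (G n))))) \<longlonglongrightarrow> LH - 0"
    by (intro tendsto_diff LH approx_seq_unique[OF H FG a p])
  then have "(\<lambda>n. lpn p (wD a (conv (F n) (G n)))) \<longlonglongrightarrow> LH" by simp
  moreover have "(\<lambda>n. C * lpn p (wD a (F n)) * lpn 1 (wD a (G n))) \<longlonglongrightarrow> C * LF * LG"
    by (intro tendsto_intros LF LG)
  ultimately have "LH \<le> C * LF * LG"
    by (rule LIMSEQ_le) (use C approx_seqD(1)[OF F a] approx_seqD(1)[OF G a] in auto)
  then have "LH / Gamma (a + 1) \<le> C * LF * LG / Gamma (a + 1)" using Gam by (simp add: divide_right_mono)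
  also have "\<dots> = C * Gamma (a + 1) * (LF / Gamma (a + 1)) * (LG / Gamma (a + 1))" using Gam by simp
  finally show ?thesis unfolding T .
qed

text \<open>Elements are functions and not classes, and \<open>conv\<close> is 0 where its integral
  diverges, so the module laws are equalities almost everywhere. They follow from Young's inequality
  and membership from the product estimate; closability enters through the norm inequality.\<close>

theorem theorem4p3:
  fixes a p :: real
  assumes "1 < p" and "0 \<le> a"
  shows "(\<forall>f\<in>T_space a p. \<forall>g\<in>T_space a 1. \<forall>h\<in>T_space a 1.
            (AE t in lborel. conv (conv f g) h t = conv f (conv g h) t)) \<and>
         (\<forall>f\<in>T_space a p. \<forall>f'\<in>T_space a p. \<forall>g\<in>T_space a 1. \<forall>c::complex.
            AE t in lborel. conv (\<lambda>x. c * f x + f' x) g t = c * conv f g t + conv f' g t) \<and>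
         (\<forall>f\<in>T_space a p. \<forall>g\<in>T_space a 1. \<forall>g'\<in>T_space a 1. \<forall>c::complex.
            AE t in lborel. conv f (\<lambda>x. c * g x + g' x) t = c * conv f g t + conv f g' t) \<and>
         (\<exists>C. \<forall>f\<in>T_space a p. \<forall>g\<in>T_space a 1.
            conv f g \<in> T_space a p \<and>
            T_norm a p (conv f g) \<le> C * T_norm a p f * T_norm a 1 g)"
proof -
  have p: "1 \<le> p" using assms by simp
  have Lp: "in_Lp q f" if "f \<in> T_space a q" for q f
    using that by (auto simp: T_space_def approx_seq_def)
  obtain C where C: "\<And>f g. f \<in> schwartz \<Longrightarrow> g \<in> schwartz \<Longrightarrow>
      lpn p (wD a (conv f g)) \<le> C * lpn p (wD a f) * lpn 1 (wD a g)"
    using lpn_wD_conv[OF assms(2) p] by blast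
  have mem: "conv f g \<in> T_space a p" if "f \<in> T_space a p" "g \<in> T_space a 1" for f g
    using that approx_seq_conv[OF _ _ assms(2) p] unfolding T_space_def by blast
  have "\<forall>f\<in>T_space a p. \<forall>g\<in>T_space a 1. conv f g \<in> T_space a p \<and>
      T_norm a p (conv f g) \<le> C * Gamma (a + 1) * T_norm a p f * T_norm a 1 g"
    using mem T_norm_conv_le[OF assms(2,1) C] by blast
  moreover have "\<forall>f\<in>T_space a p. \<forall>g\<in>T_space a 1. \<forall>h\<in>T_space a 1.
      (AE t in lborel. conv (conv f g) h t = conv f (conv g h) t)"
    using conv_assoc_AE[OF _ _ _ p] Lp by blast
  moreover have "\<forall>f\<in>T_space a p. \<forall>f'\<in>T_space a p. \<forall>g\<in>T_space a 1. \<forall>c::complex.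
      AE t in lborel. conv (\<lambda>x. c * f x + f' x) g t = c * conv f g t + conv f' g t"
    using conv_linear_left_AE[OF _ _ _ p] Lp by blast
  moreover have "\<forall>f\<in>T_space a p. \<forall>g\<in>T_space a 1. \<forall>g'\<in>T_space a 1. \<forall>c::complex.
      AE t in lborel. conv f (\<lambda>x. c * g x + g' x) t = c * conv f g t + conv f g' t"
    using conv_linear_right_AE[OF _ _ _ p] Lp by blast
  ultimately show ?thesis by blast
qed

end
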